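(* Let $J=\begin{pmatrix}0&0&1\\0&1&0\\1&0&0\end{pmatrix}$, let $\mathcal{O}_7$ be the ring of integers of $\mathbb{Q}(i\sqrt7)$, and let $\Gamma=PU(J,\mathcal{O}_7)$. Let $R,I,M,T_v\in\Gamma$ be represented by $$R=\begin{pmatrix}1&0&0\\0&-1&0\\0&0&1\end{pmatrix},\quad I=\begin{pmatrix}0&0&1\\0&-1&0\\1&0&0\end{pmatrix},\quad M=\begin{pmatrix}i\sqrt7&0&4\\0&1&0\\2&0&-i\sqrt7\end{pmatrix},\quad T_v=\begin{pmatrix}1&0&i\sqrt7\\0&1&0\\0&0&1\end{pmatrix}.$$ Let $S$ be the stabilizer in $\Gamma$ of the mirror of $R$ (the complex line of $H^2_{\mathbb{C}}$ polar to $(0,1,0)$). Then: (a) the quotient of $S$ by the subgroup acting trivially on the mirror has the presentation $$\langle\iota,\mu,\upsilon\mid\iota^2,\ \mu^2,\ (\mu\upsilon\iota)^3\rangle,$$ and $S$ is a central extension of this group, with presentation $$\langle\iota,\mu,\upsilon,\rho\mid\iota^2,\ \mu^2,\ \rho^2,\ (\mu\upsilon\iota)^3\rho^{-1},\ [\rho,\iota],\ [\rho,\mu],\ [\rho,\upsilon]\rangle,$$ where $\iota,\mu,\upsilon,\rho$ correspond to $I,M,T_v,R$ respectively; (b) the action of $S$ on the mirror has precisely three orbits of points with non-trivial isotropy (modulo the subgroup acting trivially on the mirror), represented by the common fixed point of $I$ and $R$ on the mirror, the isolated fixed point of $M$, and the isolated fixed point of $MT_vI$.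
   Context: Write $\langle v,w\rangle=w^*Jv$ for $v,w\in\mathbb{C}^3$; this Hermitian form has signature $(2,1)$. $U(J)$ is the group of complex $3\times3$ matrices preserving this form, $U(J,\mathcal{O}_7)=U(J)\cap GL(3,\mathcal{O}_7)$, and $PU(J,\mathcal{O}_7)=U(J,\mathcal{O}_7)/\{\pm Id\}$; its elements are denoted by matrix representatives. The complex hyperbolic plane $H^2_{\mathbb{C}}$ is the set of complex lines in $\mathbb{C}^3$ spanned by vectors $v$ with $\langle v,v\rangle<0$. The complex line of $H^2_{\mathbb{C}}$ polar to $v$ (with $\langle v,v\rangle>0$) is the set of points represented by vectors in $v^\perp$. The mirror of a complex reflection is its fixed point set in $H^2_{\mathbb{C}}$, which is a complex line. *)

theory Defs
  imports "HOL-Analysis.Analysis" "HOL-Algebra.Group_Action"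
begin

section \<open>Group presentations\<close>

text \<open>A word is a list of letters \<open>(x, e)\<close>, where \<open>(x, True)\<close> stands for \<open>x\<close> and
  \<open>(x, False)\<close> for its inverse.\<close>

type_synonym 'x word = "('x \<times> bool) list"

definition cancels :: "'x word \<Rightarrow> 'x word \<Rightarrow> bool" where
  "cancels u w \<longleftrightarrow> (\<exists>a b x e. u = a @ [(x, e), (x, \<not> e)] @ b \<and> w = a @ b)"

definition words :: "'x set \<Rightarrow> 'x word set" where
  "words X = lists (X \<times> UNIV)"

definition free_rel :: "'x set \<Rightarrow> ('x word \<times> 'x word) set" where
  "free_rel X = {(u, w). u \<in> words X \<and> w \<in> words X \<and> equivclp cancels u w}"

definition free_group :: "'x set \<Rightarrow> 'x word set monoid" where
  "free_group X =
    \<lparr>carrier = words X // free_rel X,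
     mult = (\<lambda>A B. \<Union>a\<in>A. \<Union>b\<in>B. free_rel X `` {a @ b}),
     one = free_rel X `` {[]}\<rparr>"

definition free_gen :: "'x set \<Rightarrow> 'x \<Rightarrow> 'x word set" where
  "free_gen X x = free_rel X `` {[(x, True)]}"

definition normal_closure :: "('a, 'b) monoid_scheme \<Rightarrow> 'a set \<Rightarrow> 'a set" where
  "normal_closure G A = \<Inter>{N. N \<lhd> G \<and> A \<subseteq> N}"

text \<open>\<open>has_presentation G X Rels \<phi>\<close>: \<open>G\<close> has the presentation with generators \<open>X\<close> and relators
  \<open>Rels\<close> (elements of the free group on \<open>X\<close>), the generator \<open>x\<close> corresponding to \<open>\<phi> x\<close>.\<close>

definition has_presentation ::
    "('a, 'b) monoid_scheme \<Rightarrow> 'x set \<Rightarrow> 'x word set set \<Rightarrow> ('x \<Rightarrow> 'a) \<Rightarrow> bool" where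
  "has_presentation G X Rels \<phi> \<longleftrightarrow>
    Rels \<subseteq> carrier (free_group X) \<and>
    (\<exists>h \<in> iso (free_group X Mod normal_closure (free_group X) Rels) G.
      \<forall>x\<in>X. h (normal_closure (free_group X) Rels #>\<^bsub>free_group X\<^esub> free_gen X x) = \<phi> x)"

definition commutator :: "('a, 'b) monoid_scheme \<Rightarrow> 'a \<Rightarrow> 'a \<Rightarrow> 'a" where
  "commutator G a b = a \<otimes>\<^bsub>G\<^esub> b \<otimes>\<^bsub>G\<^esub> inv\<^bsub>G\<^esub> a \<otimes>\<^bsub>G\<^esub> inv\<^bsub>G\<^esub> b"

definition group_center :: "('a, 'b) monoid_scheme \<Rightarrow> 'a set" where
  "group_center G = {z \<in> carrier G. \<forall>g\<in>carrier G. z \<otimes>\<^bsub>G\<^esub> g = g \<otimes>\<^bsub>G\<^esub> z}"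

definition central_extension ::
    "('a, 'c) monoid_scheme \<Rightarrow> ('b, 'd) monoid_scheme \<Rightarrow> ('a \<Rightarrow> 'b) \<Rightarrow> bool" where
  "central_extension E Q p \<longleftrightarrow>
    group_hom E Q p \<and> p ` carrier E = carrier Q \<and> kernel E Q p \<subseteq> group_center E"

section \<open>The Hermitian form and the Picard modular group\<close>

definition matJ :: "complex^3^3" where
  "matJ = vector [vector [0, 0, 1],
                  vector [0, 1, 0],
                  vector [1, 0, 0]]"

definition herm :: "complex^3 \<Rightarrow> complex^3 \<Rightarrow> complex" where
  "herm v w = (\<Sum>i\<in>UNIV. cnj (w $ i) * (matJ *v v) $ i)"

definition i_sqrt7 :: complex where
  "i_sqrt7 = \<i> * complex_of_real (sqrt 7)"

definition Q_i_sqrt7 :: "complex set" where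
  "Q_i_sqrt7 = {of_rat a + of_rat b * i_sqrt7 | a b. True}"

definition O7 :: "complex set" where
  "O7 = {z \<in> Q_i_sqrt7. algebraic_int z}"

definition UJ :: "(complex^3^3) set" where
  "UJ = {A. \<forall>v w. herm (A *v v) (A *v w) = herm v w}"

definition mat_O7 :: "(complex^3^3) set" where
  "mat_O7 = {A. \<forall>i j. A $ i $ j \<in> O7}"

definition GL3_O7 :: "(complex^3^3) set" where
  "GL3_O7 = {A \<in> mat_O7. \<exists>B \<in> mat_O7. A ** B = mat 1 \<and> B ** A = mat 1}"

definition UJ_O7 :: "(complex^3^3) monoid" where
  "UJ_O7 = \<lparr>carrier = UJ \<inter> GL3_O7, mult = (**), one = mat 1\<rparr>"

definition pm_Id :: "(complex^3^3) set" where
  "pm_Id = {mat 1, - mat 1}"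

definition PUJ_O7 :: "(complex^3^3) set monoid" where
  "PUJ_O7 = UJ_O7 Mod pm_Id"

definition PU_class :: "complex^3^3 \<Rightarrow> (complex^3^3) set" where
  "PU_class A = pm_Id #>\<^bsub>UJ_O7\<^esub> A"

definition elR :: "(complex^3^3) set" where
  "elR = PU_class (vector [vector [1, 0, 0],
                           vector [0, -1, 0],
                           vector [0, 0, 1]])"

definition elI :: "(complex^3^3) set" where
  "elI = PU_class (vector [vector [0, 0, 1],
                           vector [0, -1, 0],
                           vector [1, 0, 0]])"

definition elM :: "(complex^3^3) set" where
  "elM = PU_class (vector [vector [i_sqrt7, 0, 4],
                           vector [0, 1, 0],
                           vector [2, 0, - i_sqrt7]])"

definition elTv :: "(complex^3^3) set" where
  "elTv = PU_class (vector [vector [1, 0, i_sqrt7],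
                           vector [0, 1, 0],
                           vector [0, 0, 1]])"

section \<open>The complex hyperbolic plane\<close>

text \<open>Note that \<open>herm v v\<close> is always real. Points are complex lines, as subsets of the vector
  space.\<close>

definition H2C :: "(complex^3) set set" where
  "H2C = {vec.span {v} | v. Re (herm v v) < 0}"

text \<open>The topology induced by the projection from the set of negative vectors.\<close>

definition H2C_topology :: "(complex^3) set topology" where
  "H2C_topology = topology (\<lambda>U. U \<subseteq> H2C \<and> open {v. vec.span {v} \<in> U})"

lemma openin_H2C_topology:
  "openin H2C_topology U \<longleftrightarrow> U \<subseteq> H2C \<and> open {v. vec.span {v} \<in> U}"
proof -
  have "istopology (\<lambda>U. U \<subseteq> H2C \<and> open {v. vec.span {v} \<in> U})"
    unfolding istopology_def
  proof (intro conjI allI impI)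
    fix S T :: "(complex^3) set set"
    assume "S \<subseteq> H2C \<and> open {v. vec.span {v} \<in> S}" "T \<subseteq> H2C \<and> open {v. vec.span {v} \<in> T}"
    then show "S \<inter> T \<subseteq> H2C" "open {v. vec.span {v} \<in> S \<inter> T}"
      using open_Int[of "{v. vec.span {v} \<in> S}" "{v. vec.span {v} \<in> T}"]
      by (auto simp: Collect_conj_eq)
  next
    fix K :: "(complex^3) set set set"
    assume K: "\<forall>S\<in>K. S \<subseteq> H2C \<and> open {v. vec.span {v} \<in> S}"
    then show "\<Union>K \<subseteq> H2C" by blast
    have "{v. vec.span {v} \<in> \<Union>K} = (\<Union>S\<in>K. {v. vec.span {v} \<in> S})" by blast
    with K show "open {v. vec.span {v} \<in> \<Union>K}" by auto
  qed
  then show ?thesis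
    by (simp add: H2C_topology_def topology_inverse')
qed

text \<open>An element of \<open>PUJ_O7\<close> is a coset \<open>{A, -A}\<close>, and both representatives map a line to the same
  line.\<close>

definition act :: "(complex^3^3) set \<Rightarrow> (complex^3) set \<Rightarrow> (complex^3) set" where
  "act g L = (\<Union>A\<in>g. (\<lambda>x. A *v x) ` L)"

definition fixed_points :: "(complex^3^3) set \<Rightarrow> (complex^3) set set" where
  "fixed_points g = {p \<in> H2C. act g p = p}"

definition isolated_fixed_points :: "(complex^3^3) set \<Rightarrow> (complex^3) set set" where
  "isolated_fixed_points g = fixed_points g - H2C_topology derived_set_of fixed_points g"

definition polar_line :: "complex^3 \<Rightarrow> (complex^3) set set" where
  "polar_line v = {p \<in> H2C. \<forall>x\<in>p. herm x v = 0}"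

section \<open>The stabilizer of the mirror\<close>

definition mirror_R :: "(complex^3) set set" where
  "mirror_R = fixed_points elR"

definition stab_mirror :: "(complex^3^3) set monoid" where
  "stab_mirror = PUJ_O7\<lparr>carrier := stabilizer PUJ_O7 (\<lambda>g P. act g ` P) mirror_R\<rparr>"

definition triv_mirror :: "(complex^3^3) set set" where
  "triv_mirror = {g \<in> carrier stab_mirror. \<forall>p\<in>mirror_R. act g p = p}"

definition quot_mirror :: "(complex^3^3) set set monoid" where
  "quot_mirror = stab_mirror Mod triv_mirror"

definition quot_proj :: "(complex^3^3) set \<Rightarrow> (complex^3^3) set set" where
  "quot_proj g = triv_mirror #>\<^bsub>stab_mirror\<^esub> g"

definition isotropy :: "(complex^3) set \<Rightarrow> (complex^3^3) set set monoid" where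
  "isotropy p = stab_mirror\<lparr>carrier := stabilizer stab_mirror act p\<rparr> Mod triv_mirror"

definition isotropic_points :: "(complex^3) set set" where
  "isotropic_points = {p \<in> mirror_R. carrier (isotropy p) \<noteq> {\<one>\<^bsub>isotropy p\<^esub>}}"

section \<open>The two presentations\<close>

datatype gen = Iota | Mu | Upsilon | Rho

definition gens_quot :: "gen set" where
  "gens_quot = {Iota, Mu, Upsilon}"

definition rels_quot :: "gen word set set" where
  "rels_quot =
    (let F = free_group gens_quot;
         \<iota> = free_gen gens_quot Iota; \<mu> = free_gen gens_quot Mu; \<upsilon> = free_gen gens_quot Upsilon
     in {\<iota> [^]\<^bsub>F\<^esub> (2::nat), \<mu> [^]\<^bsub>F\<^esub> (2::nat), (\<mu> \<otimes>\<^bsub>F\<^esub> \<upsilon> \<otimes>\<^bsub>F\<^esub> \<iota>) [^]\<^bsub>F\<^esub> (3::nat)})"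

definition gens_stab :: "gen set" where
  "gens_stab = {Iota, Mu, Upsilon, Rho}"

definition rels_stab :: "gen word set set" where
  "rels_stab =
    (let F = free_group gens_stab;
         \<iota> = free_gen gens_stab Iota; \<mu> = free_gen gens_stab Mu;
         \<upsilon> = free_gen gens_stab Upsilon; \<rho> = free_gen gens_stab Rho
     in {\<iota> [^]\<^bsub>F\<^esub> (2::nat), \<mu> [^]\<^bsub>F\<^esub> (2::nat), \<rho> [^]\<^bsub>F\<^esub> (2::nat),
         (\<mu> \<otimes>\<^bsub>F\<^esub> \<upsilon> \<otimes>\<^bsub>F\<^esub> \<iota>) [^]\<^bsub>F\<^esub> (3::nat) \<otimes>\<^bsub>F\<^esub> inv\<^bsub>F\<^esub> \<rho>,
         commutator F \<rho> \<iota>, commutator F \<rho> \<mu>, commutator F \<rho> \<upsilon>})"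

fun gen_elt :: "gen \<Rightarrow> (complex^3^3) set" where
  "gen_elt Iota = elI"
| "gen_elt Mu = elM"
| "gen_elt Upsilon = elTv"
| "gen_elt Rho = elR"

end

theory Submission
  imports Defs "HOL-Algebra.Generated_Groups"
begin

text \<open>A line in the mirror is spanned by a vector \<open>(i\<surd>7 w, 0, 1)\<close> with \<open>w\<close> in the upper half-plane, on
  which the stabilizer acts as \<open>\<Gamma>\<^sub>0(7)\<close> extended by the Fricke involution; \<open>I\<close>, \<open>M\<close> and \<open>T\<^sub>v\<close> become
  \<open>-1/(7w)\<close>, \<open>(7w - 4)/(14w - 7)\<close> and \<open>w + 1\<close>. The circles \<open>|w| = 1/\<surd>7\<close> and \<open>|w - 1/2| = 1/(2\<surd>7)\<close>
  and their translates cover the real line, which gives a descent on the lower left entry and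
  hence generation. Put \<open>\<tau> = M T\<^sub>v I\<close>, so that \<open>\<tau>\<^sup>3 = R\<close>. The elements \<open>I\<close>, \<open>M\<close>, \<open>\<tau>\<close> play ping-pong on
  the three complementary regions of the ideal triangle \<open>0, 1/2, \<infinity>\<close>, so that no alternating word in
  them acts trivially; this yields both presentations. A point with non-trivial isotropy is the
  root of an integral form \<open>7cw\<^sup>2 + kw + b\<close> with \<open>28bc - k\<^sup>2\<close> equal to \<open>3\<close> or \<open>28\<close>, and the same descent
  reduces these forms to the three stated ones.\<close>

section \<open>Free groups\<close>

text \<open>The relators become transparent once \<upsilon> is traded for \<tau>: the quotient is
  then a free product of cyclic groups of orders 2, 2 and 3, and S its central extension by the cube
  of \<tau>. The normal closure of the relators is never described directly. In any group satisfying
  them, each element is an alternating word, possibly times that cube; one statement about the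
  action then serves both groups, since exactly 1 and R act trivially on the mirror. The cosets of
  \<Gamma>_0(7) and of the Fricke involution are told apart by the determinant, 1 or -1, of the
  outer 2x2 block of the representative with middle entry 1. The values 3 and 28 come from the trace
  of a non-trivial element with a fixed point: in \<Gamma>_0(7) it is -1, 0 or 1, and 0 is
  impossible because -1 is not a square modulo 7; in the other coset it vanishes. The value 28 gives
  two orbits because it is attained by \<open>7 w^2 + 1\<close> and by the imprimitive form
  \<open>2 (7 w^2 - 7 w + 2)\<close>. That the three orbits differ is read off the ratios of
  imaginary parts along an orbit.\<close>

lemma words_append [simp]: "u @ w \<in> words X \<longleftrightarrow> u \<in> words X \<and> w \<in> words X"
  by (auto simp: words_def)

lemma equivclp_cancels_append:
  assumes "equivclp cancels u w"
  shows "equivclp cancels (a @ u @ b) (a @ w @ b)"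
  using assms
proof (induction rule: equivclp_induct)
  case base
  show ?case by simp
next
  case (step y z)
  have "cancels (a @ y' @ b) (a @ z' @ b)" if "cancels y' z'" for y' z' :: "'a word"
    using that unfolding cancels_def by (metis append.assoc)
  with step have "cancels (a @ y @ b) (a @ z @ b) \<or> cancels (a @ z @ b) (a @ y @ b)"
    by blast
  with step show ?case by (meson equivclp_into_equivclp)
qed

lemma equiv_free_rel: "equiv (words X) (free_rel X)"
proof (rule equivI)
  show "free_rel X \<subseteq> words X \<times> words X" by (auto simp: free_rel_def)
  show "refl_on (words X) (free_rel X)" by (auto simp: refl_on_def free_rel_def)
  show "sym (free_rel X)" by (auto simp: sym_def free_rel_def intro: equivclp_sym)
  show "trans (free_rel X)" by (auto simp: trans_def free_rel_def intro: equivclp_trans)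
qed

abbreviation fclass :: "'x set \<Rightarrow> 'x word \<Rightarrow> 'x word set" where
  "fclass X w \<equiv> free_rel X `` {w}"

lemma fclass_eq_iff:
  "u \<in> words X \<Longrightarrow> w \<in> words X \<Longrightarrow> fclass X u = fclass X w \<longleftrightarrow> equivclp cancels u w"
  using eq_equiv_class_iff[OF equiv_free_rel, of u X w] by (auto simp: free_rel_def)

lemma carrier_free_group: "carrier (free_group X) = fclass X ` words X"
  by (auto simp: free_group_def quotient_def)

lemma one_free_group: "\<one>\<^bsub>free_group X\<^esub> = fclass X []"
  by (simp add: free_group_def)

text \<open>The product in \<open>free_group\<close> is a union over all pairs of representatives;
  it collapses to one class because cancellation is stable under concatenation on both sides and the
  classes are inhabited.\<close>

lemma mult_free_group:
  assumes "u \<in> words X" "w \<in> words X"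
  shows "fclass X u \<otimes>\<^bsub>free_group X\<^esub> fclass X w = fclass X (u @ w)"
proof -
  have "fclass X (a @ b) = fclass X (u @ w)" if "a \<in> fclass X u" "b \<in> fclass X w" for a b
  proof -
    have a: "a \<in> words X" "equivclp cancels u a" and b: "b \<in> words X" "equivclp cancels w b"
      using that by (auto simp: free_rel_def)
    have "equivclp cancels (u @ w) (a @ w)"
      using equivclp_cancels_append[OF a(2), of "[]" w] by simp
    moreover have "equivclp cancels (a @ w) (a @ b)"
      using equivclp_cancels_append[OF b(2), of a "[]"] by simp
    ultimately show ?thesis
      using a b assms by (subst fclass_eq_iff) (auto intro: equivclp_trans equivclp_sym)
  qed
  moreover have "u \<in> fclass X u" "w \<in> fclass X w"
    using assms by (auto simp: free_rel_def)
  ultimately have "(\<Union>a\<in>fclass X u. \<Union>b\<in>fclass X w. fclass X (a @ b)) = fclass X (u @ w)"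
    (is "?L = ?R")
  proof -
    assume 1: "\<And>a b. a \<in> fclass X u \<Longrightarrow> b \<in> fclass X w \<Longrightarrow> fclass X (a @ b) = ?R"
      and 2: "u \<in> fclass X u" "w \<in> fclass X w"
    have "?L \<subseteq> ?R"
      by (intro UN_least) (simp only: 1 order_refl)
    moreover have "?R \<subseteq> ?L"
      using 2 by (meson UN_upper order_trans)
    ultimately show ?thesis by (rule equalityI)
  qed
  then show ?thesis
    by (simp add: free_group_def)
qed

definition inv_word :: "'x word \<Rightarrow> 'x word" where
  "inv_word w = rev (map (\<lambda>(x, e). (x, \<not> e)) w)"

lemma inv_word_words: "w \<in> words X \<Longrightarrow> inv_word w \<in> words X"
  by (auto simp: words_def inv_word_def lists_eq_set)

lemma inv_word_cancels: "equivclp cancels (inv_word w @ w) []"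
proof (induction w)
  case Nil
  then show ?case by (simp add: inv_word_def)
next
  case (Cons l w)
  obtain x e where l: "l = (x, e)" by force
  have "cancels (inv_word w @ [(x, \<not> e), (x, \<not> \<not> e)] @ w) (inv_word w @ w)"
    unfolding cancels_def by blast
  then have "equivclp cancels (inv_word (l # w) @ l # w) (inv_word w @ w)"
    by (intro r_into_equivclp) (simp add: inv_word_def l)
  then show ?case using Cons by (meson equivclp_trans)
qed

lemma Nil_words [simp]: "[] \<in> words X"
  by (simp add: words_def)

lemma group_free_group: "group (free_group X)"
proof (rule groupI)
  fix x y assume "x \<in> carrier (free_group X)" "y \<in> carrier (free_group X)"
  then show "x \<otimes>\<^bsub>free_group X\<^esub> y \<in> carrier (free_group X)"
    by (auto simp: carrier_free_group mult_free_group)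
next
  show "\<one>\<^bsub>free_group X\<^esub> \<in> carrier (free_group X)"
    by (auto simp: carrier_free_group one_free_group)
next
  fix x y z
  assume "x \<in> carrier (free_group X)" "y \<in> carrier (free_group X)" "z \<in> carrier (free_group X)"
  then show "x \<otimes>\<^bsub>free_group X\<^esub> y \<otimes>\<^bsub>free_group X\<^esub> z = x \<otimes>\<^bsub>free_group X\<^esub> (y \<otimes>\<^bsub>free_group X\<^esub> z)"
    by (auto simp: carrier_free_group mult_free_group)
next
  fix x assume "x \<in> carrier (free_group X)"
  then show "\<one>\<^bsub>free_group X\<^esub> \<otimes>\<^bsub>free_group X\<^esub> x = x"
    by (auto simp: carrier_free_group mult_free_group one_free_group)
next
  fix x assume "x \<in> carrier (free_group X)"
  then obtain w where w: "w \<in> words X" "x = fclass X w"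
    by (auto simp: carrier_free_group)
  then have "fclass X (inv_word w) \<otimes>\<^bsub>free_group X\<^esub> x = \<one>\<^bsub>free_group X\<^esub>"
    by (simp add: mult_free_group one_free_group inv_word_words fclass_eq_iff inv_word_cancels)
  then show "\<exists>y\<in>carrier (free_group X). y \<otimes>\<^bsub>free_group X\<^esub> x = \<one>\<^bsub>free_group X\<^esub>"
    by (rule bexI) (use inv_word_words[OF w(1)] in \<open>simp add: carrier_free_group\<close>)
qed

lemma free_gen_carrier: "x \<in> X \<Longrightarrow> free_gen X x \<in> carrier (free_group X)"
  by (auto simp: free_gen_def carrier_free_group words_def)

lemma generate_free_gen: "generate (free_group X) (free_gen X ` X) = carrier (free_group X)"
proof
  interpret group "free_group X" by (rule group_free_group)
  have "free_gen X ` X \<subseteq> carrier (free_group X)"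
    by (rule image_subsetI) (rule free_gen_carrier)
  then show "generate (free_group X) (free_gen X ` X) \<subseteq> carrier (free_group X)"
    by (rule generate_incl)
  show "carrier (free_group X) \<subseteq> generate (free_group X) (free_gen X ` X)"
  proof
    fix g assume "g \<in> carrier (free_group X)"
    then obtain w where w: "w \<in> words X" "g = fclass X w"
      by (auto simp: carrier_free_group)
    have "fclass X w \<in> generate (free_group X) (free_gen X ` X)"
      using w(1)
    proof (induction w)
      case Nil
      show ?case using generate.one[of "free_group X"] by (simp only: one_free_group)
    next
      case (Cons l w)
      obtain x e where l: "l = (x, e)" by force
      have x: "x \<in> X" and w: "w \<in> words X" using Cons.prems l by (auto simp: words_def)
      have ww: "[(x, True)] \<in> words X" "[(x, False)] \<in> words X" using x by (auto simp: words_def)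
      have "cancels [(x, False), (x, True)] []"
        unfolding cancels_def by force
      then have "fclass X [(x, False)] \<otimes>\<^bsub>free_group X\<^esub> free_gen X x = \<one>\<^bsub>free_group X\<^esub>"
        using ww by (subst free_gen_def, subst mult_free_group)
          (auto simp: one_free_group words_def fclass_eq_iff r_into_equivclp)
      then have "fclass X [(x, False)] = inv\<^bsub>free_group X\<^esub> free_gen X x"
        by (intro inv_equality[symmetric] free_gen_carrier[OF x])
          (use ww in \<open>simp_all add: carrier_free_group\<close>)
      then have "fclass X [l] \<in> generate (free_group X) (free_gen X ` X)"
        using x l by (cases e) (auto intro: generate.intros simp: free_gen_def[symmetric])
      moreover have "fclass X (l # w) = fclass X [l] \<otimes>\<^bsub>free_group X\<^esub> fclass X w"
        using ww l w by (cases e) (auto simp: mult_free_group)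
      ultimately show ?case using Cons.IH[OF w] generate.eng by metis
    qed
    with w show "g \<in> generate (free_group X) (free_gen X ` X)" by simp
  qed
qed

section \<open>Evaluation of words and the universal property\<close>

definition word_eval :: "('a, 'b) monoid_scheme \<Rightarrow> ('x \<Rightarrow> 'a) \<Rightarrow> 'x word \<Rightarrow> 'a" where
  "word_eval G \<phi> w =
    foldr (\<lambda>(x, e) a. (if e then \<phi> x else inv\<^bsub>G\<^esub> (\<phi> x)) \<otimes>\<^bsub>G\<^esub> a) w \<one>\<^bsub>G\<^esub>"

context group
begin

lemma l_inv_assoc: "x \<in> carrier G \<Longrightarrow> y \<in> carrier G \<Longrightarrow> inv x \<otimes> (x \<otimes> y) = y"
  by (simp add: m_assoc[symmetric])

lemma r_inv_assoc: "x \<in> carrier G \<Longrightarrow> y \<in> carrier G \<Longrightarrow> x \<otimes> (inv x \<otimes> y) = y"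
  by (simp add: m_assoc[symmetric])

lemma word_eval_simps [simp]:
  "word_eval G \<phi> [] = \<one>"
  "word_eval G \<phi> ((x, e) # w) = (if e then \<phi> x else inv (\<phi> x)) \<otimes> word_eval G \<phi> w"
  by (simp_all add: word_eval_def)

lemma word_eval_closed:
  assumes "\<And>x. \<phi> x \<in> carrier G"
  shows "word_eval G \<phi> w \<in> carrier G"
proof (induction w)
  case (Cons l w)
  with assms show ?case by (cases l) auto
qed simp

lemma word_eval_append:
  assumes "\<And>x. \<phi> x \<in> carrier G"
  shows "word_eval G \<phi> (u @ w) = word_eval G \<phi> u \<otimes> word_eval G \<phi> w"
proof (induction u)
  case Nil
  then show ?case by (simp add: word_eval_closed[OF assms])
next
  case (Cons l u)
  then show ?case
    by (cases l) (simp add: word_eval_closed[OF assms] m_assoc assms)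
qed

lemma word_eval_cong:
  assumes "\<And>x. \<phi> x \<in> carrier G" "equivclp cancels u w"
  shows "word_eval G \<phi> u = word_eval G \<phi> w"
proof -
  have "word_eval G \<phi> u = word_eval G \<phi> w" if "cancels u w" for u w
    using that unfolding cancels_def
    by (auto simp: word_eval_append[OF assms(1)] word_eval_closed[OF assms(1)]
        assms(1) m_assoc l_inv_assoc r_inv_assoc)
  with assms(2) show ?thesis
    by (induction rule: equivclp_induct) metis+
qed

lemma free_group_universal:
  assumes "\<And>x. x \<in> X \<Longrightarrow> \<phi> x \<in> carrier G"
  obtains h where "h \<in> hom (free_group X) G" "\<And>x. x \<in> X \<Longrightarrow> h (free_gen X x) = \<phi> x"
proof
  \<comment> \<open>A chain of cancellations between two words over \<open>X\<close> may pass
    through letters outside \<open>X\<close>, so evaluation needs a value in the group at every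
    letter.\<close>
  define \<psi> where "\<psi> x = (if x \<in> X then \<phi> x else \<one>)" for x
  have \<psi>: "\<psi> x \<in> carrier G" for x
    using assms by (simp add: \<psi>_def)
  define h where "h A = the_elem (word_eval G \<psi> ` A)" for A
  have h: "h (fclass X w) = word_eval G \<psi> w" if "w \<in> words X" for w
  proof -
    have "word_eval G \<psi> ` fclass X w = {word_eval G \<psi> w}"
      using that word_eval_cong[OF \<psi>] by (fastforce simp: free_rel_def)
    then show ?thesis by (simp add: h_def)
  qed
  show "h \<in> hom (free_group X) G"
    by (rule homI) (auto simp: carrier_free_group mult_free_group h word_eval_append[OF \<psi>]
        word_eval_closed[OF \<psi>])
  show "h (free_gen X x) = \<phi> x" if "x \<in> X" for x
    using that assms by (simp add: free_gen_def h words_def \<psi>_def)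
qed

section \<open>Normal closures and a criterion for presentations\<close>

lemma normal_normal_closure:
  assumes "A \<subseteq> carrier G"
  shows "normal_closure G A \<lhd> G"
proof -
  have "carrier G \<lhd> G"
    by (simp add: normal_inv_iff subgroup_self)
  \<comment> \<open>The intersection of an empty family would be the whole type.\<close>
  then have ne: "{N. N \<lhd> G \<and> A \<subseteq> N} \<noteq> {}" using assms by blast
  have "subgroup (\<Inter>{N. N \<lhd> G \<and> A \<subseteq> N}) G"
    by (rule subgroups_Inter) (use ne in \<open>auto dest: normal_imp_subgroup\<close>)
  then show ?thesis
    unfolding normal_closure_def normal_inv_iff
    by (auto simp: normal_inv_iff)
qed

end

lemma subset_normal_closure: "A \<subseteq> normal_closure G A"
  by (auto simp: normal_closure_def)

lemma normal_closure_subset: "N \<lhd> G \<Longrightarrow> A \<subseteq> N \<Longrightarrow> normal_closure G A \<subseteq> N"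
  by (auto simp: normal_closure_def)

text \<open>Injectivity is asked in a form free of cosets: a homomorphism into \<open>G\<close> from
  a group \<open>K\<close> that is generated by images of the generators and satisfies the relators
  has trivial kernel. The type of \<open>K\<close> is that of the free group modulo the normal
  closure, the one instance used.\<close>

lemma (in group) has_presentationI:
  fixes X :: "'x set" and Rels
  defines "F \<equiv> free_group X"
  assumes Rels: "Rels \<subseteq> carrier F"
    and \<phi>: "\<phi> ` X \<subseteq> carrier G" "generate G (\<phi> ` X) = carrier G"
    and rel: "\<And>h r. h \<in> hom F G \<Longrightarrow> (\<And>x. x \<in> X \<Longrightarrow> h (free_gen X x) = \<phi> x) \<Longrightarrow> r \<in> Rels \<Longrightarrow> h r = \<one>"
    and inj: "\<And>(K :: 'x word set set monoid) p f g. group K \<Longrightarrow> p \<in> hom F K \<Longrightarrow>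
      generate K (p ` free_gen X ` X) = carrier K \<Longrightarrow> (\<And>r. r \<in> Rels \<Longrightarrow> p r = \<one>\<^bsub>K\<^esub>) \<Longrightarrow>
      f \<in> hom K G \<Longrightarrow> (\<And>x. x \<in> X \<Longrightarrow> f (p (free_gen X x)) = \<phi> x) \<Longrightarrow>
      g \<in> carrier K \<Longrightarrow> f g = \<one> \<Longrightarrow> g = \<one>\<^bsub>K\<^esub>"
  shows "has_presentation G X Rels \<phi>"
proof -
  interpret F: group F unfolding F_def by (rule group_free_group)
  obtain h where h: "h \<in> hom F G" "\<And>x. x \<in> X \<Longrightarrow> h (free_gen X x) = \<phi> x"
    using free_group_universal[of X \<phi>] \<phi>(1) unfolding F_def by blast
  interpret h: group_hom F G h
    by unfold_locales (rule h(1))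
  let ?N = "normal_closure F Rels"
  have gen: "free_gen X x \<in> carrier F" if "x \<in> X" for x
    using that unfolding F_def by (rule free_gen_carrier)
  have N: "?N \<lhd> F" by (rule F.normal_normal_closure[OF Rels])
  have sub: "?N \<subseteq> kernel F G h"
    by (rule normal_closure_subset[OF h.normal_kernel])
      (use Rels rel[OF h] in \<open>auto simp: kernel_def\<close>)
  have "h ` carrier F = carrier G"
  proof
    show "h ` carrier F \<subseteq> carrier G" by auto
    have "generate G (\<phi> ` X) \<subseteq> h ` carrier F"
      by (rule generate_subgroup_incl[OF _ h.img_is_subgroup]) (use gen h(2) in force)
    with \<phi>(2) show "carrier G \<subseteq> h ` carrier F" by simp
  qed
  then have iso: "(\<lambda>A. the_elem (h ` A)) \<in> iso (F Mod kernel F G h) G"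
    by (rule h.FactGroup_iso_set)
  obtain f where f: "f \<in> hom (F Mod ?N) G" "\<And>x. x \<in> carrier F \<Longrightarrow> f (?N #>\<^bsub>F\<^esub> x) = h x"
    using h.FactGroup_universal_kernel[OF N sub] by blast
  have "kernel F G h \<subseteq> ?N"
  proof
    fix x assume x: "x \<in> kernel F G h"
    \<comment> \<open>With \<open>K\<close> this quotient, an element of the kernel of
      \<open>h\<close> becomes trivial, which places it in the normal closure.\<close>
    let ?p = "\<lambda>g. ?N #>\<^bsub>F\<^esub> g"
    interpret K: group "F Mod ?N" by (rule normal.factorgroup_is_group[OF N])
    interpret p: group_hom F "F Mod ?N" ?p
      using normal.r_coset_hom_Mod[OF N] by unfold_locales
    have "free_gen X ` X \<subseteq> carrier F" by (rule image_subsetI) (rule gen)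
    from p.generate_img[OF this]
    have "generate (F Mod ?N) (?p ` free_gen X ` X) = carrier (F Mod ?N)"
      using generate_free_gen[of X] by (simp add: F_def carrier_FactGroup)
    moreover have "?p r = \<one>\<^bsub>F Mod ?N\<^esub>" if "r \<in> Rels" for r
      using that Rels subset_normal_closure[of Rels F]
      by (simp add: one_FactGroup) (intro F.coset_join2 normal_imp_subgroup[OF N]; blast)
    moreover have "f (?p (free_gen X x)) = \<phi> x" if "x \<in> X" for x
      by (simp only: f(2) gen h(2) that)
    moreover have xF: "x \<in> carrier F" "h x = \<one>" using x by (auto simp: kernel_def)
    moreover from xF have "?p x \<in> carrier (F Mod ?N)" "f (?p x) = \<one>"
      by (simp_all only: carrier_FactGroup imageI f(2))
    ultimately have "?p x = \<one>\<^bsub>F Mod ?N\<^esub>"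
      using inj[OF K.is_group p.homh _ _ f(1)] by blast
    then have "?N #>\<^bsub>F\<^esub> x = ?N" by (simp add: one_FactGroup)
    moreover have "x \<in> ?N #>\<^bsub>F\<^esub> x"
      using x N by (intro F.rcos_self) (auto simp: kernel_def normal_imp_subgroup)
    ultimately show "x \<in> ?N" by simp
  qed
  with sub have k: "kernel F G h = ?N" by blast
  have "the_elem (h ` (?N #>\<^bsub>F\<^esub> free_gen X x)) = \<phi> x" if "x \<in> X" for x
  proof -
    have "h y = \<phi> x" if "y \<in> ?N #>\<^bsub>F\<^esub> free_gen X x" for y
    proof -
      obtain n where n: "n \<in> kernel F G h" "y = n \<otimes>\<^bsub>F\<^esub> free_gen X x"
        using \<open>y \<in> _\<close> k by (auto simp: r_coset_def)
      then show ?thesis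
        using gen[OF \<open>x \<in> X\<close>] h(2)[OF \<open>x \<in> X\<close>] \<phi>(1) \<open>x \<in> X\<close>
        by (auto simp: kernel_def image_subset_iff)
    qed
    moreover have "free_gen X x \<in> ?N #>\<^bsub>F\<^esub> free_gen X x"
      using gen[OF that] N by (intro F.rcos_self) (auto simp: normal_imp_subgroup)
    ultimately have "h ` (?N #>\<^bsub>F\<^esub> free_gen X x) = {\<phi> x}" by (auto simp: image_iff)
    then show ?thesis by simp
  qed
  with iso k Rels show ?thesis
    unfolding has_presentation_def F_def[symmetric]
    by (intro conjI bexI[of _ "\<lambda>A. the_elem (h ` A)"]) simp_all
qed

section \<open>Normal forms\<close>

text \<open>Normal forms for the central extension \<open>\<langle>i, m, t | i\<^sup>2, m\<^sup>2, t\<^sup>6\<rangle>\<close> with \<open>t\<^sup>3\<close> central, of the free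
  product of two groups of order two and one of order three: \<open>LT'\<close> is the inverse of \<open>LT\<close>.\<close>

datatype letter = LI | LM | LT | LT'

fun letter_factor :: "letter \<Rightarrow> nat" where
  "letter_factor LI = 0" | "letter_factor LM = 1"
| "letter_factor LT = 2" | "letter_factor LT' = 2"

abbreviation alternating :: "letter list \<Rightarrow> bool" where
  "alternating \<equiv> successively (\<lambda>k l. letter_factor k \<noteq> letter_factor l)"

fun letter_val :: "('a, 'b) monoid_scheme \<Rightarrow> 'a \<Rightarrow> 'a \<Rightarrow> 'a \<Rightarrow> letter \<Rightarrow> 'a" where
  "letter_val G i m t LI = i" | "letter_val G i m t LM = m"
| "letter_val G i m t LT = t" | "letter_val G i m t LT' = inv\<^bsub>G\<^esub> t"

definition letters_prod :: "('a, 'b) monoid_scheme \<Rightarrow> 'a \<Rightarrow> 'a \<Rightarrow> 'a \<Rightarrow> letter list \<Rightarrow> 'a" where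
  "letters_prod G i m t L = foldr (\<lambda>l a. letter_val G i m t l \<otimes>\<^bsub>G\<^esub> a) L \<one>\<^bsub>G\<^esub>"

lemma letters_prod_simps [simp]:
  "letters_prod G i m t [] = \<one>\<^bsub>G\<^esub>"
  "letters_prod G i m t (l # L) = letter_val G i m t l \<otimes>\<^bsub>G\<^esub> letters_prod G i m t L"
  by (simp_all add: letters_prod_def)

text \<open>One interface for both groups: the central cube of \<open>t\<close> may be trivial, as
  over the quotient, or an involution, as over the stabilizer.\<close>

locale torsion_triple = group +
  fixes i m t
  assumes carr [simp]: "i \<in> carrier G" "m \<in> carrier G" "t \<in> carrier G"
    and sq: "i \<otimes> i = \<one>" "m \<otimes> m = \<one>"
    and central: "\<And>x. x \<in> carrier G \<Longrightarrow> (t \<otimes> t \<otimes> t) \<otimes> x = x \<otimes> (t \<otimes> t \<otimes> t)"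
    and r2: "(t \<otimes> t \<otimes> t) \<otimes> (t \<otimes> t \<otimes> t) = \<one>"
    and gen: "generate G {i, m, t} = carrier G"
begin

abbreviation "r \<equiv> t \<otimes> t \<otimes> t"
abbreviation "val \<equiv> letter_val G i m t"
abbreviation "lprod \<equiv> letters_prod G i m t"

lemma val_closed [simp]: "val l \<in> carrier G"
  by (cases l) auto

lemma lprod_closed [simp]: "lprod L \<in> carrier G"
  by (induction L) auto

definition normal_forms :: "'a set" where
  "normal_forms = {x. \<exists>L. alternating L \<and> (x = lprod L \<or> x = r \<otimes> lprod L)}"

lemma r_normal_forms: "x \<in> normal_forms \<Longrightarrow> r \<otimes> x \<in> normal_forms"
proof -
  have "r \<otimes> (r \<otimes> lprod L) = lprod L" for L
    using r2 by (subst m_assoc[symmetric]) auto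
  then show "x \<in> normal_forms \<Longrightarrow> r \<otimes> x \<in> normal_forms"
    unfolding normal_forms_def by auto
qed

text \<open>Since \<open>t^3 = r\<close> is central with square one, \<open>t t = r t^-1\<close> and
  \<open>t^-1 t^-1 = r t\<close>. Hence two adjacent letters of one factor cancel or merge into a
  single letter of that factor, at the price of \<open>r\<close>.\<close>

lemma val_val_cancel:
  assumes "letter_factor k = letter_factor l" "x \<in> carrier G"
  shows "val k \<otimes> (val l \<otimes> x) \<in> {x, r \<otimes> (val LT' \<otimes> x), r \<otimes> (val LT \<otimes> x)}"
proof -
  have 1: "t \<otimes> (t \<otimes> x) = r \<otimes> (inv t \<otimes> x)"
    using assms(2) by (simp add: m_assoc r_inv_assoc)
  \<comment> \<open>Inserting \<open>r r = 1\<close> supplies three factors \<open>t\<close>, two of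
    which absorb the inverses.\<close>
  have "inv t \<otimes> (inv t \<otimes> x) = r \<otimes> (r \<otimes> (inv t \<otimes> (inv t \<otimes> x)))"
    using assms(2) r2 by (subst (2) m_assoc[symmetric]) auto
  also have "\<dots> = r \<otimes> (t \<otimes> x)"
    using assms(2) by (simp add: m_assoc r_inv_assoc)
  finally have 2: "inv t \<otimes> (inv t \<otimes> x) = r \<otimes> (t \<otimes> x)" .
  have "i \<otimes> (i \<otimes> x) = x" "m \<otimes> (m \<otimes> x) = x"
    using assms(2) sq by (simp_all add: m_assoc[symmetric])
  with assms 1 2 show ?thesis
    by (cases k; cases l) (auto simp: l_inv_assoc r_inv_assoc)
qed

lemma val_lprod_normal_forms: "alternating L \<Longrightarrow> val l \<otimes> lprod L \<in> normal_forms"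
proof (cases L)
  case Nil
  then have "alternating [l]" "val l \<otimes> lprod L = lprod [l]" by auto
  then show ?thesis unfolding normal_forms_def by blast
next
  case (Cons k K)
  assume L: "alternating L"
  show ?thesis
  proof (cases "letter_factor l = letter_factor k")
    case False
    then have "alternating (l # L)" using L Cons by simp
    moreover have "val l \<otimes> lprod L = lprod (l # L)" by simp
    ultimately show ?thesis unfolding normal_forms_def by blast
  next
    case True
    have K: "alternating K" using L Cons by (cases K) auto
    show ?thesis
    proof (cases "letter_factor k = 2")
      case k2: True
      \<comment> \<open>The merged letter belongs to the factor of the letter it replaces, so it
        still alternates with the head of \<open>K\<close>.\<close>
      have "alternating (LT # K)" "alternating (LT' # K)"
        using k2 L Cons by (cases K; auto)+
      moreover have "val l \<otimes> lprod L \<in> {lprod K, r \<otimes> lprod (LT' # K), r \<otimes> lprod (LT # K)}"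
        using val_val_cancel[OF True, of "lprod K"] Cons by simp
      ultimately show ?thesis using K unfolding normal_forms_def by blast
    next
      case False
      then have "val l \<otimes> lprod L = lprod K"
        using True sq Cons by (cases l; cases k) (auto simp: m_assoc[symmetric])
      then show ?thesis using K unfolding normal_forms_def by blast
    qed
  qed
qed

lemma val_normal_forms: "x \<in> normal_forms \<Longrightarrow> val l \<otimes> x \<in> normal_forms"
proof -
  assume "x \<in> normal_forms"
  then obtain L where L: "alternating L" "x = lprod L \<or> x = r \<otimes> lprod L"
    unfolding normal_forms_def by blast
  have "val l \<otimes> (r \<otimes> lprod L) = r \<otimes> (val l \<otimes> lprod L)"
    using central[of "val l"] by (simp add: m_assoc[symmetric])
  then show ?thesis
    using L val_lprod_normal_forms[of L l] r_normal_forms by auto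
qed

text \<open>The normal forms contain one and are stable under left multiplication by the generators
  and their inverses: \<open>i\<close> and \<open>m\<close> are their own inverses, and the inverse
  of \<open>t\<close> is the letter \<open>LT'\<close>.\<close>

lemma carrier_normal_forms: "carrier G \<subseteq> normal_forms"
proof
  have *: "g \<in> carrier G \<and> (\<forall>x\<in>normal_forms. g \<otimes> x \<in> normal_forms)" if "g \<in> generate G {i, m, t}" for g
    using that
  proof induction
    case one
    have "x \<in> carrier G" if "x \<in> normal_forms" for x
      using that by (auto simp: normal_forms_def)
    then show ?case by auto
  next
    case (incl h)
    then show ?case
      using val_normal_forms[of _ LI] val_normal_forms[of _ LM] val_normal_forms[of _ LT] by auto
  next
    case (inv h)
    have "inv i = i" "inv m = m" using sq by (auto intro: inv_equality)
    with inv show ?case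
      using val_normal_forms[of _ LI] val_normal_forms[of _ LM] val_normal_forms[of _ LT'] by auto
  next
    case (eng h1 h2)
    moreover have "x \<in> carrier G" if "x \<in> normal_forms" for x
      using that by (auto simp: normal_forms_def)
    ultimately show ?case by (auto simp: m_assoc)
  qed
  have "\<one> \<in> normal_forms"
    unfolding normal_forms_def by (rule CollectI, rule exI[of _ "[]"]) simp
  with * show "g \<in> normal_forms" if "g \<in> carrier G" for g
    using that gen by (metis r_one)
qed

lemma hom_eq_oneD:
  assumes H: "group H" and f: "f \<in> hom G H" and x: "x \<in> carrier G" "f x = \<one>\<^bsub>H\<^esub>"
    and alt: "\<And>L. alternating L \<Longrightarrow> L \<noteq> [] \<Longrightarrow>
      letters_prod H (f i) (f m) (f t) L \<notin> {\<one>\<^bsub>H\<^esub>, f r}"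
    and r: "f r = \<one>\<^bsub>H\<^esub> \<Longrightarrow> r = \<one>"
  shows "x = \<one>"
proof -
  interpret f: group_hom G H f
    using H f by (simp add: group_hom_def group_hom_axioms_def)
  have val: "f (val l) = letter_val H (f i) (f m) (f t) l" for l
    by (cases l) auto
  have lp: "f (lprod L) = letters_prod H (f i) (f m) (f t) L" for L
    by (induction L) (auto simp: val)
  obtain L where L: "alternating L" and xL: "x = lprod L \<or> x = r \<otimes> lprod L"
    using x(1) carrier_normal_forms unfolding normal_forms_def by blast
  have "f (lprod L) = f r" if "x = r \<otimes> lprod L"
  proof -
    have "r \<otimes> x = lprod L"
      unfolding that using r2 by (subst m_assoc[symmetric]) auto
    then have "f (lprod L) = f r \<otimes>\<^bsub>H\<^esub> f x"
      using x(1) by (metis carr(3) f.hom_mult m_closed)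
    also have "\<dots> = f r" using x(2) by (simp del: f.hom_mult)
    finally show ?thesis .
  qed
  then have "L = []" using alt[OF L] lp[of L] xL x(2) by (metis insertCI)
  with xL x(2) r show ?thesis by auto
qed

end

section \<open>From normal forms to the two presentations\<close>

lemma (in group) generate_commute:
  assumes A: "A \<subseteq> carrier G" and r: "r \<in> carrier G"
    and com: "\<And>a. a \<in> A \<Longrightarrow> r \<otimes> a = a \<otimes> r" and x: "x \<in> generate G A"
  shows "r \<otimes> x = x \<otimes> r"
  using x
proof induction
  case (inv h)
  then have h: "h \<in> carrier G" "r \<otimes> h = h \<otimes> r" using A com by auto
  have "r = h \<otimes> r \<otimes> inv h"
    using h r by (metis inv_solve_right m_closed)
  then have "inv h \<otimes> r = inv h \<otimes> (h \<otimes> (r \<otimes> inv h))"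
    using h(1) r by (metis inv_closed m_assoc)
  then show ?case using h(1) r by (simp add: l_inv_assoc)
next
  case (eng g h)
  then have "g \<in> carrier G" "h \<in> carrier G" using generate_incl[OF A] by auto
  with eng r show ?case by (metis m_assoc)
qed (use com r in auto)

text \<open>As \<open>i\<close> and \<open>m\<close> are involutions, \<open>u = m t i\<close>; thus
  \<open>t\<close> can replace \<open>u\<close> as a generator, which exposes the cyclic factors,
  and \<open>r\<close> is a word in \<open>t\<close>.\<close>

lemma (in group) torsion_tripleI:
  assumes carr: "i \<in> carrier G" "m \<in> carrier G" "u \<in> carrier G"
    and t: "t = m \<otimes> u \<otimes> i" and r: "r = t \<otimes> t \<otimes> t"
    and sq: "i \<otimes> i = \<one>" "m \<otimes> m = \<one>" "r \<otimes> r = \<one>"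
    and com: "r \<otimes> i = i \<otimes> r" "r \<otimes> m = m \<otimes> r" "r \<otimes> u = u \<otimes> r"
    and gen: "carrier G \<subseteq> generate G {i, m, u, r}"
  shows "torsion_triple G i m t"
proof
  have tc: "t \<in> carrier G" and rc: "r \<in> carrier G" using carr t r by auto
  let ?A = "{i, m, t}"
  have A: "?A \<subseteq> carrier G" using carr tc by auto
  have "m \<otimes> t \<otimes> i = m \<otimes> (m \<otimes> (u \<otimes> (i \<otimes> i)))"
    using carr by (simp add: t m_assoc)
  also have "\<dots> = u"
    using carr sq by (simp add: m_assoc[symmetric])
  finally have u: "u = m \<otimes> t \<otimes> i" ..
  have "u \<in> generate G ?A" "r \<in> generate G ?A"
    unfolding u r by (intro generate.eng generate.incl; simp)+
  then have "{i, m, u, r} \<subseteq> generate G ?A"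
    by (auto intro: generate.incl)
  then have "carrier G \<subseteq> generate G ?A"
    using gen generate_subgroup_incl[OF _ generate_is_subgroup[OF A]] by blast
  then show "generate G ?A = carrier G" using generate_incl[OF A] by blast
  have "r \<otimes> x = x \<otimes> r" if "x \<in> carrier G" for x
    by (rule generate_commute[of "{i, m, u, r}"]) (use that gen com carr rc in auto)
  then show "t \<otimes> t \<otimes> t \<otimes> x = x \<otimes> (t \<otimes> t \<otimes> t)" if "x \<in> carrier G" for x
    using that by (simp add: r)
  show "i \<in> carrier G" "m \<in> carrier G" "t \<in> carrier G" "i \<otimes> i = \<one>" "m \<otimes> m = \<one>"
    "t \<otimes> t \<otimes> t \<otimes> (t \<otimes> t \<otimes> t) = \<one>"
    using carr tc sq by (auto simp: r[symmetric])
qed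

text \<open>The third relator makes the cube of \<tau> trivial in every \<open>K\<close> to be
  tested, so the normal forms are plain alternating words. Hypothesis \<open>alt\<close> says that
  \<open>i\<close>, \<open>m\<close> and \<open>t\<close> generate a free product.\<close>

lemma (in group) presentation_quot:
  assumes carr: "i \<in> carrier G" "m \<in> carrier G" "u \<in> carrier G"
    and t: "t = m \<otimes> u \<otimes> i"
    and sq: "i \<otimes> i = \<one>" "m \<otimes> m = \<one>" "t \<otimes> t \<otimes> t = \<one>"
    and gen: "generate G {i, m, u} = carrier G"
    and alt: "\<And>L. alternating L \<Longrightarrow> L \<noteq> [] \<Longrightarrow> letters_prod G i m t L \<noteq> \<one>"
    and \<phi>: "\<phi> Iota = i" "\<phi> Mu = m" "\<phi> Upsilon = u"
  shows "has_presentation G gens_quot rels_quot \<phi>"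
proof (rule has_presentationI)
  let ?X = gens_quot
  let ?F = "free_group ?X"
  interpret F: group ?F by (rule group_free_group)
  let ?\<iota> = "free_gen ?X Iota" and ?\<mu> = "free_gen ?X Mu" and ?\<upsilon> = "free_gen ?X Upsilon"
  let ?\<tau> = "?\<mu> \<otimes>\<^bsub>?F\<^esub> ?\<upsilon> \<otimes>\<^bsub>?F\<^esub> ?\<iota>"
  have g [simp]: "?\<iota> \<in> carrier ?F" "?\<mu> \<in> carrier ?F" "?\<upsilon> \<in> carrier ?F"
    by (auto intro: free_gen_carrier simp: gens_quot_def)
  have Rels: "rels_quot = {?\<iota> \<otimes>\<^bsub>?F\<^esub> ?\<iota>, ?\<mu> \<otimes>\<^bsub>?F\<^esub> ?\<mu>, ?\<tau> \<otimes>\<^bsub>?F\<^esub> ?\<tau> \<otimes>\<^bsub>?F\<^esub> ?\<tau>}"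
    unfolding rels_quot_def Let_def by (simp add: numeral_2_eq_2 numeral_3_eq_3)
  show "rels_quot \<subseteq> carrier ?F" unfolding Rels by simp
  show "\<phi> ` ?X \<subseteq> carrier G" "generate G (\<phi> ` ?X) = carrier G"
    using carr gen \<phi> by (simp_all add: gens_quot_def)
  show "h r = \<one>" if h: "h \<in> hom ?F G" "\<And>x. x \<in> ?X \<Longrightarrow> h (free_gen ?X x) = \<phi> x"
    and r: "r \<in> rels_quot" for h r
  proof -
    interpret h: group_hom ?F G h by unfold_locales (rule h(1))
    have "h ?\<iota> = i" "h ?\<mu> = m" "h ?\<upsilon> = u" using h(2) \<phi> by (auto simp: gens_quot_def)
    then show ?thesis using r sq unfolding Rels by (auto simp: t)
  qed
  fix K :: "gen word set set monoid" and p f g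
  assume K: "group K" and p: "p \<in> hom ?F K"
    and gK: "generate K (p ` free_gen ?X ` ?X) = carrier K"
    and one: "\<And>x. x \<in> rels_quot \<Longrightarrow> p x = \<one>\<^bsub>K\<^esub>" and f: "f \<in> hom K G"
    and fx: "\<And>x. x \<in> ?X \<Longrightarrow> f (p (free_gen ?X x)) = \<phi> x"
    and gg: "g \<in> carrier K" "f g = \<one>"
  interpret K: group K by (rule K)
  interpret p: group_hom ?F K p by unfold_locales (rule p)
  interpret f: group_hom K G f by unfold_locales (rule f)
  have \<tau>3: "p ?\<tau> \<otimes>\<^bsub>K\<^esub> p ?\<tau> \<otimes>\<^bsub>K\<^esub> p ?\<tau> = \<one>\<^bsub>K\<^esub>"
    using one[of "?\<tau> \<otimes>\<^bsub>?F\<^esub> ?\<tau> \<otimes>\<^bsub>?F\<^esub> ?\<tau>"] unfolding Rels by simp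
  interpret tt: torsion_triple K "p ?\<iota>" "p ?\<mu>" "p ?\<tau>"
  proof (rule K.torsion_tripleI[where u = "p ?\<upsilon>" and r = "\<one>\<^bsub>K\<^esub>"])
    show "p ?\<iota> \<otimes>\<^bsub>K\<^esub> p ?\<iota> = \<one>\<^bsub>K\<^esub>" "p ?\<mu> \<otimes>\<^bsub>K\<^esub> p ?\<mu> = \<one>\<^bsub>K\<^esub>"
      using one[of "?\<iota> \<otimes>\<^bsub>?F\<^esub> ?\<iota>"] one[of "?\<mu> \<otimes>\<^bsub>?F\<^esub> ?\<mu>"] unfolding Rels by simp_all
    have "{p ?\<iota>, p ?\<mu>, p ?\<upsilon>} \<subseteq> {p ?\<iota>, p ?\<mu>, p ?\<upsilon>, \<one>\<^bsub>K\<^esub>}" by blast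
    from K.mono_generate[OF this]
    show "carrier K \<subseteq> generate K {p ?\<iota>, p ?\<mu>, p ?\<upsilon>, \<one>\<^bsub>K\<^esub>}"
      using gK by (simp add: gens_quot_def)
  qed (use \<tau>3 in simp_all)
  have fi: "f (p ?\<iota>) = i" "f (p ?\<mu>) = m" "f (p ?\<upsilon>) = u"
    using fx \<phi> by (auto simp: gens_quot_def)
  have ft: "f (p ?\<tau>) = t"
    by (simp add: fi t)
  show "g = \<one>\<^bsub>K\<^esub>"
    using alt \<tau>3 by (intro tt.hom_eq_oneD[OF is_group f gg]) (simp_all add: fi ft del: p.hom_mult)
qed

text \<open>The relator involving \<rho> identifies it with the cube of \<tau> in \<open>K\<close>,
  and the commutators make this cube central. A normal form may now carry a factor \<open>r\<close>,
  so \<open>alt\<close> must keep alternating words away from \<open>r\<close> as well as from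
  \<open>\<one>\<close>.\<close>

lemma (in group) presentation_stab:
  assumes carr: "i \<in> carrier G" "m \<in> carrier G" "u \<in> carrier G"
    and t: "t = m \<otimes> u \<otimes> i" and r: "r = t \<otimes> t \<otimes> t"
    and sq: "i \<otimes> i = \<one>" "m \<otimes> m = \<one>" "r \<otimes> r = \<one>" "r \<noteq> \<one>"
    and com: "r \<otimes> i = i \<otimes> r" "r \<otimes> m = m \<otimes> r" "r \<otimes> u = u \<otimes> r"
    and gen: "generate G {i, m, u, r} = carrier G"
    and alt: "\<And>L. alternating L \<Longrightarrow> L \<noteq> [] \<Longrightarrow> letters_prod G i m t L \<notin> {\<one>, r}"
    and \<phi>: "\<phi> Iota = i" "\<phi> Mu = m" "\<phi> Upsilon = u" "\<phi> Rho = r"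
  shows "has_presentation G gens_stab rels_stab \<phi>"
proof (rule has_presentationI)
  let ?X = gens_stab
  let ?F = "free_group ?X"
  interpret F: group ?F by (rule group_free_group)
  let ?\<iota> = "free_gen ?X Iota" and ?\<mu> = "free_gen ?X Mu" and ?\<upsilon> = "free_gen ?X Upsilon"
    and ?\<rho> = "free_gen ?X Rho"
  let ?\<tau> = "?\<mu> \<otimes>\<^bsub>?F\<^esub> ?\<upsilon> \<otimes>\<^bsub>?F\<^esub> ?\<iota>"
  have g [simp]: "?\<iota> \<in> carrier ?F" "?\<mu> \<in> carrier ?F" "?\<upsilon> \<in> carrier ?F" "?\<rho> \<in> carrier ?F"
    by (auto intro: free_gen_carrier simp: gens_stab_def)
  have Rels: "rels_stab = {?\<iota> \<otimes>\<^bsub>?F\<^esub> ?\<iota>, ?\<mu> \<otimes>\<^bsub>?F\<^esub> ?\<mu>, ?\<rho> \<otimes>\<^bsub>?F\<^esub> ?\<rho>,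
      ?\<tau> \<otimes>\<^bsub>?F\<^esub> ?\<tau> \<otimes>\<^bsub>?F\<^esub> ?\<tau> \<otimes>\<^bsub>?F\<^esub> inv\<^bsub>?F\<^esub> ?\<rho>,
      commutator ?F ?\<rho> ?\<iota>, commutator ?F ?\<rho> ?\<mu>, commutator ?F ?\<rho> ?\<upsilon>}"
    unfolding rels_stab_def Let_def by (simp add: numeral_2_eq_2 numeral_3_eq_3)
  show "rels_stab \<subseteq> carrier ?F" unfolding Rels by (simp add: commutator_def)
  have rc: "r \<in> carrier G" using carr by (simp add: t r)
  show "\<phi> ` ?X \<subseteq> carrier G" "generate G (\<phi> ` ?X) = carrier G"
    using carr gen rc \<phi> by (simp_all add: gens_stab_def)
  show "h x = \<one>" if h: "h \<in> hom ?F G" "\<And>x. x \<in> ?X \<Longrightarrow> h (free_gen ?X x) = \<phi> x"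
    and x: "x \<in> rels_stab" for h x
  proof -
    interpret h: group_hom ?F G h by unfold_locales (rule h(1))
    have hh: "h ?\<iota> = i" "h ?\<mu> = m" "h ?\<upsilon> = u" "h ?\<rho> = r"
      using h(2) \<phi> by (auto simp: gens_stab_def)
    have "h (commutator ?F ?\<rho> ?\<iota>) = \<one>" "h (commutator ?F ?\<rho> ?\<mu>) = \<one>" "h (commutator ?F ?\<rho> ?\<upsilon>) = \<one>"
      using carr rc by (simp_all add: commutator_def hh com m_assoc r_inv_assoc)
    moreover have "h (?\<tau> \<otimes>\<^bsub>?F\<^esub> ?\<tau> \<otimes>\<^bsub>?F\<^esub> ?\<tau> \<otimes>\<^bsub>?F\<^esub> inv\<^bsub>?F\<^esub> ?\<rho>) = \<one>"
      using carr rc by (simp add: hh t[symmetric] r[symmetric])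
    ultimately show ?thesis using x sq hh unfolding Rels by auto
  qed
  fix K :: "gen word set set monoid" and p f g
  assume K: "group K" and p: "p \<in> hom ?F K"
    and gK: "generate K (p ` free_gen ?X ` ?X) = carrier K"
    and one: "\<And>x. x \<in> rels_stab \<Longrightarrow> p x = \<one>\<^bsub>K\<^esub>" and f: "f \<in> hom K G"
    and fx: "\<And>x. x \<in> ?X \<Longrightarrow> f (p (free_gen ?X x)) = \<phi> x"
    and gg: "g \<in> carrier K" "f g = \<one>"
  interpret K: group K by (rule K)
  interpret p: group_hom ?F K p by unfold_locales (rule p)
  interpret f: group_hom K G f by unfold_locales (rule f)
  have eq: "x = y" if "x \<in> carrier K" "y \<in> carrier K" "x \<otimes>\<^bsub>K\<^esub> inv\<^bsub>K\<^esub> y = \<one>\<^bsub>K\<^esub>" for x y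
    using that K.inv_solve_right'[of "\<one>\<^bsub>K\<^esub>" x y] by simp
  have com_eq: "x \<otimes>\<^bsub>K\<^esub> y = y \<otimes>\<^bsub>K\<^esub> x"
    if "x \<in> carrier K" "y \<in> carrier K" "commutator K x y = \<one>\<^bsub>K\<^esub>" for x y
    by (rule eq) (use that in \<open>simp_all add: commutator_def K.m_assoc K.inv_mult_group\<close>)
  have com1: "commutator K (p ?\<rho>) (p x) = \<one>\<^bsub>K\<^esub>" if "x \<in> {?\<iota>, ?\<mu>, ?\<upsilon>}" for x
  proof -
    have "x \<in> carrier ?F" "commutator ?F ?\<rho> x \<in> rels_stab"
      using that g unfolding Rels by blast+
    then show ?thesis using one by (fastforce simp: commutator_def)
  qed
  have \<tau>3: "p ?\<rho> = p ?\<tau> \<otimes>\<^bsub>K\<^esub> p ?\<tau> \<otimes>\<^bsub>K\<^esub> p ?\<tau>"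
  proof (rule eq[symmetric])
    have "?\<tau> \<otimes>\<^bsub>?F\<^esub> ?\<tau> \<otimes>\<^bsub>?F\<^esub> ?\<tau> \<otimes>\<^bsub>?F\<^esub> inv\<^bsub>?F\<^esub> ?\<rho> \<in> rels_stab"
      unfolding Rels by blast
    from one[OF this]
    show "p ?\<tau> \<otimes>\<^bsub>K\<^esub> p ?\<tau> \<otimes>\<^bsub>K\<^esub> p ?\<tau> \<otimes>\<^bsub>K\<^esub> inv\<^bsub>K\<^esub> p ?\<rho> = \<one>\<^bsub>K\<^esub>"
      by simp
  qed simp_all
  interpret tt: torsion_triple K "p ?\<iota>" "p ?\<mu>" "p ?\<tau>"
  proof (rule K.torsion_tripleI[where u = "p ?\<upsilon>" and r = "p ?\<rho>"])
    show "p ?\<iota> \<otimes>\<^bsub>K\<^esub> p ?\<iota> = \<one>\<^bsub>K\<^esub>" "p ?\<mu> \<otimes>\<^bsub>K\<^esub> p ?\<mu> = \<one>\<^bsub>K\<^esub>" "p ?\<rho> \<otimes>\<^bsub>K\<^esub> p ?\<rho> = \<one>\<^bsub>K\<^esub>"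
      using one[of "?\<iota> \<otimes>\<^bsub>?F\<^esub> ?\<iota>"] one[of "?\<mu> \<otimes>\<^bsub>?F\<^esub> ?\<mu>"] one[of "?\<rho> \<otimes>\<^bsub>?F\<^esub> ?\<rho>"]
      unfolding Rels by simp_all
    show "p ?\<rho> \<otimes>\<^bsub>K\<^esub> p ?\<iota> = p ?\<iota> \<otimes>\<^bsub>K\<^esub> p ?\<rho>" "p ?\<rho> \<otimes>\<^bsub>K\<^esub> p ?\<mu> = p ?\<mu> \<otimes>\<^bsub>K\<^esub> p ?\<rho>"
      "p ?\<rho> \<otimes>\<^bsub>K\<^esub> p ?\<upsilon> = p ?\<upsilon> \<otimes>\<^bsub>K\<^esub> p ?\<rho>"
      by (intro com_eq com1; simp)+
    show "p ?\<rho> = p ?\<tau> \<otimes>\<^bsub>K\<^esub> p ?\<tau> \<otimes>\<^bsub>K\<^esub> p ?\<tau>" by (rule \<tau>3)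
    show "carrier K \<subseteq> generate K {p ?\<iota>, p ?\<mu>, p ?\<upsilon>, p ?\<rho>}"
      using gK by (simp add: gens_stab_def)
  qed simp_all
  have fi: "f (p ?\<iota>) = i" "f (p ?\<mu>) = m" "f (p ?\<upsilon>) = u" "f (p ?\<rho>) = r"
    using fx \<phi> by (auto simp: gens_stab_def)
  have ft: "f (p ?\<tau>) = t"
    by (simp add: fi t)
  show "g = \<one>\<^bsub>K\<^esub>"
    using alt sq(4)
    by (intro tt.hom_eq_oneD[OF is_group f gg]) (simp_all add: fi ft \<tau>3[symmetric] del: p.hom_mult)
qed

section \<open>The ring of integers\<close>

definition omega7 :: complex where
  "omega7 = (1 + i_sqrt7) / 2"

lemma i_sqrt7_sq: "i_sqrt7 * i_sqrt7 = -7"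
proof -
  have "i_sqrt7 * i_sqrt7 = \<i> * \<i> * complex_of_real (sqrt 7 * sqrt 7)"
    unfolding i_sqrt7_def of_real_mult by (simp add: mult_ac)
  then show ?thesis by simp
qed

lemma omega7_sq: "omega7 * omega7 = omega7 - 2"
  using i_sqrt7_sq by (simp add: omega7_def field_simps)

lemma Re_i_sqrt7 [simp]: "Re i_sqrt7 = 0" and Im_i_sqrt7 [simp]: "Im i_sqrt7 = sqrt 7"
  by (simp_all add: i_sqrt7_def)

lemma cnj_i_sqrt7 [simp]: "cnj i_sqrt7 = - i_sqrt7"
  by (simp add: i_sqrt7_def)

lemma i_sqrt7_nonzero [simp]: "i_sqrt7 \<noteq> 0"
  by (simp add: i_sqrt7_def)

text \<open>\<open>7 y\<close> is a rational root of the monic polynomial \<open>X^2 - 7 k\<close>,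
  hence an integer; its square is divisible by 7, so it is itself divisible by 7.\<close>

lemma rat_int_of_seven_sq:
  assumes "y \<in> \<rat>" "7 * y ^ 2 = of_int k"
  shows "(y::real) \<in> \<int>"
proof -
  have "algebraic_int (7 * y)"
  proof (rule algebraic_int.intros)
    show "lead_coeff [:- of_int (7 * k), 0, 1 :: real:] = 1" by simp
    show "\<forall>i. coeff [:- of_int (7 * k), 0, 1 :: real:] i \<in> \<int>"
      by (auto simp: coeff_pCons split: nat.splits)
    show "poly [:- of_int (7 * k), 0, 1:] (7 * y) = 0"
      using assms(2) by (simp add: power2_eq_square algebra_simps)
  qed
  then have "7 * y \<in> \<int>"
    using assms(1) by (intro rational_algebraic_int_is_int) auto
  then obtain l where l: "7 * y = of_int l" by (auto elim: Ints_cases)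
  have "of_int (l * l) = (7 * y) * (7 * y)"
    unfolding l by simp
  also have "\<dots> = of_int (7 * k)"
    using assms(2) by (simp add: power2_eq_square)
  finally have "l * l = 7 * k" unfolding of_int_eq_iff .
  then have "7 dvd l * l" by simp
  then have "7 dvd l" by (simp add: prime_dvd_mult_iff)
  then show ?thesis using l by auto
qed

section \<open>Integral elements of the quadratic field\<close>

lemma map_poly_of_int_add: "map_poly of_int (p + q) = map_poly of_int p + map_poly of_int q"
  by (rule poly_eqI) (simp add: coeff_map_poly)

lemma map_poly_of_int_mult: "map_poly of_int (p * q) = map_poly of_int p * map_poly of_int q"
  by (rule poly_eqI) (simp add: coeff_map_poly coeff_mult)

lemma of_rat_complex: "(of_rat a :: complex) = of_real (of_rat a)"
  by (cases a) (simp add: of_rat_rat)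

text \<open>By Gauss's lemma, the primitive integral quadratic polynomial of a non-real element divides
  every monic integral polynomial annihilating it, so that it is itself monic up to sign.\<close>

lemma algebraic_int_quadratic:
  fixes z :: complex and f :: "int poly"
  assumes z: "algebraic_int z" "Im z \<noteq> 0" and f: "degree f = 2" "poly (map_poly of_int f) z = 0"
  obtains B C :: int where "z\<^sup>2 + of_int B * z + of_int C = 0"
proof -
  obtain P where P: "poly (map_poly of_int P) z = 0" "lead_coeff P = 1"
    using z(1) unfolding algebraic_int_altdef_ipoly by blast
  define q where "q = primitive_part f"
  have f0: "f \<noteq> 0" using f(1) by auto
  have fq: "f = smult (content f) q"
    by (simp add: q_def)
  have cq: "content q = 1"
    using f0 by (simp add: q_def)
  have dq: "degree q = 2"
    using f(1) by (simp add: q_def)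
  have "map_poly of_int f = smult (of_int (content f)) (map_poly of_int q :: complex poly)"
    by (subst fq) (simp add: map_poly_smult)
  then have qz: "poly (map_poly of_int q) z = 0"
    using f(2) f0 by simp
  \<comment> \<open>Pseudo-division stays within integral polynomials; its multiplier
    \<open>a\<close> is removed afterwards by comparing contents.\<close>
  obtain a s where as: "a \<noteq> 0" "smult a P = q * s + pseudo_mod P q"
    using pseudo_mod(1)[of q P] dq by force
  let ?r = "pseudo_mod P q"
  have "?r = 0 \<or> degree ?r < 2"
    using pseudo_mod(2)[of q P] dq by force
  then have "degree ?r \<le> 1" by auto
  then have "?r = [:coeff ?r 0, coeff ?r 1:]"
    by (intro poly_eqI) (auto simp: coeff_pCons coeff_eq_0 split: nat.splits)
  then obtain r0 r1 where r: "?r = [:r0, r1:]" by blast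
  have "poly (map_poly of_int (smult a P)) z = poly (map_poly of_int (q * s + ?r)) z"
    using as(2) by simp
  then have "poly (map_poly of_int ?r) z = 0"
    using P qz by (simp add: map_poly_smult map_poly_of_int_add map_poly_of_int_mult)
  then have rz: "of_int r0 + z * of_int r1 = 0"
    by (simp add: r map_poly_pCons)
  \<comment> \<open>The non-real \<open>z\<close> cannot be a root of a nonzero integral polynomial
    of degree at most one, so the remainder vanishes.\<close>
  then have "Im (of_int r0 + z * of_int r1) = 0" by simp
  then have "r1 = 0" using z(2) by simp
  with rz have "r0 = 0" by simp
  with \<open>r1 = 0\<close> r have qs: "smult a P = q * s" using as(2) by simp
  have cP: "content P = 1"
  proof -
    have "content P dvd lead_coeff P" by (rule content_dvd_coeff)
    then show ?thesis using P(2)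
      by (metis content_dvd_coeff is_unit_content_iff)
  qed
  \<comment> \<open>\<open>P\<close> and \<open>q\<close> have content one, so \<open>a\<close>
    divides the leading coefficient of \<open>s\<close>; cancelling it leaves a unit as leading
    coefficient of \<open>q\<close>.\<close>
  have "content s = \<bar>a\<bar>"
    using arg_cong[OF qs, of content] cP cq by (simp add: content_mult)
  moreover have "content s dvd lead_coeff s" by (rule content_dvd_coeff)
  ultimately obtain c where c: "lead_coeff s = a * c" by auto
  have "a = lead_coeff q * lead_coeff s"
    using arg_cong[OF qs, of lead_coeff] P(2) as(1) by (simp add: lead_coeff_mult)
  then have "lead_coeff q * c = 1" using c as(1) by simp
  then have lq: "lead_coeff q = 1 \<or> lead_coeff q = -1" by (metis zmult_eq_1_iff)
  obtain A B C where q: "q = [:C, B, A:]"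
    using dq by (metis degree_pCons_eq_if numeral_2_eq_2 nat.inject pCons_cases degree_eq_zeroE Zero_not_Suc)
  have "A = 1 \<or> A = -1" using lq dq by (simp add: q numeral_2_eq_2)
  then have "z\<^sup>2 + of_int (A * B) * z + of_int (A * C) = 0"
    using qz by (auto simp: q map_poly_pCons power2_eq_square algebra_simps)
  then show thesis by (rule that)
qed

text \<open>A non-real \<open>z\<close> has integral trace \<open>-B\<close> and norm
  \<open>C\<close>. Then \<open>7 (2 b)^2 = 4 C - B^2\<close> makes \<open>2 b\<close> an integer of
  the same parity as \<open>B\<close>, and this parity condition describes the lattice spanned by 1
  and \<open>omega7\<close>.\<close>

lemma O7_iff: "z \<in> O7 \<longleftrightarrow> (\<exists>j n. z = of_int j + of_int n * omega7)"
proof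
  assume z: "z \<in> O7"
  then obtain a b where ab: "z = of_rat a + of_rat b * i_sqrt7" and alg: "algebraic_int z"
    unfolding O7_def Q_i_sqrt7_def by blast
  have Re: "Re z = of_rat a" and Im: "Im z = of_rat b * sqrt 7"
    using ab by (simp_all add: of_rat_complex)
  show "\<exists>j n. z = of_int j + of_int n * omega7"
  proof (cases "b = 0")
    case True
    then have "z \<in> \<rat>" using ab by simp
    then have "z \<in> \<int>" using alg rational_algebraic_int_is_int by blast
    then obtain j where "z = of_int j" by (auto elim: Ints_cases)
    then show ?thesis by (intro exI[of _ j] exI[of _ 0]) simp
  next
    case False
    obtain p n where pn: "a = of_int p / of_int n" "n > 0"
      by (metis Fract_of_int_quotient Rat_cases)
    obtain q m where qm: "b = of_int q / of_int m" "m > 0"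
      by (metis Fract_of_int_quotient Rat_cases)
    \<comment> \<open>\<open>(X - a)^2 + 7 b^2\<close> with the denominators of \<open>a\<close> and
      \<open>b\<close> cleared.\<close>
    define f :: "int poly" where "f = [:(p * m)\<^sup>2 + 7 * (q * n)\<^sup>2, - 2 * (p * m) * (n * m), (n * m)\<^sup>2:]"
    have "degree f = 2" using pn qm by (simp add: f_def)
    have z': "of_int (n * m) * z = of_int (p * m) + of_int (q * n) * i_sqrt7"
      using pn(2) qm(2) unfolding ab pn(1) qm(1) by (simp add: of_rat_divide field_simps)
    have "poly (map_poly of_int f) z = (of_int (n * m) * z - of_int (p * m))\<^sup>2 + 7 * (of_int (q * n))\<^sup>2"
      by (simp add: f_def map_poly_pCons power2_eq_square algebra_simps)
    also have "\<dots> = of_int (q * n) ^ 2 * (i_sqrt7 * i_sqrt7 + 7)"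
      unfolding z' by (simp add: power2_eq_square algebra_simps)
    also have "\<dots> = 0" by (simp add: i_sqrt7_sq)
    finally have "poly (map_poly of_int f) z = 0" .
    moreover have "Im z \<noteq> 0" using False Im by simp
    ultimately obtain B C where BC: "z\<^sup>2 + of_int B * z + of_int C = 0"
      using algebraic_int_quadratic[OF alg _ \<open>degree f = 2\<close>] by blast
    have "Im (z\<^sup>2 + of_int B * z + of_int C) = Im z * (2 * Re z + of_int B)"
      by (simp add: power2_eq_square algebra_simps)
    with BC \<open>Im z \<noteq> 0\<close> have B: "2 * Re z = - of_int B" by simp
    have "Re (z\<^sup>2 + of_int B * z + of_int C) = (Re z)\<^sup>2 - (Im z)\<^sup>2 + of_int B * Re z + of_int C"
      by (simp add: power2_eq_square)
    with BC have "(Re z)\<^sup>2 - (Im z)\<^sup>2 + of_int B * Re z + of_int C = 0" by simp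
    then have "4 * (Re z)\<^sup>2 - 4 * (Im z)\<^sup>2 + 2 * of_int B * (2 * Re z) + 4 * of_int C = 0" by simp
    moreover have "4 * (Re z)\<^sup>2 = (of_int B)\<^sup>2"
      using arg_cong[OF B, of power2] by (simp add: power_mult_distrib)
    ultimately have I: "4 * (Im z)\<^sup>2 = of_int (4 * C - B\<^sup>2)"
      unfolding B by (simp add: power2_eq_square)
    then have I7: "7 * (2 * of_rat b)\<^sup>2 = (of_int (4 * C - B\<^sup>2) :: real)"
      by (simp add: Im power_mult_distrib)
    have "2 * of_rat b \<in> (\<int> :: real set)"
      by (rule rat_int_of_seven_sq[OF _ I7]) simp
    then obtain n where n: "2 * of_rat b = real_of_int n" by (auto elim: Ints_cases)
    have "real_of_int (7 * n\<^sup>2) = of_int (4 * C - B\<^sup>2)" using I7 n by simp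
    then have "7 * n\<^sup>2 = 4 * C - B\<^sup>2" unfolding of_int_eq_iff .
    then have "even (7 * n\<^sup>2 + B\<^sup>2)" by simp
    then have "even (- B - n)" by simp
    then obtain j where j: "- B - n = 2 * j" unfolding dvd_def by blast
    have "2 * Re z = of_int (2 * j + n)" using B j by simp
    then have "z = of_int j + of_int n * omega7"
      using n Im by (auto simp: complex_eq_iff omega7_def)
    then show ?thesis by blast
  qed
next
  assume "\<exists>j n. z = of_int j + of_int n * omega7"
  then obtain j n where z: "z = of_int j + of_int n * omega7" by blast
  have "algebraic_int z"
  proof (rule algebraic_int.intros)
    \<comment> \<open>The product of \<open>X - z\<close> and \<open>X - cnj z\<close>.\<close>
    let ?p = "[:of_int (j * j + j * n + 2 * n * n), - of_int (2 * j + n), 1 :: complex:]"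
    show "lead_coeff ?p = 1" by simp
    show "\<forall>i. coeff ?p i \<in> \<int>"
      by (auto simp: coeff_pCons simp del: of_int_add of_int_mult split: nat.splits)
    have "poly ?p z = of_int n * of_int n * (omega7 * omega7 - omega7 + 2)"
      by (simp add: z algebra_simps)
    then show "poly ?p z = 0" by (simp add: omega7_sq)
  qed
  moreover have "z = of_rat (of_int j + of_int n / 2) + of_rat (of_int n / 2) * i_sqrt7"
    by (simp add: z omega7_def of_rat_add of_rat_divide ring_distribs add_divide_distrib)
  ultimately show "z \<in> O7"
    unfolding O7_def Q_i_sqrt7_def by blast
qed

section \<open>Ring operations, norms and units\<close>

lemma O7_of_int [simp]: "of_int j \<in> O7"
  by (subst O7_iff) (rule exI[of _ j], rule exI[of _ 0], simp)

lemma O7_0 [simp]: "0 \<in> O7" and O7_1 [simp]: "1 \<in> O7" and O7_numeral [simp]: "numeral w \<in> O7"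
  using O7_of_int[of 0] O7_of_int[of 1] O7_of_int[of "numeral w"] by simp_all

lemma O7_add: "x \<in> O7 \<Longrightarrow> y \<in> O7 \<Longrightarrow> x + y \<in> O7"
proof -
  assume "x \<in> O7" "y \<in> O7"
  then obtain j n k m where "x = of_int j + of_int n * omega7" "y = of_int k + of_int m * omega7"
    unfolding O7_iff by blast
  then have "x + y = of_int (j + k) + of_int (n + m) * omega7"
    by (simp add: algebra_simps)
  then show ?thesis unfolding O7_iff by blast
qed

lemma O7_mult: "x \<in> O7 \<Longrightarrow> y \<in> O7 \<Longrightarrow> x * y \<in> O7"
proof -
  assume "x \<in> O7" "y \<in> O7"
  then obtain j n k m where xy: "x = of_int j + of_int n * omega7" "y = of_int k + of_int m * omega7"
    unfolding O7_iff by blast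
  have "x * y = of_int j * of_int k + (of_int j * of_int m + of_int n * of_int k) * omega7
    + of_int n * of_int m * (omega7 * omega7)"
    by (simp add: xy algebra_simps)
  also have "\<dots> = of_int (j * k - 2 * n * m) + of_int (j * m + n * k + n * m) * omega7"
    by (simp add: omega7_sq algebra_simps)
  finally show ?thesis unfolding O7_iff by blast
qed

lemma O7_uminus [simp]: "- x \<in> O7 \<longleftrightarrow> x \<in> O7"
  using O7_mult[of "of_int (-1)" x] O7_mult[of "of_int (-1)" "- x"] O7_of_int[of "-1"]
  by (auto simp del: O7_of_int)

lemma O7_i_sqrt7 [simp]: "i_sqrt7 \<in> O7"
  unfolding O7_iff by (rule exI[of _ "-1"], rule exI[of _ 2]) (simp add: omega7_def field_simps)

lemma O7_sum: "(\<And>i. i \<in> A \<Longrightarrow> f i \<in> O7) \<Longrightarrow> sum f A \<in> O7"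
  by (induction A rule: infinite_finite_induct) (auto intro: O7_add)

text \<open>Squared moduli are integers, which makes the later descent on an entry of a matrix well
  founded.\<close>

lemma O7_cases:
  assumes "z \<in> O7"
  obtains j n where "z = of_int j + of_int n * omega7" "Re z = of_int j + of_int n / 2"
    "Im z = of_int n * sqrt 7 / 2" "(cmod z)\<^sup>2 = of_int (j * j + j * n + 2 * n * n)"
proof -
  obtain j n where z: "z = of_int j + of_int n * omega7"
    using assms O7_iff by blast
  then have RI: "Re z = of_int j + of_int n / 2" "Im z = of_int n * sqrt 7 / 2"
    by (simp_all add: omega7_def)
  have "(cmod z)\<^sup>2 = (of_int j + of_int n / 2)\<^sup>2 + (of_int n)\<^sup>2 * (sqrt 7)\<^sup>2 / 4"
    by (simp add: cmod_power2 RI power_mult_distrib power_divide)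
  also have "\<dots> = of_int (j * j + j * n + 2 * n * n)"
    by (simp add: power2_eq_square field_simps)
  finally show thesis using that z RI by blast
qed

lemma O7_cnj: "z \<in> O7 \<Longrightarrow> cnj z \<in> O7"
proof -
  assume "z \<in> O7"
  then obtain j n where "z = of_int j + of_int n * omega7" by (rule O7_cases)
  then have "cnj z = of_int j + of_int n * cnj omega7" by simp
  also have "cnj omega7 = 1 - omega7"
    by (simp add: omega7_def field_simps)
  finally have "cnj z = of_int (j + n) + of_int (- n) * omega7"
    by (simp add: algebra_simps)
  then show ?thesis unfolding O7_iff by blast
qed

text \<open>Four times the norm is \<open>(2 j + n)^2 + 7 n^2\<close>; being 4, it forces
  \<open>n = 0\<close>.\<close>

lemma O7_unit:
  assumes "z \<in> O7" "z * cnj z = 1"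
  shows "z = 1 \<or> z = -1"
proof -
  obtain j n where z: "z = of_int j + of_int n * omega7" "(cmod z)\<^sup>2 = of_int (j * j + j * n + 2 * n * n)"
    using O7_cases[OF assms(1)] by metis
  have "(cmod z)\<^sup>2 = 1"
    using assms(2) by (metis complex_norm_square of_real_eq_1_iff)
  then have "j * j + j * n + 2 * n * n = 1"
    using z(2) by linarith
  then have eq: "(2 * j + n)\<^sup>2 + 7 * n\<^sup>2 = 4" by (simp add: power2_eq_square algebra_simps)
  have "n\<^sup>2 < 1" using eq zero_le_power2[of "2 * j + n"] by linarith
  then have "n = 0" by (simp add: power2_less_1_iff)
  with eq have "j\<^sup>2 = 1" by (simp add: power_mult_distrib)
  then have "j = 1 \<or> j = -1" by (simp add: power2_eq_1_iff)
  then show ?thesis using z \<open>n = 0\<close> by auto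
qed

lemma O7_real:
  assumes "z \<in> O7" "cnj z = z"
  obtains j where "z = of_int j"
proof -
  obtain j n where z: "z = of_int j + of_int n * omega7" "Im z = of_int n * sqrt 7 / 2"
    using O7_cases[OF assms(1)] by metis
  have "Im z = 0" using assms(2) by (simp add: complex_eq_iff)
  then have "n = 0" using z(2) by simp
  then show thesis using z(1) that by simp
qed

lemma O7_imag:
  assumes "z \<in> O7" "cnj z = - z"
  obtains j where "z = i_sqrt7 * of_int j"
proof -
  obtain j n where z: "z = of_int j + of_int n * omega7" "Re z = of_int j + of_int n / 2"
    using O7_cases[OF assms(1)] by metis
  have "Re z = 0" using assms(2) by (simp add: complex_eq_iff)
  then have "real_of_int n = of_int (- 2 * j)" using z(2) by (simp add: field_simps)
  then have "n = - 2 * j" by linarith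
  then have "z = i_sqrt7 * of_int (- j)" by (simp add: z(1) omega7_def field_simps)
  then show thesis by (rule that)
qed

section \<open>The Picard modular group\<close>

lemma herm_eq: "herm v w = cnj (w $ 1) * v $ 3 + cnj (w $ 2) * v $ 2 + cnj (w $ 3) * v $ 1"
  by (simp add: herm_def matJ_def sum_3 matrix_vector_mult_def)

lemma neg_matrix_mult [simp]:
  fixes A B :: "'a::ring_1^'n^'n"
  shows "- A ** B = - (A ** B)" "A ** - B = - (A ** B)"
  by (simp_all add: matrix_matrix_mult_def vec_eq_iff sum_negf)

lemma neg_matrix_vector_mult [simp]:
  fixes A :: "'a::ring_1^'n^'n"
  shows "- A *v v = - (A *v v)"
  by (simp add: matrix_vector_mult_def vec_eq_iff sum_negf)

lemma carrier_UJ_O7: "carrier UJ_O7 = UJ \<inter> GL3_O7"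
  and mult_UJ_O7 [simp]: "A \<otimes>\<^bsub>UJ_O7\<^esub> B = A ** B"
  and one_UJ_O7 [simp]: "\<one>\<^bsub>UJ_O7\<^esub> = mat 1"
  by (simp_all add: UJ_O7_def)

lemma mat_O7_mult: "A \<in> mat_O7 \<Longrightarrow> B \<in> mat_O7 \<Longrightarrow> A ** B \<in> mat_O7"
  by (auto simp: mat_O7_def matrix_matrix_mult_def intro!: O7_sum O7_mult)

lemma mat_O7_one: "mat 1 \<in> mat_O7"
  by (auto simp: mat_O7_def mat_def)

lemma group_UJ_O7: "group UJ_O7"
proof (rule groupI)
  fix A B assume A: "A \<in> carrier UJ_O7" and B: "B \<in> carrier UJ_O7"
  obtain A' where A': "A' \<in> mat_O7" "A ** A' = mat 1" "A' ** A = mat 1"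
    using A by (auto simp: carrier_UJ_O7 GL3_O7_def)
  obtain B' where B': "B' \<in> mat_O7" "B ** B' = mat 1" "B' ** B = mat 1"
    using B by (auto simp: carrier_UJ_O7 GL3_O7_def)
  have "A ** B ** (B' ** A') = A ** (B ** B') ** A'" "B' ** A' ** (A ** B) = B' ** (A' ** A) ** B"
    by (simp_all only: matrix_mul_assoc)
  then have "A ** B ** (B' ** A') = mat 1" "B' ** A' ** (A ** B) = mat 1"
    using A' B' by simp_all
  moreover have "B' ** A' \<in> mat_O7" "A ** B \<in> mat_O7"
    using A A' B B' by (auto simp: carrier_UJ_O7 GL3_O7_def intro: mat_O7_mult)
  moreover have "A ** B \<in> UJ"
    using A B by (simp add: carrier_UJ_O7 UJ_def matrix_vector_mul_assoc[symmetric])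
  ultimately show "A \<otimes>\<^bsub>UJ_O7\<^esub> B \<in> carrier UJ_O7"
    unfolding carrier_UJ_O7 GL3_O7_def by auto
next
  show "\<one>\<^bsub>UJ_O7\<^esub> \<in> carrier UJ_O7"
    using mat_O7_one by (auto simp: carrier_UJ_O7 GL3_O7_def UJ_def)
next
  fix A assume A: "A \<in> carrier UJ_O7"
  then obtain A' where A': "A' \<in> mat_O7" "A ** A' = mat 1" "A' ** A = mat 1"
    by (auto simp: carrier_UJ_O7 GL3_O7_def)
  have "herm (A' *v v) (A' *v w) = herm v w" for v w
  proof -
    have "herm (A' *v v) (A' *v w) = herm (A *v (A' *v v)) (A *v (A' *v w))"
      using A by (simp add: carrier_UJ_O7 UJ_def)
    also have "\<dots> = herm v w" using A' by (simp add: matrix_vector_mul_assoc)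
    finally show ?thesis .
  qed
  then have "A' \<in> carrier UJ_O7"
    using A A' by (auto simp: carrier_UJ_O7 GL3_O7_def UJ_def)
  then show "\<exists>B\<in>carrier UJ_O7. B \<otimes>\<^bsub>UJ_O7\<^esub> A = \<one>\<^bsub>UJ_O7\<^esub>"
    using A' by auto
qed (simp_all add: matrix_mul_assoc)

interpretation UJ_O7: group UJ_O7
  by (rule group_UJ_O7)

lemma uminus_carrier_UJ_O7: "A \<in> carrier UJ_O7 \<Longrightarrow> - A \<in> carrier UJ_O7"
proof -
  assume A: "A \<in> carrier UJ_O7"
  then obtain A' where A': "A' \<in> mat_O7" "A ** A' = mat 1" "A' ** A = mat 1"
    by (auto simp: carrier_UJ_O7 GL3_O7_def)
  have "- A' \<in> mat_O7" "- A \<in> mat_O7"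
    using A A' by (auto simp: carrier_UJ_O7 GL3_O7_def mat_O7_def)
  moreover have "- A ** - A' = mat 1" "- A' ** - A = mat 1" using A' by simp_all
  moreover have "- A \<in> UJ"
    using A by (simp add: carrier_UJ_O7 UJ_def herm_eq)
  ultimately show "- A \<in> carrier UJ_O7"
    unfolding carrier_UJ_O7 GL3_O7_def by blast
qed

lemma normal_pm_Id: "pm_Id \<lhd> UJ_O7"
  unfolding UJ_O7.normal_inv_iff
proof (intro conjI ballI)
  have one: "mat 1 \<in> carrier UJ_O7" using UJ_O7.one_closed by simp
  then have "- mat 1 \<in> carrier UJ_O7" by (rule uminus_carrier_UJ_O7)
  moreover have "inv\<^bsub>UJ_O7\<^esub> (- mat 1) = - mat 1"
    using \<open>- mat 1 \<in> carrier UJ_O7\<close> by (intro UJ_O7.inv_equality) auto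
  moreover have "inv\<^bsub>UJ_O7\<^esub> (mat 1) = mat 1"
    using UJ_O7.inv_one by simp
  ultimately show "subgroup pm_Id UJ_O7"
    using one by (intro UJ_O7.subgroupI) (auto simp: pm_Id_def)
  fix x h assume x: "x \<in> carrier UJ_O7" and h: "h \<in> pm_Id"
  have "x ** (inv\<^bsub>UJ_O7\<^esub> x) = mat 1" using UJ_O7.r_inv[OF x] by simp
  then show "x \<otimes>\<^bsub>UJ_O7\<^esub> h \<otimes>\<^bsub>UJ_O7\<^esub> inv\<^bsub>UJ_O7\<^esub> x \<in> pm_Id"
    using h by (auto simp: pm_Id_def)
qed

lemma PU_class_eq: "PU_class A = {A, - A}"
  by (auto simp: PU_class_def r_coset_def pm_Id_def)

lemma PU_class_uminus [simp]: "PU_class (- A) = PU_class A"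
  by (auto simp: PU_class_eq)

lemma PU_class_eq_iff: "PU_class A = PU_class B \<longleftrightarrow> A = B \<or> A = - B"
  by (auto simp: PU_class_eq doubleton_eq_iff)

interpretation PUJ_O7: group PUJ_O7
  unfolding PUJ_O7_def by (rule normal.factorgroup_is_group[OF normal_pm_Id])

lemma carrier_PUJ_O7: "carrier PUJ_O7 = PU_class ` carrier UJ_O7"
  by (auto simp: PUJ_O7_def PU_class_def carrier_FactGroup)

lemma mult_PUJ_O7:
  "A \<in> carrier UJ_O7 \<Longrightarrow> B \<in> carrier UJ_O7 \<Longrightarrow>
    PU_class A \<otimes>\<^bsub>PUJ_O7\<^esub> PU_class B = PU_class (A ** B)"
  using normal.rcos_sum[OF normal_pm_Id] by (simp add: PUJ_O7_def PU_class_def)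

lemma one_PUJ_O7: "\<one>\<^bsub>PUJ_O7\<^esub> = PU_class (mat 1)"
  by (auto simp: PUJ_O7_def PU_class_eq pm_Id_def)

section \<open>The action on lines\<close>

lemma act_span: "act (PU_class A) (vec.span {v}) = vec.span {A *v v}"
proof -
  have 1: "A *v (k *s v) = k *s (A *v v)" "- A *v (k *s v) = (- k) *s (A *v v)" for k
    by (simp_all add: vec.scale vec_eq_iff)
  have "act (PU_class A) (vec.span {v}) =
      range (\<lambda>k. A *v (k *s v)) \<union> range (\<lambda>k. - A *v (k *s v))"
    by (simp add: act_def PU_class_eq vec.span_singleton image_image)
  also have "\<dots> = range (\<lambda>k. k *s (A *v v)) \<union> range (\<lambda>k. (- k) *s (A *v v))"
    by (simp only: 1)
  also have "\<dots> = range (\<lambda>k. k *s (A *v v))" by blast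
  finally show ?thesis by (simp only: vec.span_singleton)
qed

lemma span_eq_iff:
  fixes v w :: "complex^'n"
  assumes "v \<noteq> 0"
  shows "vec.span {v} = vec.span {w} \<longleftrightarrow> (\<exists>k. k \<noteq> 0 \<and> v = k *s w)"
proof
  assume "vec.span {v} = vec.span {w}"
  then have "v \<in> vec.span {w}" using vec.span_base by blast
  then show "\<exists>k. k \<noteq> 0 \<and> v = k *s w" using assms by (auto simp: vec.span_singleton)
next
  assume "\<exists>k. k \<noteq> 0 \<and> v = k *s w"
  then obtain k where k: "k \<noteq> 0" "v = k *s w" by blast
  have "j *s w = (j / k) *s v" "j *s v = (j * k) *s w" for j
    using k by simp_all
  then show "vec.span {v} = vec.span {w}"
    unfolding vec.span_singleton by blast
qed

lemma herm_scale: "herm (k *s v) (k *s v) = k * cnj k * herm v v"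
  by (simp add: herm_eq algebra_simps)

lemma herm_zero [simp]: "herm 0 v = 0"
  by (simp add: herm_eq)

lemma span_H2C_iff: "vec.span {v} \<in> H2C \<longleftrightarrow> Re (herm v v) < 0"
proof
  assume "vec.span {v} \<in> H2C"
  then obtain w where w: "vec.span {w} = vec.span {v}" "Re (herm w w) < 0"
    by (auto simp: H2C_def)
  then have "w \<noteq> 0" by auto
  with w obtain k where "w = k *s v"
    using span_eq_iff[of w v] by auto
  then have "herm w w = of_real ((cmod k)\<^sup>2) * herm v v"
    by (simp only: herm_scale complex_norm_square)
  then have "(cmod k)\<^sup>2 * Re (herm v v) < 0" using w(2) by simp
  then show "Re (herm v v) < 0" by (simp add: mult_less_0_iff)
qed (auto simp: H2C_def)

lemma fixed_points_PU_class:
  "fixed_points (PU_class A) = {vec.span {v} | v. Re (herm v v) < 0 \<and> vec.span {A *v v} = vec.span {v}}"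
proof (intro equalityI subsetI)
  fix p assume "p \<in> fixed_points (PU_class A)"
  then obtain v where v: "p = vec.span {v}" "Re (herm v v) < 0" "act (PU_class A) p = p"
    unfolding fixed_points_def H2C_def by blast
  then have "vec.span {A *v v} = vec.span {v}" using act_span[of A v] by simp
  with v show "p \<in> {vec.span {v} | v. Re (herm v v) < 0 \<and> vec.span {A *v v} = vec.span {v}}"
    by blast
next
  fix p assume "p \<in> {vec.span {v} | v. Re (herm v v) < 0 \<and> vec.span {A *v v} = vec.span {v}}"
  then obtain v where v: "p = vec.span {v}" "Re (herm v v) < 0" "vec.span {A *v v} = vec.span {v}"
    by blast
  then have "act (PU_class A) p = p" using act_span[of A v] by simp
  with v show "p \<in> fixed_points (PU_class A)"
    unfolding fixed_points_def H2C_def by blast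
qed

section \<open>The mirror as an upper half-plane\<close>

definition Pt :: "complex \<Rightarrow> (complex^3) set" where
  "Pt w = vec.span {vector [i_sqrt7 * w, 0, 1]}"

lemma Re_herm_self: "Re (herm v v) = 2 * Re (v $ 1 * cnj (v $ 3)) + (cmod (v $ 2))\<^sup>2"
  by (simp add: herm_eq cmod_power2) (simp add: algebra_simps power2_eq_square)

lemma span_eq_Pt:
  assumes "Re (herm v v) < 0" "v $ 2 = 0"
  shows "\<exists>w. Im w > 0 \<and> vec.span {v} = Pt w"
proof -
  have neg: "Re (v $ 1 * cnj (v $ 3)) < 0"
    using assms by (simp add: Re_herm_self)
  then have v3: "v $ 3 \<noteq> 0" by auto
  define w where "w = v $ 1 / (i_sqrt7 * v $ 3)"
  have v: "v = v $ 3 *s vector [i_sqrt7 * w, 0, 1]"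
    using assms(2) v3 by (simp add: vec_eq_iff forall_3 w_def)
  then have sp: "vec.span {v} = Pt w"
    unfolding Pt_def using v3 by (subst span_eq_iff) auto
  have "v $ 1 * cnj (v $ 3) = i_sqrt7 * w * (v $ 3 * cnj (v $ 3))"
    using v3 by (simp add: w_def)
  also have "\<dots> = i_sqrt7 * w * of_real ((cmod (v $ 3))\<^sup>2)"
    by (simp only: complex_norm_square)
  finally have "v $ 1 * cnj (v $ 3) = i_sqrt7 * w * of_real ((cmod (v $ 3))\<^sup>2)" .
  then have "Re (v $ 1 * cnj (v $ 3)) = - (sqrt 7 * Im w * (cmod (v $ 3))\<^sup>2)"
    by (simp add: mult.assoc)
  with neg v3 have "Im w > 0" by (simp add: zero_less_mult_iff)
  with sp show ?thesis by blast
qed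

lemma Pt_H2C [simp]: "Pt w \<in> H2C \<longleftrightarrow> Im w > 0"
  unfolding Pt_def span_H2C_iff by (simp add: Re_herm_self zero_less_mult_iff)

lemma Pt_eq_iff [simp]: "Pt w = Pt w' \<longleftrightarrow> w = w'"
proof
  have "vector [i_sqrt7 * w, 0, 1] \<noteq> (0 :: complex^3)"
    by (simp add: vec_eq_iff forall_3)
  moreover assume "Pt w = Pt w'"
  ultimately obtain k where "vector [i_sqrt7 * w, 0, 1] = k *s (vector [i_sqrt7 * w', 0, 1] :: complex^3)"
    using span_eq_iff unfolding Pt_def by blast
  then show "w = w'" by (simp add: vec_eq_iff forall_3)
qed simp

text \<open>The matrices of the elements of the stabilizer, normalised by their middle entry.\<close>

definition mat_E :: "complex \<Rightarrow> complex \<Rightarrow> complex \<Rightarrow> complex \<Rightarrow> complex^3^3" where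
  "mat_E a b c d = vector [vector [a, 0, b], vector [0, 1, 0], vector [c, 0, d]]"

lemma mat_E_mult: "mat_E a b c d ** mat_E a' b' c' d' =
    mat_E (a * a' + b * c') (a * b' + b * d') (c * a' + d * c') (c * b' + d * d')"
  by (simp add: mat_E_def matrix_matrix_mult_def vec_eq_iff forall_3 sum_3)

lemma mat_E_vec: "mat_E a b c d *v v = vector [a * v $ 1 + b * v $ 3, v $ 2, c * v $ 1 + d * v $ 3]"
  by (simp add: mat_E_def matrix_vector_mult_def vec_eq_iff forall_3 sum_3)

lemma mat_E_one: "mat_E 1 0 0 1 = mat 1"
  by (simp add: mat_E_def mat_def vec_eq_iff forall_3)

lemma mat_E_eq_iff: "mat_E a b c d = mat_E a' b' c' d' \<longleftrightarrow> a = a' \<and> b = b' \<and> c = c' \<and> d = d'"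
  by (auto simp: mat_E_def vec_eq_iff forall_3)

text \<open>The middle entries are 1 and -1. Hence an element of the projective group has at most
  one representative of this shape, and its entries become invariants.\<close>

lemma mat_E_neq: "mat_E a b c d \<noteq> - mat_E a' b' c' d'"
  by (simp add: mat_E_def vec_eq_iff forall_3)

lemma cnj_unit_eq:
  assumes "d * cnj a + b * cnj c = 1"
  shows "a * cnj d + c * cnj b = 1"
proof -
  have "a * cnj d + c * cnj b = cnj (d * cnj a + b * cnj c)" by (simp add: mult.commute)
  then show ?thesis using assms by simp
qed

lemma mat_E_UJ_iff: "mat_E a b c d \<in> UJ \<longleftrightarrow>
    a * cnj c + c * cnj a = 0 \<and> b * cnj d + d * cnj b = 0 \<and> d * cnj a + b * cnj c = 1"
  (is "?L \<longleftrightarrow> ?R")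
proof
  assume ?L
  then have H: "herm (mat_E a b c d *v v) (mat_E a b c d *v w) = herm v w" for v w
    by (simp add: UJ_def)
  show ?R
    \<comment> \<open>The outer basis vectors test that the outer columns are isotropic and pair to
      one.\<close>
    using H[of "vector [1, 0, 0]" "vector [1, 0, 0]"] H[of "vector [0, 0, 1]" "vector [0, 0, 1]"]
      H[of "vector [0, 0, 1]" "vector [1, 0, 0]"]
    by (simp add: mat_E_vec herm_eq algebra_simps)
next
  assume R: ?R
  then have R2: "a * cnj d + c * cnj b = 1" using cnj_unit_eq by blast
  have "herm (mat_E a b c d *v v) (mat_E a b c d *v w) =
    cnj (w $ 1) * v $ 1 * (a * cnj c + c * cnj a) + cnj (w $ 3) * v $ 3 * (b * cnj d + d * cnj b)
    + cnj (w $ 1) * v $ 3 * (d * cnj a + b * cnj c) + cnj (w $ 3) * v $ 1 * (a * cnj d + c * cnj b)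
    + cnj (w $ 2) * v $ 2" for v w
    by (simp add: mat_E_vec herm_eq algebra_simps)
  then have "herm (mat_E a b c d *v v) (mat_E a b c d *v w) = herm v w" for v w
    using R R2 by (simp add: herm_eq)
  then show ?L by (simp add: UJ_def)
qed

lemma mat_E_mat_O7_iff: "mat_E a b c d \<in> mat_O7 \<longleftrightarrow> a \<in> O7 \<and> b \<in> O7 \<and> c \<in> O7 \<and> d \<in> O7"
  by (auto simp: mat_O7_def mat_E_def forall_3)

text \<open>The inverse of a unitary matrix is its adjoint for the form, \<open>J\<close> times the
  conjugate transpose times \<open>J\<close>. In particular it has entries in \<open>O7\<close>
  whenever the matrix does.\<close>

lemma mat_E_inverse:
  assumes "mat_E a b c d \<in> UJ"
  shows "mat_E (cnj d) (cnj b) (cnj c) (cnj a) ** mat_E a b c d = mat 1"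
    "mat_E a b c d ** mat_E (cnj d) (cnj b) (cnj c) (cnj a) = mat 1"
proof -
  from assms have R: "a * cnj c + c * cnj a = 0" "b * cnj d + d * cnj b = 0" "d * cnj a + b * cnj c = 1"
    by (simp_all add: mat_E_UJ_iff)
  have "a * cnj d + c * cnj b = 1" using cnj_unit_eq[OF R(3)] .
  with R show "mat_E (cnj d) (cnj b) (cnj c) (cnj a) ** mat_E a b c d = mat 1"
    by (simp add: mat_E_mult mat_E_one[symmetric] mat_E_eq_iff algebra_simps)
  then show "mat_E a b c d ** mat_E (cnj d) (cnj b) (cnj c) (cnj a) = mat 1"
    using matrix_left_right_inverse by blast
qed

lemma mat_E_carrier_iff: "mat_E a b c d \<in> carrier UJ_O7 \<longleftrightarrow>
    a \<in> O7 \<and> b \<in> O7 \<and> c \<in> O7 \<and> d \<in> O7 \<and>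
    a * cnj c + c * cnj a = 0 \<and> b * cnj d + d * cnj b = 0 \<and> d * cnj a + b * cnj c = 1"
proof
  assume "mat_E a b c d \<in> carrier UJ_O7"
  then show "a \<in> O7 \<and> b \<in> O7 \<and> c \<in> O7 \<and> d \<in> O7 \<and>
    a * cnj c + c * cnj a = 0 \<and> b * cnj d + d * cnj b = 0 \<and> d * cnj a + b * cnj c = 1"
    by (auto simp: carrier_UJ_O7 GL3_O7_def mat_E_UJ_iff mat_E_mat_O7_iff)
next
  assume R: "a \<in> O7 \<and> b \<in> O7 \<and> c \<in> O7 \<and> d \<in> O7 \<and>
    a * cnj c + c * cnj a = 0 \<and> b * cnj d + d * cnj b = 0 \<and> d * cnj a + b * cnj c = 1"
  then have UJ: "mat_E a b c d \<in> UJ" by (simp add: mat_E_UJ_iff)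
  from R have "mat_E (cnj d) (cnj b) (cnj c) (cnj a) \<in> mat_O7" "mat_E a b c d \<in> mat_O7"
    by (simp_all add: mat_E_mat_O7_iff O7_cnj)
  with UJ mat_E_inverse[OF UJ] show "mat_E a b c d \<in> carrier UJ_O7"
    by (auto simp: carrier_UJ_O7 GL3_O7_def)
qed

text \<open>The given matrices of R and I have middle entry -1, so the normalised representatives
  are their negatives.\<close>

lemma elR_eq: "elR = PU_class (mat_E (-1) 0 0 (-1))"
  unfolding elR_def PU_class_eq_iff mat_E_def by (simp add: vec_eq_iff forall_3)

lemma elI_eq: "elI = PU_class (mat_E 0 (-1) (-1) 0)"
  unfolding elI_def PU_class_eq_iff mat_E_def by (simp add: vec_eq_iff forall_3)

lemma elM_eq: "elM = PU_class (mat_E i_sqrt7 4 2 (- i_sqrt7))"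
  by (simp add: elM_def mat_E_def)

lemma elTv_eq: "elTv = PU_class (mat_E 1 i_sqrt7 0 1)"
  by (simp add: elTv_def mat_E_def)

lemma polar_line_eq: "polar_line (vector [0, 1, 0]) = Pt ` {w. Im w > 0}"
proof
  show "polar_line (vector [0, 1, 0]) \<subseteq> Pt ` {w. Im w > 0}"
  proof
    fix p assume p: "p \<in> polar_line (vector [0, 1, 0])"
    then obtain v where v: "p = vec.span {v}" "Re (herm v v) < 0"
      by (auto simp: polar_line_def H2C_def)
    then have "herm v (vector [0, 1, 0]) = 0"
      using p vec.span_base[of v "{v}"] by (auto simp: polar_line_def)
    then have "v $ 2 = 0" by (simp add: herm_eq)
    then show "p \<in> Pt ` {w. Im w > 0}"
      using span_eq_Pt v by blast
  qed
  show "Pt ` {w. Im w > 0} \<subseteq> polar_line (vector [0, 1, 0])"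
  proof
    fix p assume "p \<in> Pt ` {w. Im w > 0}"
    then obtain w where w: "Im w > 0" "p = Pt w" by blast
    have "herm x (vector [0, 1, 0]) = 0" if "x \<in> Pt w" for x
      using that by (auto simp: Pt_def herm_eq vec.span_singleton)
    then show "p \<in> polar_line (vector [0, 1, 0])"
      using w by (simp add: polar_line_def)
  qed
qed

lemma mirror_R_eq: "mirror_R = Pt ` {w. Im w > 0}"
proof
  show "mirror_R \<subseteq> Pt ` {w. Im w > 0}"
  proof
    fix p assume "p \<in> mirror_R"
    then obtain v where v: "p = vec.span {v}" "Re (herm v v) < 0"
        "vec.span {v} = vec.span {mat_E (-1) 0 0 (-1) *v v}"
      unfolding mirror_R_def elR_eq fixed_points_PU_class by auto
    then have "v \<noteq> 0" by auto
    then obtain k where k: "v = k *s (mat_E (-1) 0 0 (-1) *v v)"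
      using span_eq_iff v(3) by blast
    have "v $ 2 = 0"
    \<comment> \<open>A nonzero middle component forces eigenvalue factor \<open>k = 1\<close>,
      which kills the first component and leaves a vector of positive norm.\<close>
    proof (rule ccontr)
      assume n: "v $ 2 \<noteq> 0"
      from k have "v $ 2 = k * v $ 2" "v $ 1 = - k * v $ 1"
        by (simp_all add: mat_E_vec vec_eq_iff forall_3)
      with n have "v $ 1 = 0" by (auto simp: eq_neg_iff_add_eq_0)
      with v(2) show False by (simp add: Re_herm_self)
    qed
    then show "p \<in> Pt ` {w. Im w > 0}"
      using span_eq_Pt v by blast
  qed
  have "act elR (Pt w) = Pt w" for w
    unfolding elR_eq Pt_def act_span
    by (subst span_eq_iff, simp add: mat_E_vec vec_eq_iff forall_3)
      (rule exI[of _ "-1"], simp add: mat_E_vec vec_eq_iff forall_3)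
  then show "Pt ` {w. Im w > 0} \<subseteq> mirror_R"
    by (auto simp: mirror_R_def fixed_points_def)
qed

section \<open>The stabilizer of the mirror\<close>

definition el :: "complex \<Rightarrow> complex \<Rightarrow> complex \<Rightarrow> complex \<Rightarrow> (complex^3^3) set" where
  "el a b c d = PU_class (mat_E a b c d)"

text \<open>The fractional linear map of the outer block in the coordinate
  \<open>i_sqrt7 * w\<close>, conjugated to the coordinate \<open>w\<close>.\<close>

definition mob :: "complex \<Rightarrow> complex \<Rightarrow> complex \<Rightarrow> complex \<Rightarrow> complex \<Rightarrow> complex" where
  "mob a b c d w = (a * i_sqrt7 * w + b) / (i_sqrt7 * (c * i_sqrt7 * w + d))"

text \<open>Invariance of the form plays the part of the determinant: it gives
  \<open>Re (p * cnj q) = - sqrt 7 * Im w\<close> for numerator \<open>p\<close> and denominator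
  \<open>q\<close>, whence both \<open>q \<noteq> 0\<close> and the transformation law of the
  imaginary part.\<close>

lemma act_el_Pt:
  assumes E: "mat_E a b c d \<in> carrier UJ_O7" and w: "Im w > 0"
  shows "c * i_sqrt7 * w + d \<noteq> 0" "act (el a b c d) (Pt w) = Pt (mob a b c d w)"
    "Im (mob a b c d w) * (cmod (c * i_sqrt7 * w + d))\<^sup>2 = Im w"
proof -
  let ?p = "a * i_sqrt7 * w + b" and ?q = "c * i_sqrt7 * w + d"
  let ?v = "vector [i_sqrt7 * w, 0, 1] :: complex^3"
  have Av: "mat_E a b c d *v ?v = vector [?p, 0, ?q]"
    by (simp add: mat_E_vec mult.assoc)
  have "herm (mat_E a b c d *v ?v) (mat_E a b c d *v ?v) = herm ?v ?v"
    using E by (simp add: carrier_UJ_O7 UJ_def)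
  then have "Re (herm (vector [?p, 0, ?q]) (vector [?p, 0, ?q])) = Re (herm ?v ?v)"
    unfolding Av by simp
  then have pq: "Re (?p * cnj ?q) = - sqrt 7 * Im w"
    unfolding Re_herm_self by simp
  show q: "?q \<noteq> 0"
  proof
    assume "?q = 0"
    with pq w show False by simp
  qed
  have "i_sqrt7 * (p / (i_sqrt7 * q)) * (q * cnj q) = p * cnj q" if "q \<noteq> 0" for p q
    using that by simp
  from this[OF q] have "i_sqrt7 * mob a b c d w * (?q * cnj ?q) = ?p * cnj ?q"
    unfolding mob_def .
  then have "Re (i_sqrt7 * mob a b c d w * of_real ((cmod ?q)\<^sup>2)) = - sqrt 7 * Im w"
    using pq by (simp only: complex_norm_square)
  then have "sqrt 7 * (Im (mob a b c d w) * (cmod ?q)\<^sup>2) = sqrt 7 * Im w"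
    by (simp add: mult.assoc)
  then show "Im (mob a b c d w) * (cmod ?q)\<^sup>2 = Im w" by simp
  have "vector [?p, 0, ?q] = ?q *s (vector [i_sqrt7 * mob a b c d w, 0, 1] :: complex^3)"
  proof -
    have "q * (i_sqrt7 * (p / (i_sqrt7 * q))) = p" if "q \<noteq> 0" for p q
      using that by simp
    from this[OF q] have "?q * (i_sqrt7 * mob a b c d w) = ?p"
      unfolding mob_def .
    then show ?thesis by (simp add: vec_eq_iff forall_3 algebra_simps)
  qed
  moreover have "vector [?p, 0, ?q] \<noteq> (0 :: complex^3)"
    using q by (simp add: vec_eq_iff forall_3)
  ultimately have "vec.span {vector [?p, 0, ?q]} = Pt (mob a b c d w)"
    unfolding Pt_def using q span_eq_iff by blast
  then show "act (el a b c d) (Pt w) = Pt (mob a b c d w)"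
    unfolding el_def Pt_def act_span Av .
qed

lemma Im_mob_pos:
  assumes "mat_E a b c d \<in> carrier UJ_O7" "Im w > 0"
  shows "Im (mob a b c d w) > 0"
  using act_el_Pt(3)[OF assms] assms(2) by (metis zero_less_mult_pos2 zero_le_power2
      less_eq_real_def mult_zero_right less_irrefl)

lemma PUJ_O7_act:
  assumes "g \<in> carrier PUJ_O7" "h \<in> carrier PUJ_O7"
  shows "act (g \<otimes>\<^bsub>PUJ_O7\<^esub> h) (vec.span {v}) = act g (act h (vec.span {v}))"
proof -
  obtain A B where "A \<in> carrier UJ_O7" "B \<in> carrier UJ_O7" "g = PU_class A" "h = PU_class B"
    using assms by (auto simp: carrier_PUJ_O7)
  then show ?thesis by (simp add: mult_PUJ_O7 act_span matrix_vector_mul_assoc)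
qed

lemma act_one [simp]: "act \<one>\<^bsub>PUJ_O7\<^esub> (vec.span {v}) = vec.span {v}"
  by (simp add: one_PUJ_O7 act_span)

lemma mat_E_inverse_carrier:
  assumes "mat_E a b c d \<in> carrier UJ_O7"
  shows "mat_E (cnj d) (cnj b) (cnj c) (cnj a) \<in> carrier UJ_O7"
proof -
  have UJ: "mat_E a b c d \<in> UJ" using assms by (simp add: carrier_UJ_O7)
  have "inv\<^bsub>UJ_O7\<^esub> mat_E a b c d \<in> carrier UJ_O7"
    using assms by (rule UJ_O7.inv_closed)
  moreover have "inv\<^bsub>UJ_O7\<^esub> mat_E a b c d = mat_E (cnj d) (cnj b) (cnj c) (cnj a)"
    (is "?i = ?e")
  proof -
    have "?i = ?e ** mat_E a b c d ** ?i"
      using mat_E_inverse[OF UJ] by simp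
    also have "\<dots> = ?e ** (mat_E a b c d ** ?i)" by (simp only: matrix_mul_assoc)
    also have "mat_E a b c d ** ?i = mat 1" using UJ_O7.r_inv[OF assms] by simp
    finally show ?thesis by simp
  qed
  ultimately show ?thesis by simp
qed

lemma el_closed: "mat_E a b c d \<in> carrier UJ_O7 \<Longrightarrow> el a b c d \<in> carrier PUJ_O7"
  by (simp add: el_def carrier_PUJ_O7)

lemma el_mult:
  assumes "mat_E a b c d \<in> carrier UJ_O7" "mat_E a' b' c' d' \<in> carrier UJ_O7"
  shows "el a b c d \<otimes>\<^bsub>PUJ_O7\<^esub> el a' b' c' d' =
      el (a * a' + b * c') (a * b' + b * d') (c * a' + d * c') (c * b' + d * d')"
    "mat_E (a * a' + b * c') (a * b' + b * d') (c * a' + d * c') (c * b' + d * d') \<in> carrier UJ_O7"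
  using assms UJ_O7.m_closed[OF assms] by (simp_all add: el_def mult_PUJ_O7 mat_E_mult)

lemma el_one: "\<one>\<^bsub>PUJ_O7\<^esub> = el 1 0 0 1" "mat_E 1 0 0 1 \<in> carrier UJ_O7"
  using UJ_O7.one_closed by (simp_all add: one_PUJ_O7 el_def mat_E_one)

lemma el_eq_iff: "el a b c d = el a' b' c' d' \<longleftrightarrow> a = a' \<and> b = b' \<and> c = c' \<and> d = d'"
  by (simp add: el_def PU_class_eq_iff mat_E_eq_iff mat_E_neq)

lemma el_inv:
  assumes "mat_E a b c d \<in> carrier UJ_O7"
  shows "inv\<^bsub>PUJ_O7\<^esub> el a b c d = el (cnj d) (cnj b) (cnj c) (cnj a)"
proof (rule PUJ_O7.inv_equality)
  have "mat_E a b c d \<in> UJ" using assms by (simp add: carrier_UJ_O7)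
  from mat_E_inverse(1)[OF this]
  show "el (cnj d) (cnj b) (cnj c) (cnj a) \<otimes>\<^bsub>PUJ_O7\<^esub> el a b c d = \<one>\<^bsub>PUJ_O7\<^esub>"
    using assms mat_E_inverse_carrier[OF assms] by (simp add: el_def mult_PUJ_O7 one_PUJ_O7)
qed (use assms mat_E_inverse_carrier el_closed in blast)+

text \<open>Points of the mirror span the plane of vectors with middle component 0, so
  \<open>A\<close> preserves this plane and, being unitary, its orthogonal complement. The middle
  entry is then a unit, and the choice of sign makes it 1.\<close>

lemma mirror_fixing_matrix:
  assumes A: "A \<in> carrier UJ_O7" and into: "\<And>w. Im w > 0 \<Longrightarrow> act (PU_class A) (Pt w) \<in> mirror_R"
  obtains a b c d where "mat_E a b c d \<in> carrier UJ_O7" "PU_class A = el a b c d"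
proof -
  have mid: "(A *v vector [i_sqrt7 * w, 0, 1]) $ 2 = 0" if w: "Im w > 0" for w
  proof -
    obtain w' where "act (PU_class A) (Pt w) = Pt w'" using into[OF w] by (auto simp: mirror_R_eq)
    then have "A *v vector [i_sqrt7 * w, 0, 1] \<in> Pt w'"
      unfolding Pt_def act_span using vec.span_base by blast
    then show ?thesis by (auto simp: Pt_def vec.span_singleton)
  qed
  \<comment> \<open>The middle component of the image is affine in \<open>w\<close>, so two points
    of the mirror suffice.\<close>
  have "A $ 2 $ 1 * (i_sqrt7 * \<i>) + A $ 2 $ 3 = 0" "A $ 2 $ 1 * (i_sqrt7 * (2 * \<i>)) + A $ 2 $ 3 = 0"
    using mid[of "\<i>"] mid[of "2 * \<i>"] by (simp_all add: matrix_vector_mult_def sum_3)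
  moreover have "A $ 2 $ 1 * (i_sqrt7 * (2 * \<i>)) + A $ 2 $ 3 - (A $ 2 $ 1 * (i_sqrt7 * \<i>) + A $ 2 $ 3)
      = A $ 2 $ 1 * (i_sqrt7 * \<i>)"
    by (simp add: algebra_simps)
  ultimately have A21: "A $ 2 $ 1 = 0" by simp
  with \<open>A $ 2 $ 1 * (i_sqrt7 * \<i>) + A $ 2 $ 3 = 0\<close> have A23: "A $ 2 $ 3 = 0" by simp
  define l where "l = A $ 2 $ 2"
  have row: "(A *v v) $ 2 = l * v $ 2" for v
    by (simp add: matrix_vector_mult_def sum_3 A21 A23 l_def)
  obtain B where B: "A ** B = mat 1" using A by (auto simp: carrier_UJ_O7 GL3_O7_def)
  then have AB: "A *v (B *v v) = v" for v by (simp add: matrix_vector_mul_assoc)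
  have lB: "l * (B *v v) $ 2 = v $ 2" for v
    using row[of "B *v v"] AB[of v] by simp
  from lB[of "vector [0, 1, 0]"] have l0: "l \<noteq> 0" by auto
  have H: "herm (A *v v) (A *v w) = herm v w" for v w
    using A by (simp add: carrier_UJ_O7 UJ_def)
  let ?e = "vector [0, 1, 0] :: complex^3"
  \<comment> \<open>Pairing with the image of the middle basis vector reads off the middle component
    of a preimage; by \<open>lB\<close> it vanishes for the outer basis vectors.\<close>
  have he: "herm (A *v ?e) v = cnj ((B *v v) $ 2)" for v
    using H[of ?e "B *v v"] AB[of v] by (simp add: herm_eq)
  have "(A *v ?e) $ 3 = 0"
    using he[of "vector [1, 0, 0]"] lB[of "vector [1, 0, 0]"] l0 by (simp add: herm_eq)
  moreover have "(A *v ?e) $ 1 = 0"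
    using he[of "vector [0, 0, 1]"] lB[of "vector [0, 0, 1]"] l0 by (simp add: herm_eq)
  ultimately have A12: "A $ 3 $ 2 = 0" "A $ 1 $ 2 = 0"
    by (simp_all add: matrix_vector_mult_def sum_3)
  have "l * cnj l = 1"
    using H[of ?e ?e] row[of ?e] \<open>(A *v ?e) $ 3 = 0\<close> \<open>(A *v ?e) $ 1 = 0\<close> by (simp add: herm_eq mult.commute)
  moreover have "l \<in> O7" using A by (simp add: l_def carrier_UJ_O7 GL3_O7_def mat_O7_def)
  ultimately have "l = 1 \<or> l = -1" by (rule O7_unit[rotated])
  then show thesis
  proof
    assume "l = 1"
    then have "A = mat_E (A $ 1 $ 1) (A $ 1 $ 3) (A $ 3 $ 1) (A $ 3 $ 3)"
      by (simp add: mat_E_def vec_eq_iff forall_3 A21 A23 A12 l_def)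
    then show thesis using that A by (metis el_def)
  next
    assume "l = -1"
    then have "- A = mat_E (- A $ 1 $ 1) (- A $ 1 $ 3) (- A $ 3 $ 1) (- A $ 3 $ 3)"
      by (simp add: mat_E_def vec_eq_iff forall_3 A21 A23 A12 l_def)
    then show thesis using that uminus_carrier_UJ_O7[OF A] by (metis el_def PU_class_uminus)
  qed
qed

lemma carrier_stab_mirror:
  "carrier stab_mirror = {el a b c d | a b c d. mat_E a b c d \<in> carrier UJ_O7}"
proof (intro equalityI subsetI)
  fix g assume "g \<in> carrier stab_mirror"
  then have g: "g \<in> carrier PUJ_O7" "act g ` mirror_R = mirror_R"
    by (auto simp: stab_mirror_def stabilizer_def)
  then obtain A where A: "A \<in> carrier UJ_O7" "g = PU_class A" by (auto simp: carrier_PUJ_O7)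
  have "act (PU_class A) (Pt w) \<in> mirror_R" if "Im w > 0" for w
    using g(2) A(2) that by (auto simp: mirror_R_eq)
  then obtain a b c d where "mat_E a b c d \<in> carrier UJ_O7" "PU_class A = el a b c d"
    using mirror_fixing_matrix[OF A(1)] by metis
  then show "g \<in> {el a b c d | a b c d. mat_E a b c d \<in> carrier UJ_O7}"
    unfolding A(2) by blast
next
  fix g assume "g \<in> {el a b c d | a b c d. mat_E a b c d \<in> carrier UJ_O7}"
  then obtain a b c d where E: "mat_E a b c d \<in> carrier UJ_O7" and g: "g = el a b c d" by blast
  have sub: "act (el a b c d) ` mirror_R \<subseteq> mirror_R" if "mat_E a b c d \<in> carrier UJ_O7" for a b c d
    using that act_el_Pt(2) Im_mob_pos by (auto simp: mirror_R_eq)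
  let ?h = "inv\<^bsub>PUJ_O7\<^esub> g"
  have gc: "g \<in> carrier PUJ_O7" using E g el_closed by simp
  have "mirror_R \<subseteq> act g ` mirror_R"
  proof
    fix p assume p: "p \<in> mirror_R"
    then obtain w where w: "p = Pt w" "Im w > 0" by (auto simp: mirror_R_eq)
    have "act ?h p \<in> mirror_R"
      using sub[OF mat_E_inverse_carrier[OF E]] p by (auto simp: g el_inv[OF E])
    moreover have "act g (act ?h p) = p"
      using PUJ_O7_act[OF gc PUJ_O7.inv_closed[OF gc]] gc by (simp add: w Pt_def)
    ultimately show "p \<in> act g ` mirror_R" by force
  qed
  with sub[OF E] gc show "g \<in> carrier stab_mirror"
    by (auto simp: stab_mirror_def stabilizer_def g)
qed

section \<open>Group structure of the stabilizer and of its quotient\<close>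

lemma stab_mirror_simps [simp]:
  "mult stab_mirror = mult PUJ_O7" "\<one>\<^bsub>stab_mirror\<^esub> = \<one>\<^bsub>PUJ_O7\<^esub>"
  by (simp_all add: stab_mirror_def)

lemma carrier_stab_mirrorE:
  assumes "g \<in> carrier stab_mirror"
  obtains a b c d where "mat_E a b c d \<in> carrier UJ_O7" "g = el a b c d"
  using assms by (auto simp: carrier_stab_mirror)

lemma subgroup_stab_mirror: "subgroup (carrier stab_mirror) PUJ_O7"
proof (rule PUJ_O7.subgroupI)
  show "carrier stab_mirror \<subseteq> carrier PUJ_O7"
    by (auto simp: carrier_stab_mirror el_closed)
  show "carrier stab_mirror \<noteq> {}"
    using el_one by (auto simp: carrier_stab_mirror)
  show "inv\<^bsub>PUJ_O7\<^esub> g \<in> carrier stab_mirror" if "g \<in> carrier stab_mirror" for g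
  proof -
    obtain a b c d where "mat_E a b c d \<in> carrier UJ_O7" "g = el a b c d"
      using \<open>g \<in> carrier stab_mirror\<close> unfolding carrier_stab_mirror by blast
    then show ?thesis
      using mat_E_inverse_carrier el_inv unfolding carrier_stab_mirror by blast
  qed
  show "g \<otimes>\<^bsub>PUJ_O7\<^esub> h \<in> carrier stab_mirror"
    if "g \<in> carrier stab_mirror" "h \<in> carrier stab_mirror" for g h
  proof -
    obtain a b c d where g: "mat_E a b c d \<in> carrier UJ_O7" "g = el a b c d"
      using \<open>g \<in> carrier stab_mirror\<close> unfolding carrier_stab_mirror by blast
    obtain a' b' c' d' where h: "mat_E a' b' c' d' \<in> carrier UJ_O7" "h = el a' b' c' d'"
      using \<open>h \<in> carrier stab_mirror\<close> unfolding carrier_stab_mirror by blast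
    show ?thesis
      using el_mult[OF g(1) h(1)] unfolding g(2) h(2) carrier_stab_mirror by blast
  qed
qed

interpretation stab: group stab_mirror
  using subgroup.subgroup_is_group[OF subgroup_stab_mirror PUJ_O7.is_group]
  by (simp add: stab_mirror_def)

lemma el_stab: "mat_E a b c d \<in> carrier UJ_O7 \<Longrightarrow> el a b c d \<in> carrier stab_mirror"
  by (auto simp: carrier_stab_mirror)

lemma inv_stab_mirror: "g \<in> carrier stab_mirror \<Longrightarrow> inv\<^bsub>stab_mirror\<^esub> g = inv\<^bsub>PUJ_O7\<^esub> g"
  using PUJ_O7.m_inv_consistent[OF subgroup_stab_mirror] by (simp add: stab_mirror_def)

lemma generators_carrier:
  "mat_E (-1) 0 0 (-1) \<in> carrier UJ_O7" "mat_E 0 (-1) (-1) 0 \<in> carrier UJ_O7"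
  "mat_E i_sqrt7 4 2 (- i_sqrt7) \<in> carrier UJ_O7" "mat_E 1 i_sqrt7 0 1 \<in> carrier UJ_O7"
  by (simp_all add: mat_E_carrier_iff i_sqrt7_sq)

lemmas generators_el = elR_eq[folded el_def] elI_eq[folded el_def] elM_eq[folded el_def] elTv_eq[folded el_def]

lemma generators_stab:
  "elR \<in> carrier stab_mirror" "elI \<in> carrier stab_mirror" "elM \<in> carrier stab_mirror"
  "elTv \<in> carrier stab_mirror"
  by (simp_all add: generators_el el_stab generators_carrier)

lemma elR_commute: "g \<in> carrier stab_mirror \<Longrightarrow> elR \<otimes>\<^bsub>PUJ_O7\<^esub> g = g \<otimes>\<^bsub>PUJ_O7\<^esub> elR"
  by (auto simp: carrier_stab_mirror generators_el el_mult generators_carrier)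

lemma triv_mirror_eq: "triv_mirror = {\<one>\<^bsub>PUJ_O7\<^esub>, elR}"
proof
  show "triv_mirror \<subseteq> {\<one>\<^bsub>PUJ_O7\<^esub>, elR}"
  proof
    fix g assume "g \<in> triv_mirror"
    then have g: "g \<in> carrier stab_mirror" "\<And>p. p \<in> mirror_R \<Longrightarrow> act g p = p"
      by (auto simp: triv_mirror_def)
    then obtain a b c d where E: "mat_E a b c d \<in> carrier UJ_O7" and ge: "g = el a b c d"
      by (auto elim: carrier_stab_mirrorE)
    have eq: "a * i_sqrt7 * w + b = i_sqrt7 * w * (c * i_sqrt7 * w + d)" if w: "Im w > 0" for w
    proof -
      have "Pt (mob a b c d w) = Pt w"
        using g(2)[of "Pt w"] act_el_Pt(2)[OF E w] w by (simp add: ge mirror_R_eq)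
      then have "a * i_sqrt7 * w + b = w * (i_sqrt7 * (c * i_sqrt7 * w + d))"
        using act_el_Pt(1)[OF E w] unfolding mob_def by (subst (asm) Pt_eq_iff) (simp only: divide_eq_eq, simp)
      then show ?thesis by (simp only: mult_ac)
    qed
    have e: "i_sqrt7 * i_sqrt7 = -7" by (rule i_sqrt7_sq)
    define A where "A = (a - d) * i_sqrt7"
    have q: "A * w + b + 7 * c * w * w = 0" if "Im w > 0" for w
      using eq[OF that] arg_cong[OF e, of "\<lambda>x. x * c * w * w"] by (simp add: A_def algebra_simps)
    \<comment> \<open>A quadratic polynomial vanishes on the half-plane; its second difference along
      \<open>\<i>\<close>, \<open>2 * \<i>\<close>, \<open>3 * \<i>\<close> isolates the leading
      coefficient.\<close>
    have "A * \<i> + b - 7 * c = 0" "A * (2 * \<i>) + b - 28 * c = 0" "A * (3 * \<i>) + b - 63 * c = 0"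
      using q[of "\<i>"] q[of "2 * \<i>"] q[of "3 * \<i>"] by (simp_all add: algebra_simps)
    moreover have "(A * (3 * \<i>) + b - 63 * c) - 2 * (A * (2 * \<i>) + b - 28 * c) + (A * \<i> + b - 7 * c) = - 14 * c"
      by (simp add: algebra_simps)
    ultimately have c: "c = 0" by simp
    with \<open>A * \<i> + b - 7 * c = 0\<close> \<open>A * (2 * \<i>) + b - 28 * c = 0\<close>
    have b: "b = - (A * \<i>)" "b = - (A * (2 * \<i>))" by (simp_all add: add_eq_0_iff)
    then have "A = 0" by simp
    with b(1) have "b = 0" "a = d" by (simp_all add: A_def)
    have "a * cnj a = 1" "a \<in> O7"
      using E c \<open>b = 0\<close> \<open>a = d\<close> by (simp_all add: mat_E_carrier_iff)
    then have "a = 1 \<or> a = -1" by (intro O7_unit)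
    then show "g \<in> {\<one>\<^bsub>PUJ_O7\<^esub>, elR}"
      using ge c \<open>b = 0\<close> \<open>a = d\<close> by (auto simp: generators_el el_one)
  qed
  have "act elR p = p" if "p \<in> mirror_R" for p
    using that by (auto simp: mirror_R_def fixed_points_def)
  moreover have "act \<one>\<^bsub>PUJ_O7\<^esub> p = p" if "p \<in> mirror_R" for p
    using that by (auto simp: mirror_R_eq Pt_def)
  ultimately show "{\<one>\<^bsub>PUJ_O7\<^esub>, elR} \<subseteq> triv_mirror"
    using generators_stab(1) stab.one_closed by (auto simp: triv_mirror_def)
qed

lemma elR_sq: "elR \<otimes>\<^bsub>PUJ_O7\<^esub> elR = \<one>\<^bsub>PUJ_O7\<^esub>"
  by (simp add: generators_el el_mult generators_carrier el_one)

lemma elR_neq_one: "elR \<noteq> \<one>\<^bsub>PUJ_O7\<^esub>"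
  by (simp add: generators_el el_one el_eq_iff)

lemma normal_triv_mirror: "triv_mirror \<lhd> stab_mirror"
  unfolding stab.normal_inv_iff
proof (intro conjI ballI)
  have "inv\<^bsub>stab_mirror\<^esub> elR = elR"
    using generators_stab elR_sq by (intro stab.inv_equality) simp_all
  then show "subgroup triv_mirror stab_mirror"
    using generators_stab(1) stab.one_closed stab.inv_one elR_sq stab.l_one[OF stab.one_closed]
      stab.l_one[OF generators_stab(1)] stab.r_one[OF generators_stab(1)]
    by (intro stab.subgroupI) (auto simp: triv_mirror_eq)
  fix x h assume x: "x \<in> carrier stab_mirror" and h: "h \<in> triv_mirror"
  have "elR \<otimes>\<^bsub>stab_mirror\<^esub> x \<otimes>\<^bsub>stab_mirror\<^esub> inv\<^bsub>stab_mirror\<^esub> x = elR"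
    using x generators_stab(1) stab.r_inv[OF x] stab.r_one[OF generators_stab(1)]
    by (subst stab.m_assoc) auto
  then show "x \<otimes>\<^bsub>stab_mirror\<^esub> h \<otimes>\<^bsub>stab_mirror\<^esub> inv\<^bsub>stab_mirror\<^esub> x \<in> triv_mirror"
    using h x stab.r_inv[OF x] stab.r_one[OF x] elR_commute[OF x] by (auto simp: triv_mirror_eq)
qed

lemma group_quot_mirror: "group quot_mirror"
  unfolding quot_mirror_def by (rule normal.factorgroup_is_group[OF normal_triv_mirror])

interpretation quot: group quot_mirror
  by (rule group_quot_mirror)

lemma quot_proj_hom: "quot_proj \<in> hom stab_mirror quot_mirror"
  unfolding quot_proj_def[abs_def] quot_mirror_def
  by (rule normal.r_coset_hom_Mod[OF normal_triv_mirror])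

interpretation quot_proj: group_hom stab_mirror quot_mirror quot_proj
  by unfold_locales (rule quot_proj_hom)

lemma quot_proj_eq_one_iff:
  assumes "g \<in> carrier stab_mirror"
  shows "quot_proj g = \<one>\<^bsub>quot_mirror\<^esub> \<longleftrightarrow> g \<in> triv_mirror"
proof -
  have sg: "subgroup triv_mirror stab_mirror" by (rule normal_imp_subgroup[OF normal_triv_mirror])
  show ?thesis
    unfolding quot_proj_def quot_mirror_def
    using stab.rcos_self[OF assms sg] stab.coset_join2[OF assms sg] by auto
qed

lemma central_extension_stab: "central_extension stab_mirror quot_mirror quot_proj"
  unfolding central_extension_def
proof (intro conjI)
  show "group_hom stab_mirror quot_mirror quot_proj" by unfold_locales
  show "quot_proj ` carrier stab_mirror = carrier quot_mirror"
    by (auto simp: quot_proj_def quot_mirror_def carrier_FactGroup)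
  have "triv_mirror \<subseteq> group_center stab_mirror"
    using generators_stab(1) elR_commute stab.one_closed stab.l_one stab.r_one
    by (auto simp: triv_mirror_eq group_center_def)
  then show "kernel stab_mirror quot_mirror quot_proj \<subseteq> group_center stab_mirror"
    using quot_proj_eq_one_iff by (auto simp: kernel_def)
qed

section \<open>Ping-pong\<close>

abbreviation el_tau :: "(complex^3^3) set" where
  "el_tau \<equiv> elM \<otimes>\<^bsub>PUJ_O7\<^esub> elTv \<otimes>\<^bsub>PUJ_O7\<^esub> elI"

lemma el_tau_eq: "el_tau = el 3 (- i_sqrt7) (- i_sqrt7) (- 2)"
    "mat_E 3 (- i_sqrt7) (- i_sqrt7) (- 2) \<in> carrier UJ_O7"
  using el_mult[OF generators_carrier(3,4)] el_mult[OF el_mult(2)[OF generators_carrier(3,4)] generators_carrier(2)]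
  by (simp_all add: generators_el i_sqrt7_sq)

lemma el_tau_stab: "el_tau \<in> carrier stab_mirror"
  using el_tau_eq el_stab by simp

text \<open>The outer block of \<tau> has trace 1 and determinant 1, hence satisfies
  \<open>X^2 - X + 1 = 0\<close> and has cube -1.\<close>

lemma el_tau_cube: "el_tau \<otimes>\<^bsub>PUJ_O7\<^esub> el_tau \<otimes>\<^bsub>PUJ_O7\<^esub> el_tau = elR"
proof -
  have "mat_E 3 (- i_sqrt7) (- i_sqrt7) (- 2) \<in> carrier UJ_O7" by (rule el_tau_eq)
  note m = el_mult[OF this this]
  show ?thesis
    unfolding el_tau_eq(1) m(1) using el_mult(1)[OF m(2) el_tau_eq(2)]
    by (simp add: i_sqrt7_sq generators_el algebra_simps)
qed

lemma elI_sq: "elI \<otimes>\<^bsub>PUJ_O7\<^esub> elI = \<one>\<^bsub>PUJ_O7\<^esub>"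
  using el_mult[OF generators_carrier(2,2)] by (simp add: generators_el el_one)

lemma elM_sq: "elM \<otimes>\<^bsub>PUJ_O7\<^esub> elM = \<one>\<^bsub>PUJ_O7\<^esub>"
  using el_mult[OF generators_carrier(3,3)] by (simp add: generators_el el_one i_sqrt7_sq)

lemma mob_simps:
  "mob 1 i_sqrt7 0 1 w = w + 1"
  "mob 0 (-1) (-1) 0 w = - 1 / (7 * w)"
  "mob i_sqrt7 4 2 (- i_sqrt7) w = (7 * w - 4) / (14 * w - 7)"
  "mob 3 (- i_sqrt7) (- i_sqrt7) (- 2) w = (3 * w - 1) / (7 * w - 2)"
  "mob (- 2) i_sqrt7 i_sqrt7 3 w = (2 * w - 1) / (7 * w - 3)"
proof -
  have e: "i_sqrt7 * (i_sqrt7 * x) = - 7 * x" for x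
    by (simp add: i_sqrt7_sq mult.assoc[symmetric])
  show "mob 1 i_sqrt7 0 1 w = w + 1" by (simp add: mob_def field_simps)
  show "mob 0 (-1) (-1) 0 w = - 1 / (7 * w)" by (simp add: mob_def e)
  have "mob i_sqrt7 4 2 (- i_sqrt7) w = (- (7 * w - 4)) / (- (14 * w - 7))"
    by (simp add: mob_def algebra_simps e i_sqrt7_sq)
  then show "mob i_sqrt7 4 2 (- i_sqrt7) w = (7 * w - 4) / (14 * w - 7)"
    by (simp only: minus_divide_divide)
  have "mob 3 (- i_sqrt7) (- i_sqrt7) (- 2) w = (i_sqrt7 * (3 * w - 1)) / (i_sqrt7 * (7 * w - 2))"
    by (simp add: mob_def algebra_simps e)
  then show "mob 3 (- i_sqrt7) (- i_sqrt7) (- 2) w = (3 * w - 1) / (7 * w - 2)" by simp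
  have "mob (- 2) i_sqrt7 i_sqrt7 3 w = (i_sqrt7 * (- (2 * w - 1))) / (i_sqrt7 * (- (7 * w - 3)))"
    by (simp add: mob_def algebra_simps e)
  then show "mob (- 2) i_sqrt7 i_sqrt7 3 w = (2 * w - 1) / (7 * w - 3)"
    by (simp only: minus_divide_divide mult_divide_mult_cancel_left i_sqrt7_nonzero not_False_eq_True)
qed

lemma act_generators:
  assumes "Im w > 0"
  shows "act elTv (Pt w) = Pt (w + 1)" "act elI (Pt w) = Pt (- 1 / (7 * w))"
    "act elM (Pt w) = Pt ((7 * w - 4) / (14 * w - 7))"
    "act el_tau (Pt w) = Pt ((3 * w - 1) / (7 * w - 2))"
    "act (inv\<^bsub>stab_mirror\<^esub> el_tau) (Pt w) = Pt ((2 * w - 1) / (7 * w - 3))"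
proof -
  show "act elTv (Pt w) = Pt (w + 1)" "act elI (Pt w) = Pt (- 1 / (7 * w))"
    "act elM (Pt w) = Pt ((7 * w - 4) / (14 * w - 7))"
    using act_el_Pt(2)[OF generators_carrier(4) assms] act_el_Pt(2)[OF generators_carrier(2) assms]
      act_el_Pt(2)[OF generators_carrier(3) assms]
    by (simp_all only: generators_el mob_simps)
  show "act el_tau (Pt w) = Pt ((3 * w - 1) / (7 * w - 2))"
    using act_el_Pt(2)[OF el_tau_eq(2) assms] by (simp only: el_tau_eq(1) mob_simps)
  have "inv\<^bsub>stab_mirror\<^esub> el_tau = el (- 2) i_sqrt7 i_sqrt7 3"
    using el_inv[OF el_tau_eq(2)] inv_stab_mirror[OF el_tau_stab] by (simp add: el_tau_eq(1))
  moreover have "mat_E (- 2) i_sqrt7 i_sqrt7 3 \<in> carrier UJ_O7"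
    using mat_E_inverse_carrier[OF el_tau_eq(2)] by simp
  ultimately show "act (inv\<^bsub>stab_mirror\<^esub> el_tau) (Pt w) = Pt ((2 * w - 1) / (7 * w - 3))"
    using act_el_Pt(2)[OF _ assms] by (simp only: mob_simps)
qed

lemma stab_mirror_act_Pt:
  assumes "g \<in> carrier stab_mirror" "Im w > 0"
  obtains w' where "Im w' > 0" "act g (Pt w) = Pt w'"
proof -
  obtain a b c d where "mat_E a b c d \<in> carrier UJ_O7" "g = el a b c d"
    using assms(1) by (rule carrier_stab_mirrorE)
  then show thesis using that act_el_Pt(2) Im_mob_pos assms(2) by blast
qed

text \<open>The complement in the upper half-plane of the ideal triangle with vertices
  \<open>0\<close>, \<open>1/2\<close> and \<open>\<infinity>\<close>.\<close>

fun region :: "nat \<Rightarrow> complex set" where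
  "region 0 = {w. Re w < 0}"
| "region (Suc 0) = {w. Re w > 1 / 2}"
| "region k = {w. (cmod w)\<^sup>2 < Re w / 2}"

lemma region_2: "region 2 = {w. (cmod w)\<^sup>2 < Re w / 2}"
  by (simp add: numeral_2_eq_2)

lemma Re_div: "Re (z / w) = Re (z * cnj w) / (cmod w)\<^sup>2"
  by (simp add: complex_div_cnj[of z w] )

lemma region_bounds:
  assumes "w \<in> region 2"
  shows "0 < Re w" "Re w < 1 / 2"
proof -
  have 1: "(cmod w)\<^sup>2 < Re w / 2" using assms by (simp add: numeral_2_eq_2)
  then show "0 < Re w" using zero_le_power2[of "cmod w"] by linarith
  moreover have "Re w * Re w < Re w * (1 / 2)"
  proof -
    have "(Re w)\<^sup>2 + (Im w)\<^sup>2 < Re w / 2" using 1 by (simp add: cmod_power2)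
    then have "(Re w)\<^sup>2 < Re w * (1 / 2)" using zero_le_power2[of "Im w"] by linarith
    then show ?thesis by (simp only: power2_eq_square)
  qed
  ultimately show "Re w < 1 / 2" by (simp only: mult_less_cancel_left_pos)
qed

lemma region_disjoint:
  assumes "w \<in> region j" "w \<in> region k" "j < 3" "k < 3"
  shows "j = k"
proof -
  have "j = 0 \<or> j = 1 \<or> j = 2" "k = 0 \<or> k = 1 \<or> k = 2" using assms by auto
  then show ?thesis using assms(1,2) region_bounds[of w] by auto
qed

lemma letter_val_stab: "letter_val stab_mirror elI elM el_tau l \<in> carrier stab_mirror"
  by (cases l) (simp_all only: letter_val.simps generators_stab el_tau_stab stab.inv_closed)

text \<open>I exchanges the two sides of the line \<open>Re w = 0\<close>, and M those of
  \<open>Re w = 1/2\<close>. Both \<tau> and its inverse send \<open>Re w < 0\<close> and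
  \<open>Re w > 1/2\<close> into the half-disc over the segment from 0 to 1/2, which contains the
  fixed point of \<tau>.\<close>

lemma region_step:
  assumes w: "Im w > 0" "w \<in> region k" and k: "k < 3" "k \<noteq> letter_factor l"
  obtains w' where "Im w' > 0" "w' \<in> region (letter_factor l)"
    "act (letter_val stab_mirror elI elM el_tau l) (Pt w) = Pt w'"
proof -
  let ?g = "letter_val stab_mirror elI elM el_tau l"
  obtain w' where w': "Im w' > 0" "act ?g (Pt w) = Pt w'"
    using stab_mirror_act_Pt[OF letter_val_stab w(1)] by metis
  define x y where "x = Re w" and "y = Im w"
  have wxy: "w = Complex x y" by (simp add: x_def y_def)
  have y: "y > 0" using w by (simp add: y_def)
  have k3: "k = 0 \<or> k = 1 \<or> k = 2" using k by auto
  have "w' \<in> region (letter_factor l)"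
  proof (cases l)
    case LI
    then have "x > 0" using k w(2) k3 region_bounds[of w] by (auto simp: x_def)
    have "w' = - 1 / (7 * w)" using act_generators(2)[OF w(1)] w' LI by simp
    then have "Re w' = - (7 * x) / (cmod (7 * w))\<^sup>2"
      by (simp add: Re_div x_def)
    moreover have "(cmod (7 * w))\<^sup>2 > 0" using w(1) by auto
    ultimately have "Re w' < 0" using \<open>x > 0\<close> by (simp add: divide_neg_pos)
    then show ?thesis using LI by simp
  next
    case LM
    then have "x < 1 / 2" using k w(2) k3 region_bounds[of w] by (auto simp: x_def)
    have nz: "14 * w - 7 \<noteq> 0" using y by (auto simp: wxy complex_eq_iff)
    have "w' = (7 * w - 4) / (14 * w - 7)" using act_generators(3)[OF w(1)] w' LM by simp
    \<comment> \<open>In this form M visibly reverses the sign of \<open>Re w - 1/2\<close>.\<close>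
    also have "\<dots> = 1 / 2 - 1 / (2 * (14 * w - 7))"
      using nz by (simp add: field_simps)
    also have "Re \<dots> = 1 / 2 - (2 * (14 * x - 7)) / (cmod (2 * (14 * w - 7)))\<^sup>2"
      by (simp add: Re_div x_def)
    finally have "Re w' = 1 / 2 - (2 * (14 * x - 7)) / (cmod (2 * (14 * w - 7)))\<^sup>2" .
    moreover have "(cmod (2 * (14 * w - 7)))\<^sup>2 > 0" using nz by simp
    then have "(2 * (14 * x - 7)) / (cmod (2 * (14 * w - 7)))\<^sup>2 < 0"
      using \<open>x < 1 / 2\<close> by (intro divide_neg_pos) simp_all
    ultimately have "Re w' > 1 / 2" by linarith
    then show ?thesis using LM by simp
  next
    case LT
    then have xx: "x < 0 \<or> x > 1 / 2" using k w(2) k3 by (auto simp: x_def)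
    have nz: "7 * w - 2 \<noteq> 0" using y by (auto simp: wxy complex_eq_iff)
    then have pos: "(cmod (7 * w - 2))\<^sup>2 > 0" by simp
    have w'eq: "w' = (3 * w - 1) / (7 * w - 2)" using act_generators(4)[OF w(1)] w' LT by simp
    \<comment> \<open>With the denominator cleared, membership in the half-disc reads
      \<open>2 |p|^2 < Re (p * cnj q)\<close>; for \<tau> the difference of the two sides is
      \<open>3 x^2 - x + 3 y^2\<close>.\<close>
    have "x < 3 * x\<^sup>2"
    proof (cases "x < 0")
      case True
      then show ?thesis using zero_le_power2[of x] by linarith
    next
      case False
      then have "x * (1 / 2) < x * x" using xx by (intro mult_strict_left_mono) auto
      then show ?thesis using False xx unfolding power2_eq_square by linarith
    qed
    then have "2 * ((3 * x - 1)\<^sup>2 + (3 * y)\<^sup>2) < (3 * x - 1) * (7 * x - 2) + 21 * y\<^sup>2"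
      using zero_less_power[OF y, of 2] by (simp add: power2_eq_square algebra_simps)
    then have "(cmod (3 * w - 1))\<^sup>2 < Re ((3 * w - 1) * cnj (7 * w - 2)) / 2"
      by (simp add: wxy cmod_power2) (simp add: power2_eq_square algebra_simps)
    then have "(cmod (3 * w - 1))\<^sup>2 / (cmod (7 * w - 2))\<^sup>2 <
        Re ((3 * w - 1) * cnj (7 * w - 2)) / 2 / (cmod (7 * w - 2))\<^sup>2"
      using pos by (rule divide_strict_right_mono)
    then have "(cmod w')\<^sup>2 < Re w' / 2"
      unfolding w'eq Re_div by (simp add: norm_divide power_divide mult.commute)
    then show ?thesis using LT by (simp add: numeral_2_eq_2)
  next
    case LT'
    then have xx: "x < 0 \<or> x > 1 / 2" using k w(2) k3 by (auto simp: x_def)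
    have nz: "7 * w - 3 \<noteq> 0" using y by (auto simp: wxy complex_eq_iff)
    then have pos: "(cmod (7 * w - 3))\<^sup>2 > 0" by simp
    have w'eq: "w' = (2 * w - 1) / (7 * w - 3)" using act_generators(5)[OF w(1)] w' LT' by simp
    \<comment> \<open>For the inverse of \<tau> the difference is
      \<open>(2 x - 1) (3 x - 1) + 6 y^2\<close>.\<close>
    have "(2 * x - 1) * (3 * x - 1) > 0"
      using xx by (auto simp: zero_less_mult_iff)
    then have "2 * ((2 * x - 1)\<^sup>2 + (2 * y)\<^sup>2) < (2 * x - 1) * (7 * x - 3) + 14 * y\<^sup>2"
      using zero_less_power[OF y, of 2] by (simp add: power2_eq_square algebra_simps)
    then have "(cmod (2 * w - 1))\<^sup>2 < Re ((2 * w - 1) * cnj (7 * w - 3)) / 2"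
      by (simp add: wxy cmod_power2) (simp add: power2_eq_square algebra_simps)
    then have "(cmod (2 * w - 1))\<^sup>2 / (cmod (7 * w - 3))\<^sup>2 <
        Re ((2 * w - 1) * cnj (7 * w - 3)) / 2 / (cmod (7 * w - 3))\<^sup>2"
      using pos by (rule divide_strict_right_mono)
    then have "(cmod w')\<^sup>2 < Re w' / 2"
      unfolding w'eq Re_div by (simp add: norm_divide power_divide mult.commute)
    then show ?thesis using LT' by (simp add: numeral_2_eq_2)
  qed
  with w' that show thesis by blast
qed

abbreviation "stab_prod \<equiv> letters_prod stab_mirror elI elM el_tau"

lemma stab_prod_closed: "stab_prod L \<in> carrier stab_mirror"
  by (induction L) (simp_all only: letters_prod_simps letter_val_stab stab.m_closed stab.one_closed)

lemma stab_act:
  "g \<in> carrier stab_mirror \<Longrightarrow> h \<in> carrier stab_mirror \<Longrightarrow>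
    act (g \<otimes>\<^bsub>PUJ_O7\<^esub> h) (Pt w) = act g (act h (Pt w))"
  using PUJ_O7_act subgroup.subset[OF subgroup_stab_mirror] unfolding Pt_def by blast

lemma region_stab_prod:
  assumes "alternating L" "L \<noteq> []" "Im w > 0" "w \<in> region k" "k < 3" "k \<noteq> letter_factor (last L)"
  obtains w' where "Im w' > 0" "w' \<in> region (letter_factor (hd L))" "act (stab_prod L) (Pt w) = Pt w'"
  using assms
proof (induction L arbitrary: thesis)
  case (Cons l L)
  let ?v = "letter_val stab_mirror elI elM el_tau l"
  have act: "act (stab_prod (l # L)) (Pt w) = act ?v (act (stab_prod L) (Pt w))"
    using stab_act[OF letter_val_stab stab_prod_closed] by simp
  show ?case
  proof (cases "L = []")
    case True
    then have "act (stab_prod L) (Pt w) = Pt w" by (simp add: Pt_def)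
    with act obtain w' where "Im w' > 0" "w' \<in> region (letter_factor l)" "act (stab_prod (l # L)) (Pt w) = Pt w'"
      using region_step[of w k l] Cons.prems True by auto
    then show ?thesis using Cons.prems(1) by simp
  next
    case False
    then have hd: "letter_factor (hd L) \<noteq> letter_factor l" and L: "alternating L"
      using Cons.prems(2) by (cases L; auto)+
    obtain w1 where w1: "Im w1 > 0" "w1 \<in> region (letter_factor (hd L))"
        "act (stab_prod L) (Pt w) = Pt w1"
      using Cons.IH[OF _ L False] Cons.prems False by auto
    have "letter_factor (hd L) < 3" by (cases "hd L") auto
    then show ?thesis
      using region_step[OF w1(1,2) _ hd] act w1(3) Cons.prems(1) by (metis list.sel(1))
  qed
qed simp

text \<open>With three regions, one differs from those of both the first and the last letter. A
  point starting there is moved into the region of the first letter, so the word need not be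
  cyclically reduced.\<close>

lemma stab_prod_not_triv:
  assumes "alternating L" "L \<noteq> []"
  shows "stab_prod L \<notin> triv_mirror"
proof
  assume triv: "stab_prod L \<in> triv_mirror"
  have "\<exists>k<3. k \<noteq> i \<and> k \<noteq> j" for i j :: nat
    by presburger
  then obtain k where k: "k < 3" "k \<noteq> letter_factor (hd L)" "k \<noteq> letter_factor (last L)"
    by blast
  have "\<exists>w. Im w > 0 \<and> w \<in> region k"
  proof -
    have "Complex (-1) 1 \<in> region 0" "Complex 1 1 \<in> region 1" "Complex (1/4) (1/8) \<in> region 2"
      by (simp_all add: region_2 cmod_power2 power_divide)
    moreover have "k = 0 \<or> k = 1 \<or> k = 2" using k by auto
    ultimately show ?thesis
      by (metis complex.sel(2) zero_less_one zero_less_divide_1_iff zero_less_numeral)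
  qed
  then obtain w where w: "Im w > 0" "w \<in> region k" by blast
  obtain w' where w': "Im w' > 0" "w' \<in> region (letter_factor (hd L))" "act (stab_prod L) (Pt w) = Pt w'"
    using region_stab_prod[OF assms w k(1,3)] by blast
  have "act (stab_prod L) (Pt w) = Pt w"
    using triv w(1) by (auto simp: triv_mirror_def mirror_R_eq)
  then have "w' = w" using w'(3) by simp
  moreover have "letter_factor (hd L) < 3" by (cases "hd L") auto
  ultimately show False using region_disjoint[of w] w w' k by blast
qed

section \<open>Generation\<close>

text \<open>The slack in \<open>7y\<^sup>2 < 1 - 1/16\<close> and \<open>7(2y - 1)\<^sup>2 < 1 - 1/4\<close> is needed for the reduction of forms,
  whose roots have positive imaginary part.\<close>

lemma exists_translate:
  fixes x :: real
  obtains k :: int where "112 * (x - of_int k)\<^sup>2 < 15 \<or> 28 * (2 * (x - of_int k) - 1)\<^sup>2 < 3"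
proof -
  \<comment> \<open>The shift by 7/20 puts \<open>y\<close> in the interval from -7/20 to 13/20. Its
    part up to 7/20 satisfies the first inequality, as \<open>7/20 < sqrt (15/112)\<close>; on the
    rest \<open>|2 y - 1| \<le> 3/10 < sqrt (3/28)\<close>.\<close>
  define y where "y = x - of_int \<lfloor>x + 7 / 20\<rfloor>"
  have y: "- 7 / 20 \<le> y" "y < 13 / 20" unfolding y_def by linarith+
  have "112 * y\<^sup>2 < 15 \<or> 28 * (2 * y - 1)\<^sup>2 < 3"
  proof (cases "y \<le> 7 / 20")
    case True
    then have "\<bar>y\<bar> \<le> 7 / 20" using y by (simp add: abs_le_iff)
    then have "y\<^sup>2 \<le> (7 / 20)\<^sup>2" by (metis abs_ge_zero power2_abs power_mono)
    then show ?thesis by (simp add: power2_eq_square)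
  next
    case False
    then have "\<bar>2 * y - 1\<bar> \<le> 3 / 10" using y by linarith
    then have "(2 * y - 1)\<^sup>2 \<le> (3 / 10)\<^sup>2" by (metis abs_ge_zero power2_abs power_mono)
    then show ?thesis by (simp add: power2_eq_square)
  qed
  then show thesis using that unfolding y_def by blast
qed

abbreviation "stab_gen \<equiv> generate stab_mirror {elI, elM, elTv, elR}"

lemma stab_gen_incl: "stab_gen \<subseteq> carrier stab_mirror"
  using generators_stab by (intro stab.generate_incl) auto

lemma translate_carrier: "mat_E 1 (i_sqrt7 * of_int k) 0 1 \<in> carrier UJ_O7"
  by (simp add: mat_E_carrier_iff O7_mult)

lemma translate_stab_gen: "el 1 (i_sqrt7 * of_int k) 0 1 \<in> stab_gen"
proof -
  have nat: "el 1 (i_sqrt7 * of_int (int n)) 0 1 \<in> stab_gen" for n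
  proof (induction n)
    case 0
    then show ?case using generate.one[of stab_mirror] by (simp add: el_one)
  next
    case (Suc n)
    have "elTv \<otimes>\<^bsub>stab_mirror\<^esub> el 1 (i_sqrt7 * of_int (int n)) 0 1 \<in> stab_gen"
      by (intro generate.eng generate.incl Suc) simp
    then show ?case
      by (simp add: generators_el el_mult generators_carrier translate_carrier algebra_simps
          del: of_int_of_nat_eq)
  qed
  show ?thesis
  proof (cases "k \<ge> 0")
    case True
    then show ?thesis using nat[of "nat k"] by simp
  next
    case False
    have "inv\<^bsub>stab_mirror\<^esub> el 1 (i_sqrt7 * of_int (int (nat (- k)))) 0 1 \<in> stab_gen"
      using generators_stab by (intro stab.generate_m_inv_closed nat) auto
    moreover have "inv\<^bsub>stab_mirror\<^esub> el 1 (i_sqrt7 * of_int (- k)) 0 1 = el 1 (i_sqrt7 * of_int k) 0 1"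
      by (subst inv_stab_mirror, intro el_stab translate_carrier, subst el_inv, rule translate_carrier) simp
    ultimately show ?thesis using False by simp
  qed
qed

lemma stab_gen_cancel:
  assumes g: "g \<in> stab_gen" and h: "h \<in> carrier stab_mirror" and gh: "g \<otimes>\<^bsub>PUJ_O7\<^esub> h \<in> stab_gen"
  shows "h \<in> stab_gen"
proof -
  have "inv\<^bsub>stab_mirror\<^esub> g \<in> stab_gen"
    using generators_stab g by (intro stab.generate_m_inv_closed) auto
  then have "inv\<^bsub>stab_mirror\<^esub> g \<otimes>\<^bsub>stab_mirror\<^esub> (g \<otimes>\<^bsub>stab_mirror\<^esub> h) \<in> stab_gen"
    using generate.eng[of "inv\<^bsub>stab_mirror\<^esub> g" stab_mirror _ "g \<otimes>\<^bsub>PUJ_O7\<^esub> h"] gh by simp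
  moreover have "g \<in> carrier stab_mirror" using g stab_gen_incl by blast
  ultimately show ?thesis using h by (simp only: stab.l_inv_assoc)
qed

text \<open>The first column \<open>(a, c)\<close> satisfies \<open>a = i \<surd>7 x c\<close> with \<open>x\<close> real; after a translation, one of
  \<open>I\<close> and \<open>M\<close> decreases \<open>|c|\<close>.\<close>

lemma el_stab_gen:
  "mat_E a b c d \<in> carrier UJ_O7 \<Longrightarrow> (cmod c)\<^sup>2 = of_nat n \<Longrightarrow> el a b c d \<in> stab_gen"
proof (induction n arbitrary: a b c d rule: less_induct)
  case (less n)
  note E = less.prems(1)
  then have R: "a \<in> O7" "b \<in> O7" "c \<in> O7" "d \<in> O7"
    "a * cnj c + c * cnj a = 0" "b * cnj d + d * cnj b = 0" "d * cnj a + b * cnj c = 1"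
    by (auto simp: mat_E_carrier_iff)
  show ?case
  proof (cases "c = 0")
    case True
    obtain na where na: "(cmod a)\<^sup>2 = of_int na" using O7_cases[OF R(1)] by metis
    obtain nd where nd: "(cmod d)\<^sup>2 = of_int nd" using O7_cases[OF R(4)] by metis
    \<comment> \<open>The norms of \<open>a\<close> and \<open>d\<close> are integers with product
      one, so \<open>a\<close> is 1 or -1 and the element is a translation, up to a factor
      \<open>elR\<close>.\<close>
    have da: "d * cnj a = 1" using R(7) True by simp
    then have "(cmod (d * cnj a))\<^sup>2 = 1" by simp
    then have "(cmod d)\<^sup>2 * (cmod a)\<^sup>2 = 1" by (simp add: norm_mult power_mult_distrib)
    then have "real_of_int (nd * na) = of_int 1" by (simp add: na nd)
    then have "nd * na = 1" unfolding of_int_eq_iff .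
    moreover have "na \<ge> 0" using na by (metis of_int_0_le_iff zero_le_power2)
    ultimately have "na = 1" by (metis zmult_eq_1_iff zero_le_one neg_0_le_iff_le not_one_le_zero)
    then have "a * cnj a = 1" using na by (metis complex_norm_square of_int_1 of_real_1)
    with R(1) have a: "a = 1 \<or> a = -1" by (rule O7_unit)
    have "d = a"
      using da \<open>a * cnj a = 1\<close> by (metis mult_right_cancel mult_zero_right zero_neq_one)
    moreover have "cnj a = a" using a by auto
    ultimately have "a * (b + cnj b) = 0" using R(6) by (simp add: algebra_simps)
    then have "b + cnj b = 0" using a by auto
    then have "cnj b = - b" by (simp add: eq_neg_iff_add_eq_0 add.commute)
    then obtain j where j: "b = i_sqrt7 * of_int j" using O7_imag[OF R(2)] by blast
    show ?thesis
    proof (cases "a = 1")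
      case True
      then show ?thesis using \<open>c = 0\<close> \<open>d = a\<close> j translate_stab_gen by simp
    next
      case False
      then have "a = -1" using a by simp
      have "elR \<otimes>\<^bsub>stab_mirror\<^esub> el 1 (i_sqrt7 * of_int (- j)) 0 1 \<in> stab_gen"
        by (intro generate.eng generate.incl translate_stab_gen) simp
      moreover have "elR \<otimes>\<^bsub>stab_mirror\<^esub> el 1 (i_sqrt7 * of_int (- j)) 0 1 = el a b c d"
        using el_mult(1)[OF generators_carrier(1) translate_carrier, of "- j"]
        by (simp add: generators_el \<open>a = -1\<close> \<open>d = a\<close> \<open>c = 0\<close> j)
      ultimately show ?thesis by simp
    qed
  next
    case False
    define x where "x = Im (a / c) / sqrt 7"
    have "Re (a * cnj c) = 0"
      using arg_cong[OF R(5), of Re] by (simp add: algebra_simps)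
    then have "Re (a / c) = 0" by (simp add: complex_div_cnj[of a c])
    then have "a / c = i_sqrt7 * of_real x"
      by (simp add: complex_eq_iff x_def)
    then have a: "a = i_sqrt7 * of_real x * c" using False by (simp add: field_simps)
    obtain k where k: "112 * (x - of_int k)\<^sup>2 < 15 \<or> 28 * (2 * (x - of_int k) - 1)\<^sup>2 < 3"
      by (rule exists_translate)
    define y where "y = x - of_int k"
    define a1 where "a1 = a + i_sqrt7 * of_int (- k) * c"
    define b1 where "b1 = b + i_sqrt7 * of_int (- k) * d"
    have a1: "a1 = i_sqrt7 * of_real y * c"
      by (simp add: a1_def a y_def algebra_simps)
    note tr = el_mult[OF translate_carrier[of "- k"] E]
    have E1: "mat_E a1 b1 c d \<in> carrier UJ_O7"
      and tr1: "el 1 (i_sqrt7 * of_int (- k)) 0 1 \<otimes>\<^bsub>PUJ_O7\<^esub> el a b c d = el a1 b1 c d"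
      using tr by (simp_all add: a1_def b1_def)
    have norm: "cmod (i_sqrt7 * of_real t * c) ^ 2 = 7 * t\<^sup>2 * (cmod c)\<^sup>2" for t
      by (simp add: norm_mult power_mult_distrib i_sqrt7_def)
    have cpos: "(cmod c)\<^sup>2 > 0" using False by simp
    have IH: "el a' b' c' d' \<in> stab_gen"
      if "mat_E a' b' c' d' \<in> carrier UJ_O7" "c' = i_sqrt7 * of_real t * c" "7 * t\<^sup>2 < 1" for a' b' c' d' t
    proof -
      have "c' \<in> O7" using that(1) by (simp add: mat_E_carrier_iff)
      then obtain m :: int where m: "(cmod c')\<^sup>2 = of_int m" using O7_cases by metis
      then have "m \<ge> 0" by (metis of_int_0_le_iff zero_le_power2)
      then have m': "(cmod c')\<^sup>2 = of_nat (nat m)" using m by simp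
      have "(cmod c')\<^sup>2 < (cmod c)\<^sup>2"
        using mult_strict_right_mono[OF that(3) cpos] by (simp add: that(2) norm)
      then have "nat m < n" using m' less.prems(2) by simp
      from less.IH[OF this that(1) m'] show ?thesis .
    qed
    \<comment> \<open>The lower left entry becomes \<open>- i_sqrt7 * y * c\<close> under
      \<open>elI\<close> and \<open>i_sqrt7 * (2 * y - 1) * c\<close> under \<open>elM\<close>; by
      the choice of \<open>k\<close> one of the factors of \<open>c\<close> has modulus below
      one.\<close>
    have "el a1 b1 c d \<in> stab_gen"
    proof (cases "112 * y\<^sup>2 < 15")
      case True
      note m = el_mult[OF generators_carrier(2) E1]
      have "el (0 * a1 + - 1 * c) (0 * b1 + - 1 * d) (- 1 * a1 + 0 * c) (- 1 * b1 + 0 * d) \<in> stab_gen"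
        by (rule IH[OF m(2), of "- y"]) (use True in \<open>simp_all add: a1\<close>)
      then have "elI \<otimes>\<^bsub>PUJ_O7\<^esub> el a1 b1 c d \<in> stab_gen"
        using m(1) generators_el(2) by metis
      then show ?thesis
        using stab_gen_cancel[OF generate.incl el_stab[OF E1]] by blast
    next
      case False
      then have y2: "28 * (2 * y - 1)\<^sup>2 < 3" using k by (simp add: y_def)
      note m = el_mult[OF generators_carrier(3) E1]
      have "el (i_sqrt7 * a1 + 4 * c) (i_sqrt7 * b1 + 4 * d) (2 * a1 + - i_sqrt7 * c)
          (2 * b1 + - i_sqrt7 * d) \<in> stab_gen"
        by (rule IH[OF m(2), of "2 * y - 1"]) (use y2 in \<open>simp_all add: a1 algebra_simps\<close>)
      then have "elM \<otimes>\<^bsub>PUJ_O7\<^esub> el a1 b1 c d \<in> stab_gen"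
        using m(1) generators_el(3) by metis
      then show ?thesis
        using stab_gen_cancel[OF generate.incl el_stab[OF E1]] by blast
    qed
    then show ?thesis
      using stab_gen_cancel[OF translate_stab_gen el_stab[OF E]] tr1 by metis
  qed
qed

lemma stab_gen_eq: "stab_gen = carrier stab_mirror"
proof
  show "carrier stab_mirror \<subseteq> stab_gen"
  proof
    fix g assume "g \<in> carrier stab_mirror"
    then obtain a b c d where E: "mat_E a b c d \<in> carrier UJ_O7" and g: "g = el a b c d"
      by (rule carrier_stab_mirrorE)
    then have "c \<in> O7" by (simp add: mat_E_carrier_iff)
    then obtain m :: int where m: "(cmod c)\<^sup>2 = of_int m" using O7_cases by metis
    then have "m \<ge> 0" by (metis of_int_0_le_iff zero_le_power2)
    then have "(cmod c)\<^sup>2 = of_nat (nat m)" using m by simp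
    with E show "g \<in> stab_gen" unfolding g by (rule el_stab_gen)
  qed
qed (rule stab_gen_incl)

section \<open>The presentations\<close>

lemma presentation_stab_mirror: "has_presentation stab_mirror gens_stab rels_stab gen_elt"
proof (rule stab.presentation_stab[where i = elI and m = elM and u = elTv and t = el_tau and r = elR])
  show "generate stab_mirror {elI, elM, elTv, elR} = carrier stab_mirror" by (rule stab_gen_eq)
  show "stab_prod L \<notin> {\<one>\<^bsub>stab_mirror\<^esub>, elR}" if "alternating L" "L \<noteq> []" for L
    using stab_prod_not_triv[OF that] by (simp add: triv_mirror_eq)
qed (use generators_stab in \<open>simp_all add: elI_sq elM_sq elR_sq elR_neq_one el_tau_cube elR_commute\<close>)

lemma presentation_quot_mirror:
  "has_presentation quot_mirror gens_quot rels_quot (\<lambda>x. quot_proj (gen_elt x))"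
proof (rule quot.presentation_quot[where i = "quot_proj elI" and m = "quot_proj elM"
      and u = "quot_proj elTv" and t = "quot_proj el_tau"])
  note [simp] = generators_stab el_tau_stab
  have R: "quot_proj elR = \<one>\<^bsub>quot_mirror\<^esub>"
    by (simp add: quot_proj_eq_one_iff triv_mirror_eq)
  have mult: "quot_proj g \<otimes>\<^bsub>quot_mirror\<^esub> quot_proj h = quot_proj (g \<otimes>\<^bsub>PUJ_O7\<^esub> h)"
    if "g \<in> carrier stab_mirror" "h \<in> carrier stab_mirror" for g h
    using quot_proj.hom_mult[OF that] by simp
  have mc: "g \<otimes>\<^bsub>PUJ_O7\<^esub> h \<in> carrier stab_mirror"
    if "g \<in> carrier stab_mirror" "h \<in> carrier stab_mirror" for g h
    using stab.m_closed[OF that] by simp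
  show "quot_proj el_tau = quot_proj elM \<otimes>\<^bsub>quot_mirror\<^esub> quot_proj elTv \<otimes>\<^bsub>quot_mirror\<^esub> quot_proj elI"
    by (simp add: mult mc)
  have one: "quot_proj \<one>\<^bsub>PUJ_O7\<^esub> = \<one>\<^bsub>quot_mirror\<^esub>"
    using quot_proj.hom_one by simp
  show "quot_proj elI \<otimes>\<^bsub>quot_mirror\<^esub> quot_proj elI = \<one>\<^bsub>quot_mirror\<^esub>"
    "quot_proj elM \<otimes>\<^bsub>quot_mirror\<^esub> quot_proj elM = \<one>\<^bsub>quot_mirror\<^esub>"
    by (simp_all add: mult elI_sq elM_sq one)
  show "quot_proj el_tau \<otimes>\<^bsub>quot_mirror\<^esub> quot_proj el_tau \<otimes>\<^bsub>quot_mirror\<^esub> quot_proj el_tau = \<one>\<^bsub>quot_mirror\<^esub>"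
    using mult[OF mc[OF el_tau_stab el_tau_stab] el_tau_stab] mult[OF el_tau_stab el_tau_stab]
    by (simp only: el_tau_cube R)
  have sub: "{elI, elM, elTv, elR} \<subseteq> carrier stab_mirror" by simp
  have "generate quot_mirror {quot_proj elI, quot_proj elM, quot_proj elTv, \<one>\<^bsub>quot_mirror\<^esub>} = carrier quot_mirror"
    using quot_proj.generate_img[OF sub] central_extension_stab
    by (simp add: R stab_gen_eq central_extension_def)
  moreover have "{quot_proj elI, quot_proj elM, quot_proj elTv, \<one>\<^bsub>quot_mirror\<^esub>} \<subseteq>
      generate quot_mirror {quot_proj elI, quot_proj elM, quot_proj elTv}"
    by (auto intro: generate.intros)
  then have "generate quot_mirror {quot_proj elI, quot_proj elM, quot_proj elTv, \<one>\<^bsub>quot_mirror\<^esub>} \<subseteq>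
      generate quot_mirror {quot_proj elI, quot_proj elM, quot_proj elTv}"
    by (intro quot.generate_subgroup_incl quot.generate_is_subgroup) (auto intro: quot_proj.hom_closed)
  moreover have "generate quot_mirror {quot_proj elI, quot_proj elM, quot_proj elTv} \<subseteq> carrier quot_mirror"
    by (intro quot.generate_incl) (auto intro: quot_proj.hom_closed)
  ultimately show "generate quot_mirror {quot_proj elI, quot_proj elM, quot_proj elTv} = carrier quot_mirror"
    by blast
  show "letters_prod quot_mirror (quot_proj elI) (quot_proj elM) (quot_proj el_tau) L \<noteq> \<one>\<^bsub>quot_mirror\<^esub>"
    if L: "alternating L" "L \<noteq> []" for L
  proof -
    have "letter_val quot_mirror (quot_proj elI) (quot_proj elM) (quot_proj el_tau) l =
        quot_proj (letter_val stab_mirror elI elM el_tau l)" for l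
      by (cases l) (simp_all only: letter_val.simps quot_proj.hom_inv el_tau_stab)
    then have "letters_prod quot_mirror (quot_proj elI) (quot_proj elM) (quot_proj el_tau) K =
        quot_proj (stab_prod K)" for K
      by (induction K) (simp_all add: one mult letter_val_stab stab_prod_closed)
    then show ?thesis
      using stab_prod_not_triv[OF L] quot_proj_eq_one_iff[OF stab_prod_closed] by simp
  qed
qed (use generators_stab quot_proj.hom_closed in simp_all)

section \<open>Fixed points\<close>

definition wI :: complex where "wI = i_sqrt7 / 7"
definition wM :: complex where "wM = (7 + i_sqrt7) / 14"
definition wT :: complex where "wT = (5 + \<i> * of_real (sqrt 3)) / 14"

lemma Im_base [simp]: "Im wI = sqrt 7 / 7" "Im wM = sqrt 7 / 14" "Im wT = sqrt 3 / 14"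
  by (simp_all add: wI_def wM_def wT_def)

lemma square_eq_upper_iff:
  fixes z t :: complex
  assumes "Im z > 0" "Im t > 0"
  shows "z * z = t * t \<longleftrightarrow> z = t"
proof
  assume "z * z = t * t"
  then have "(z - t) * (z + t) = 0" by (simp add: algebra_simps)
  moreover have "Im (z + t) \<noteq> 0" using assms by simp
  then have "z + t \<noteq> 0" by (metis zero_complex.sel(2))
  ultimately show "z = t" by simp
qed simp

text \<open>Completing the square gives an equality of squares of two points of the upper
  half-plane, where square roots are unique.\<close>

lemma root_base:
  assumes "Im w > 0"
  shows "7 * w * w + 1 = 0 \<longleftrightarrow> w = wI" "14 * w * w - 14 * w + 4 = 0 \<longleftrightarrow> w = wM"
    "7 * w * w - 5 * w + 1 = 0 \<longleftrightarrow> w = wT"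
proof -
  have s3: "\<i> * of_real (sqrt 3) * (\<i> * of_real (sqrt 3)) = (-3 :: complex)"
  proof -
    have "\<i> * of_real (sqrt 3) * (\<i> * of_real (sqrt 3)) = \<i> * \<i> * complex_of_real (sqrt 3 * sqrt 3)"
      unfolding of_real_mult by (simp add: mult_ac)
    then show ?thesis by simp
  qed
  define x where "x = 7 * w * w + 1"
  have "(7 * w) * (7 * w) = 7 * x - 7"
    by (simp add: x_def algebra_simps)
  then have "7 * w * w + 1 = 0 \<longleftrightarrow> (7 * w) * (7 * w) = i_sqrt7 * i_sqrt7"
    unfolding i_sqrt7_sq x_def[symmetric] by simp
  also have "\<dots> \<longleftrightarrow> 7 * w = i_sqrt7"
    by (rule square_eq_upper_iff) (simp_all add: assms)
  also have "\<dots> \<longleftrightarrow> w = wI"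
    by (auto simp: wI_def field_simps)
  finally show "7 * w * w + 1 = 0 \<longleftrightarrow> w = wI" .
  define y where "y = 14 * w * w - 14 * w + 4"
  have "(14 * w - 7) * (14 * w - 7) = 14 * y - 7"
    by (simp add: y_def algebra_simps)
  then have "14 * w * w - 14 * w + 4 = 0 \<longleftrightarrow> (14 * w - 7) * (14 * w - 7) = i_sqrt7 * i_sqrt7"
    unfolding i_sqrt7_sq y_def[symmetric] by simp
  also have "\<dots> \<longleftrightarrow> 14 * w - 7 = i_sqrt7"
    by (rule square_eq_upper_iff) (simp_all add: assms)
  finally show "14 * w * w - 14 * w + 4 = 0 \<longleftrightarrow> w = wM" by (auto simp: wM_def field_simps)
  define u where "u = 7 * w * w - 5 * w + 1"
  have "(14 * w - 5) * (14 * w - 5) = 28 * u - 3"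
    by (simp add: u_def algebra_simps)
  then have "7 * w * w - 5 * w + 1 = 0 \<longleftrightarrow>
      (14 * w - 5) * (14 * w - 5) = \<i> * of_real (sqrt 3) * (\<i> * of_real (sqrt 3))"
    unfolding s3 u_def[symmetric] by simp
  also have "\<dots> \<longleftrightarrow> 14 * w - 5 = \<i> * of_real (sqrt 3)"
    by (rule square_eq_upper_iff) (simp_all add: assms)
  finally show "7 * w * w - 5 * w + 1 = 0 \<longleftrightarrow> w = wT" by (auto simp: wT_def field_simps)
qed

lemma act_fix_iff:
  assumes "Im w > 0"
  shows "act elI (Pt w) = Pt w \<longleftrightarrow> w = wI" "act elM (Pt w) = Pt w \<longleftrightarrow> w = wM"
    "act el_tau (Pt w) = Pt w \<longleftrightarrow> w = wT"
proof -
  have nz: "w \<noteq> 0" "14 * w - 7 \<noteq> 0" "7 * w - 2 \<noteq> 0"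
    using assms by (auto simp: complex_eq_iff)
  have "- 1 / (7 * w) = w \<longleftrightarrow> 7 * w * w = - 1"
    using nz(1) by (subst divide_eq_eq) (auto simp: mult_ac)
  then have "- 1 / (7 * w) = w \<longleftrightarrow> 7 * w * w + 1 = 0"
    by (simp only: eq_neg_iff_add_eq_0)
  then show "act elI (Pt w) = Pt w \<longleftrightarrow> w = wI"
    using root_base[OF assms] act_generators[OF assms] by simp
  have "(7 * w - 4) / (14 * w - 7) = w \<longleftrightarrow> 14 * w * w - 14 * w + 4 = 0"
    using nz(2) by (subst divide_eq_eq) (auto simp: algebra_simps)
  then show "act elM (Pt w) = Pt w \<longleftrightarrow> w = wM"
    using root_base[OF assms] act_generators[OF assms] by simp
  have "(3 * w - 1) / (7 * w - 2) = w \<longleftrightarrow> 7 * w * w - 5 * w + 1 = 0"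
    using nz(3) by (subst divide_eq_eq) (auto simp: algebra_simps)
  then show "act el_tau (Pt w) = Pt w \<longleftrightarrow> w = wT"
    using root_base[OF assms] act_generators[OF assms] by simp
qed

text \<open>A fixed line off the mirror has a nonzero middle component, so the middle entry 1 makes
  its eigenvalue 1. It therefore suffices to exclude negative eigenvectors for 1.\<close>

lemma fixed_points_el:
  assumes "\<And>v. Re (herm v v) < 0 \<Longrightarrow> v = mat_E a b c d *v v \<Longrightarrow> v $ 2 = 0"
  shows "fixed_points (el a b c d) = {Pt w | w. Im w > 0 \<and> act (el a b c d) (Pt w) = Pt w}"
proof (intro equalityI subsetI)
  fix p assume p: "p \<in> fixed_points (el a b c d)"
  then obtain v where v: "p = vec.span {v}" "Re (herm v v) < 0" "vec.span {mat_E a b c d *v v} = vec.span {v}"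
    unfolding el_def fixed_points_PU_class by blast
  then have "v \<noteq> 0" by auto
  then obtain k where k: "v = k *s (mat_E a b c d *v v)"
    using span_eq_iff v(3) by metis
  have "v $ 2 = 0"
  proof (rule ccontr)
    assume "v $ 2 \<noteq> 0"
    moreover have "v $ 2 = k * v $ 2"
      using arg_cong[OF k, of "\<lambda>v. v $ 2"] by (simp add: mat_E_vec)
    ultimately have "k = 1" by simp
    with k have "v = mat_E a b c d *v v" by simp
    with assms v(2) \<open>v $ 2 \<noteq> 0\<close> show False by blast
  qed
  then obtain w where "Im w > 0" "p = Pt w" using span_eq_Pt v by blast
  with p show "p \<in> {Pt w | w. Im w > 0 \<and> act (el a b c d) (Pt w) = Pt w}"
    by (auto simp: fixed_points_def)
qed (auto simp: fixed_points_def)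

text \<open>The outer block of M has eigenvalues 1 and -1, so the eigenspace of M for 1 is a plane.
  Its vector in the outer coordinates has positive norm, hence the plane contains no negative
  vector.\<close>

lemma fixed_points_elM: "fixed_points elM = {Pt wM}"
proof -
  have "fixed_points elM = {Pt w | w. Im w > 0 \<and> act elM (Pt w) = Pt w}"
    unfolding generators_el
  proof (rule fixed_points_el)
    fix v assume v: "Re (herm v v) < 0" "v = mat_E i_sqrt7 4 2 (- i_sqrt7) *v v"
    have "v $ 3 = 2 * v $ 1 - i_sqrt7 * v $ 3"
      using arg_cong[OF v(2), of "\<lambda>v. v $ 3"] by (simp add: mat_E_vec)
    then have "v $ 1 = (1 + i_sqrt7) / 2 * v $ 3" by (simp add: field_simps)
    then have "v $ 1 * cnj (v $ 3) = (1 + i_sqrt7) / 2 * (v $ 3 * cnj (v $ 3))" by simp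
    also have "\<dots> = (1 + i_sqrt7) / 2 * of_real ((cmod (v $ 3))\<^sup>2)" by (simp only: complex_norm_square)
    finally have "Re (v $ 1 * cnj (v $ 3)) = Re ((1 + i_sqrt7) / 2 * of_real ((cmod (v $ 3))\<^sup>2))"
      by (rule arg_cong)
    also have "\<dots> = (cmod (v $ 3))\<^sup>2 / 2" by simp
    finally have "Re (v $ 1 * cnj (v $ 3)) = (cmod (v $ 3))\<^sup>2 / 2" .
    then show "v $ 2 = 0" using v(1) zero_le_power2[of "cmod (v $ 3)"] zero_le_power2[of "cmod (v $ 2)"]
      unfolding Re_herm_self by linarith
  qed
  also have "\<dots> = {Pt wM}" using act_fix_iff(2) by (auto simp: act_fix_iff(2)[of wM])
  finally show ?thesis .
qed

text \<open>1 is not a root of \<open>X^2 - X + 1\<close>, the characteristic polynomial of the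
  outer block, so a vector fixed by the matrix has vanishing outer components and is not
  negative.\<close>

lemma fixed_points_el_tau: "fixed_points el_tau = {Pt wT}"
proof -
  have "fixed_points el_tau = {Pt w | w. Im w > 0 \<and> act el_tau (Pt w) = Pt w}"
    unfolding el_tau_eq(1)
  proof (rule fixed_points_el)
    fix v assume v: "Re (herm v v) < 0" "v = mat_E 3 (- i_sqrt7) (- i_sqrt7) (- 2) *v v"
    have 1: "v $ 1 = 3 * v $ 1 - i_sqrt7 * v $ 3"
      using arg_cong[OF v(2), of "\<lambda>v. v $ 1"] by (simp add: mat_E_vec)
    have 3: "v $ 3 = - i_sqrt7 * v $ 1 - 2 * v $ 3"
      using arg_cong[OF v(2), of "\<lambda>v. v $ 3"] by (simp add: mat_E_vec)
    from 1 have "2 * v $ 1 = i_sqrt7 * v $ 3" by (simp add: algebra_simps)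
    then have "2 * (i_sqrt7 * v $ 1) = i_sqrt7 * i_sqrt7 * v $ 3" by simp
    moreover from 3 have "i_sqrt7 * v $ 1 = - 3 * v $ 3" by (simp add: algebra_simps eq_neg_iff_add_eq_0)
    ultimately have "v $ 3 = 0" by (simp add: i_sqrt7_sq)
    then show "v $ 2 = 0" using v(1) zero_le_power2[of "cmod (v $ 2)"]
      by (simp add: Re_herm_self)
  qed
  also have "\<dots> = {Pt wT}" using act_fix_iff(3) by (auto simp: act_fix_iff(3)[of wT])
  finally show ?thesis .
qed

lemma isolated_fixed_points_singleton:
  "fixed_points g = {p} \<Longrightarrow> isolated_fixed_points g = {p}"
  by (auto simp: isolated_fixed_points_def derived_set_of_def)

lemma isotropic_points_iff:
  "p \<in> isotropic_points \<longleftrightarrow>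
    p \<in> mirror_R \<and> (\<exists>g \<in> carrier stab_mirror. g \<notin> triv_mirror \<and> act g p = p)"
proof -
  let ?S = "stabilizer stab_mirror act p"
  have one: "\<one>\<^bsub>isotropy p\<^esub> = triv_mirror" by (simp add: isotropy_def)
  \<comment> \<open>Cosets do not depend on the carrier, so the isotropy group is the image of the
    point stabilizer in \<open>quot_mirror\<close>.\<close>
  have "r_coset (stab_mirror\<lparr>carrier := ?S\<rparr>) H g = r_coset stab_mirror H g" for H g
    by (simp add: r_coset_def)
  then have car: "carrier (isotropy p) = quot_proj ` ?S"
    by (simp add: isotropy_def carrier_FactGroup quot_proj_def)
  have qp: "quot_proj g = triv_mirror \<longleftrightarrow> g \<in> triv_mirror" if "g \<in> ?S" for g
    using quot_proj_eq_one_iff[of g] that by (simp add: quot_mirror_def stabilizer_def)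
  have "carrier (isotropy p) = {\<one>\<^bsub>isotropy p\<^esub>} \<longleftrightarrow> (\<forall>g\<in>?S. g \<in> triv_mirror)"
    if p: "p \<in> mirror_R"
  proof -
    have ne: "\<one>\<^bsub>PUJ_O7\<^esub> \<in> ?S"
      using p stab.one_closed by (auto simp: stabilizer_def mirror_R_eq Pt_def)
    have "f ` A = {x} \<longleftrightarrow> (\<forall>a\<in>A. f a = x)" if "y \<in> A"
      for f :: "(complex^3^3) set \<Rightarrow> (complex^3^3) set set" and A x y
      using that by blast
    from this[OF ne, of quot_proj triv_mirror]
    have "carrier (isotropy p) = {\<one>\<^bsub>isotropy p\<^esub>} \<longleftrightarrow> (\<forall>g\<in>?S. quot_proj g = triv_mirror)"
      by (simp only: car one)
    also have "\<dots> \<longleftrightarrow> (\<forall>g\<in>?S. g \<in> triv_mirror)" by (intro ball_cong refl qp)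
    finally show ?thesis .
  qed
  then show ?thesis
    unfolding isotropic_points_def stabilizer_def by blast
qed

section \<open>Orbits\<close>

abbreviation Orb :: "complex \<Rightarrow> (complex^3) set set" where
  "Orb w \<equiv> orbit stab_mirror act (Pt w)"

lemma Orb_eqI:
  assumes g: "g \<in> carrier stab_mirror" and gw: "act g (Pt w) = Pt w'"
  shows "Orb w' = Orb w"
proof -
  have inv: "act (inv\<^bsub>stab_mirror\<^esub> g) (Pt w') = Pt w"
    using stab_act[OF stab.inv_closed[OF g] g, of w] stab.l_inv[OF g] gw by (simp add: Pt_def)
  have "Orb u' \<subseteq> Orb u" if "h \<in> carrier stab_mirror" "act h (Pt u) = Pt u'" for h u u'
    unfolding orbit_def
  proof clarify
    fix k assume k: "k \<in> carrier stab_mirror"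
    have "act k (Pt u') = act (k \<otimes>\<^bsub>PUJ_O7\<^esub> h) (Pt u)"
      using stab_act[OF k that(1)] that(2) by simp
    moreover have "k \<otimes>\<^bsub>PUJ_O7\<^esub> h \<in> carrier stab_mirror"
      using stab.m_closed[OF k that(1)] by simp
    ultimately show "\<exists>g. act k (Pt u') = act g (Pt u) \<and> g \<in> carrier stab_mirror" by blast
  qed
  then show ?thesis using g gw inv stab.inv_closed[OF g] by blast
qed

lemma Orb_eqD:
  assumes "Orb w' = Orb w"
  obtains g where "g \<in> carrier stab_mirror" "act g (Pt w) = Pt w'"
proof -
  have "act \<one>\<^bsub>PUJ_O7\<^esub> (Pt w') = Pt w'" by (simp add: Pt_def)
  then have "Pt w' \<in> Orb w'"
    using stab.one_closed unfolding orbit_def by force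
  then show thesis using assms that unfolding orbit_def by auto
qed

lemma Orb_translate: "Im w > 0 \<Longrightarrow> Orb (w + of_int k) = Orb w"
proof (rule Orb_eqI[OF el_stab[OF translate_carrier[of k]]])
  assume w: "Im w > 0"
  have "mob 1 (i_sqrt7 * of_int k) 0 1 w = w + of_int k"
    by (simp add: mob_def field_simps)
  then show "act (el 1 (i_sqrt7 * of_int k) 0 1) (Pt w) = Pt (w + of_int k)"
    using act_el_Pt(2)[OF translate_carrier[of k] w] by simp
qed

lemma Orb_I:
  assumes "Im w > 0"
  shows "Orb (- 1 / (7 * w)) = Orb w" "Im (- 1 / (7 * w)) > 0"
  using Orb_eqI[OF generators_stab(2) act_generators(2)[OF assms]]
    Im_mob_pos[OF generators_carrier(2) assms] by (simp_all only: mob_simps)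

lemma Orb_M:
  assumes "Im w > 0"
  shows "Orb ((7 * w - 4) / (14 * w - 7)) = Orb w" "Im ((7 * w - 4) / (14 * w - 7)) > 0"
  using Orb_eqI[OF generators_stab(3) act_generators(3)[OF assms]]
    Im_mob_pos[OF generators_carrier(3) assms] by (simp_all only: mob_simps)

text \<open>The determinant \<open>D\<close> of the outer block is 1 or -1 and satisfies
  \<open>D * cnj x = x\<close> on the diagonal and \<open>D * cnj x = - x\<close> off it. So each
  entry is an integer or \<open>i_sqrt7\<close> times one. In the coordinate \<open>w\<close>, case
  \<open>even\<close> is \<Gamma>_0(7) and case \<open>odd\<close> the coset of the Fricke
  involution.\<close>

lemma stab_mirror_integral:
  assumes "mat_E a b c d \<in> carrier UJ_O7"
  obtains (even) a' b' c' d' :: int where "a = of_int a'" "b = i_sqrt7 * of_int b'"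
      "c = i_sqrt7 * of_int c'" "d = of_int d'" "a' * d' + 7 * b' * c' = 1"
    | (odd) a' b' c' d' :: int where "a = i_sqrt7 * of_int a'" "b = of_int b'"
      "c = of_int c'" "d = i_sqrt7 * of_int d'" "7 * a' * d' + b' * c' = 1"
proof -
  from assms have R: "a \<in> O7" "b \<in> O7" "c \<in> O7" "d \<in> O7"
    "a * cnj c + c * cnj a = 0" "b * cnj d + d * cnj b = 0" "d * cnj a + b * cnj c = 1"
    by (auto simp: mat_E_carrier_iff)
  have R8: "a * cnj d + c * cnj b = 1" using cnj_unit_eq[OF R(7)] .
  have e5: "c * cnj a = - (a * cnj c)" and e6: "d * cnj b = - (b * cnj d)"
    using R(5,6) by (simp_all add: eq_neg_iff_add_eq_0 add.commute)
  define D where "D = a * d - b * c"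
  \<comment> \<open>By the isotropy relations the squared modulus of the determinant factors into
    the two conjugate pairings, both equal to one.\<close>
  have "D * cnj D = a * d * (cnj a * cnj d) - a * cnj c * d * cnj b - b * cnj d * (c * cnj a) + b * c * (cnj b * cnj c)"
    by (simp add: D_def algebra_simps)
  also have "\<dots> = (d * cnj a + b * cnj c) * (a * cnj d + c * cnj b)"
    using arg_cong[OF e5, of "\<lambda>x. x * d * cnj b"] arg_cong[OF e5, of "\<lambda>x. x * b * cnj d"]
    by (simp add: algebra_simps)
  also have "\<dots> = 1" by (simp add: R(7) R8)
  finally have "D * cnj D = 1" .
  moreover have "D \<in> O7"
    unfolding D_def diff_conv_add_uminus using R by (intro O7_add) (simp_all add: O7_mult)
  ultimately have D: "D = 1 \<or> D = -1" by (intro O7_unit)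
  have "D * cnj d = d * (a * cnj d + c * cnj b)"
    using arg_cong[OF e6, of "\<lambda>x. x * c"] by (simp add: D_def algebra_simps)
  then have d: "D * cnj d = d" by (simp add: R8)
  have "D * cnj a = a * (d * cnj a + b * cnj c)"
    using arg_cong[OF e5, of "\<lambda>x. x * b"] by (simp add: D_def algebra_simps)
  then have a: "D * cnj a = a" by (simp add: R(7))
  have "D * cnj b = - b * (a * cnj d + c * cnj b)"
    using arg_cong[OF e6, of "\<lambda>x. x * a"] by (simp add: D_def algebra_simps)
  then have b: "D * cnj b = - b" by (simp add: R8)
  have "D * cnj c = - c * (d * cnj a + b * cnj c)"
    using arg_cong[OF e5, of "\<lambda>x. x * d"] by (simp add: D_def algebra_simps)
  then have c: "D * cnj c = - c" by (simp add: R(7))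
  from D show thesis
  proof
    assume D1: "D = 1"
    then have "cnj a = a" "cnj d = d" "cnj b = - b" "cnj c = - c" using a b c d by simp_all
    then obtain a' b' c' d' where x: "a = of_int a'" "b = i_sqrt7 * of_int b'"
      "c = i_sqrt7 * of_int c'" "d = of_int d'"
      using O7_real[OF R(1)] O7_imag[OF R(2)] O7_imag[OF R(3)] O7_real[OF R(4)] by metis
    have "of_int (a' * d' + 7 * b' * c') = a * d - (- 7) * (of_int b' * of_int c')"
      by (simp add: x)
    also have "\<dots> = D" unfolding D_def x i_sqrt7_sq[symmetric] by (simp add: algebra_simps)
    finally have "a' * d' + 7 * b' * c' = 1" using D1 by (simp only: of_int_eq_1_iff)
    with x show thesis by (rule even)
  next
    assume D1: "D = -1"
    then have "cnj a = - a" "cnj d = - d" "cnj b = b" "cnj c = c"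
      using a b c d by (simp_all add: minus_equation_iff)
    then obtain a' b' c' d' where x: "a = i_sqrt7 * of_int a'" "b = of_int b'"
      "c = of_int c'" "d = i_sqrt7 * of_int d'"
      using O7_imag[OF R(1)] O7_real[OF R(2)] O7_real[OF R(3)] O7_imag[OF R(4)] by metis
    have "of_int (7 * a' * d' + b' * c') = - ((- 7) * (of_int a' * of_int d') - b * c)"
      by (simp add: x)
    also have "\<dots> = - D" unfolding D_def x i_sqrt7_sq[symmetric] by (simp add: algebra_simps)
    finally have "7 * a' * d' + b' * c' = 1" using D1 by (simp only: of_int_eq_1_iff minus_minus)
    with x show thesis by (rule odd)
  qed
qed

text \<open>Elliptic fixed points are roots of integral quadratic forms, on which the generators act.\<close>

definition form_root :: "int \<Rightarrow> int \<Rightarrow> int \<Rightarrow> complex \<Rightarrow> bool" where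
  "form_root c k b w \<longleftrightarrow> c > 0 \<and> Im w > 0 \<and> 7 * of_int c * w * w + of_int k * w + of_int b = 0"

lemma form_root_translate:
  assumes "form_root c k b w"
  shows "form_root c (k + 14 * c * j) (b + k * j + 7 * c * j * j) (w - of_int j)"
    "Orb (w - of_int j) = Orb w"
proof -
  have "7 * of_int c * (w - of_int j) * (w - of_int j) + of_int (k + 14 * c * j) * (w - of_int j)
      + of_int (b + k * j + 7 * c * j * j) = 7 * of_int c * w * w + of_int k * w + of_int b"
    by (simp add: algebra_simps)
  with assms show "form_root c (k + 14 * c * j) (b + k * j + 7 * c * j * j) (w - of_int j)"
    by (simp add: form_root_def)
  show "Orb (w - of_int j) = Orb w"
    using Orb_translate[of w "- j"] assms by (simp add: form_root_def)
qed

lemma form_root_I: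
  assumes "form_root c k b w" "b > 0"
  shows "form_root b (- k) c (- 1 / (7 * w))"
proof -
  have w: "w \<noteq> 0" "Im w > 0" and eq: "7 * of_int c * w * w + of_int k * w + of_int b = 0"
    using assms(1) by (auto simp: form_root_def)
  have "7 * w * w * (7 * of_int b * (- 1 / (7 * w)) * (- 1 / (7 * w)) + of_int (- k) * (- 1 / (7 * w)) + of_int c)
      = 7 * of_int c * w * w + of_int k * w + of_int b"
    using w(1) by (simp add: field_simps)
  then have "7 * of_int b * (- 1 / (7 * w)) * (- 1 / (7 * w)) + of_int (- k) * (- 1 / (7 * w)) + of_int c = 0"
    using w(1) eq by (metis mult_eq_0_iff zero_neq_numeral)
  then show ?thesis using assms(2) Orb_I(2)[OF w(2)] by (simp only: form_root_def)
qed

text \<open>M sends 1/2 to \<infinity>, so the new leading coefficient is four times the value of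
  the form at 1/2, just as I, which sends 0 to \<infinity>, makes the value at 0 the leading
  one.\<close>

lemma form_root_M:
  assumes "form_root c k b w" "7 * c + 2 * k + 4 * b > 0"
  shows "form_root (7 * c + 2 * k + 4 * b) (- 56 * c - 15 * k - 28 * b) (16 * c + 4 * k + 7 * b)
    ((7 * w - 4) / (14 * w - 7))"
proof -
  have w: "Im w > 0" and eq: "7 * of_int c * w * w + of_int k * w + of_int b = 0"
    using assms(1) by (auto simp: form_root_def)
  define p q where "p = 7 * w - 4" and "q = 14 * w - 7"
  have q: "q \<noteq> 0" using w by (auto simp: q_def complex_eq_iff)
  let ?C = "of_int (7 * c + 2 * k + 4 * b)" and ?K = "of_int (- 56 * c - 15 * k - 28 * b)"
    and ?B = "of_int (16 * c + 4 * k + 7 * b)"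
  have "q * q * (7 * ?C * (p / q) * (p / q) + ?K * (p / q) + ?B) = 7 * ?C * p * p + ?K * p * q + ?B * q * q"
    using q by (simp add: field_simps)
  also have "\<dots> = 7 * (7 * of_int c * w * w + of_int k * w + of_int b)"
    by (simp add: p_def q_def algebra_simps)
  finally have "7 * ?C * (p / q) * (p / q) + ?K * (p / q) + ?B = 0"
    using q eq by (metis mult_eq_0_iff mult_zero_right)
  then show ?thesis using assms(2) Orb_M(2)[OF w] by (simp only: form_root_def p_def q_def)
qed

text \<open>\<open>14 * c * w + k\<close> is not real but has the real square
  \<open>k^2 - 28 * b * c\<close>, so it is purely imaginary.\<close>

lemma form_root_disc:
  assumes eq: "7 * of_int c * w * w + of_int k * w + of_int b = 0" and "Im w > 0" "c \<noteq> 0"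
  shows "28 * b * c - k\<^sup>2 > 0"
proof -
  define z where "z = 14 * of_int c * w + of_int k"
  have "z * z = 28 * of_int c * (7 * of_int c * w * w + of_int k * w + of_int b) - of_int (28 * b * c - k\<^sup>2)"
    by (simp add: z_def power2_eq_square algebra_simps)
  then have zz: "z * z = of_real (- of_int (28 * b * c - k\<^sup>2))" using eq by simp
  have "Im z = 14 * of_int c * Im w" by (simp add: z_def)
  then have Im: "Im z \<noteq> 0" using assms by simp
  have "Im (z * z) = 0" unfolding zz by (rule Im_complex_of_real)
  then have "Re z = 0" using Im by simp
  then have "Re (z * z) = - (Im z)\<^sup>2" by (simp add: power2_eq_square)
  then have "- of_int (28 * b * c - k\<^sup>2) = - (Im z)\<^sup>2" unfolding zz by (simp only: Re_complex_of_real)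
  then have "of_int (28 * b * c - k\<^sup>2) = (Im z)\<^sup>2" by (simp only: neg_equal_iff_equal)
  moreover have "(Im z)\<^sup>2 > 0" using Im by simp
  ultimately have "real_of_int (28 * b * c - k\<^sup>2) > 0" by (simp only:)
  then show ?thesis by (simp only: of_int_0_less_iff)
qed

text \<open>Descent on \<open>c\<close>: the centre of the two conjugate roots is translated into
  one of the two intervals, and I or M then lowers \<open>c\<close> as long as
  \<open>16 * D \<le> 28 * c^2\<close>. The term \<open>D\<close>, absent from the descent on
  matrices, is what the slack in the intervals pays for.\<close>

lemma form_root_reduce:
  assumes "form_root c k b w" "28 * b * c - k\<^sup>2 = D" "D > 0"
  shows "\<exists>c' k' b' w'. form_root c' k' b' w' \<and> 28 * b' * c' - k'\<^sup>2 = D \<and> Orb w' = Orb w \<and> 28 * c'\<^sup>2 < 16 * D"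
  using assms(1,2)
proof (induction "nat c" arbitrary: c k b w rule: less_induct)
  case less
  show ?case
  proof (cases "28 * c\<^sup>2 < 16 * D")
    case True
    then show ?thesis using less.prems by blast
  next
    case False
    have c: "c > 0" using less.prems by (simp add: form_root_def)
    define x where "x = - real_of_int k / (14 * of_int c)"
    obtain j where j: "112 * (x - of_int j)\<^sup>2 < 15 \<or> 28 * (2 * (x - of_int j) - 1)\<^sup>2 < 3"
      by (rule exists_translate)
    define k1 b1 w1 where "k1 = k + 14 * c * j" and "b1 = b + k * j + 7 * c * j * j" and "w1 = w - of_int j"
    note f1 = form_root_translate[OF less.prems(1), of j, folded k1_def b1_def w1_def]
    have D1: "28 * b1 * c - k1\<^sup>2 = D"
      using less.prems(2) by (simp add: k1_def b1_def power2_eq_square algebra_simps)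
    have Im: "Im w1 > 0" using f1(1) by (simp add: form_root_def)
    have b1: "b1 > 0"
    proof -
      have "28 * b1 * c = k1\<^sup>2 + D" using D1 by simp
      then have "b1 * c > 0" using assms(3) zero_le_power2[of k1] by linarith
      then show ?thesis using c by (simp add: zero_less_mult_iff)
    qed
    have xj: "x - of_int j = - of_int k1 / (14 * of_int c)"
      using c by (simp add: x_def k1_def field_simps)
    have c2: "(real_of_int c)\<^sup>2 > 0" using c by simp
    have "\<exists>c' k' b' w'. form_root c' k' b' w' \<and> 28 * b' * c' - k'\<^sup>2 = D \<and> Orb w' = Orb w1 \<and> nat c' < nat c"
    proof (cases "112 * (x - of_int j)\<^sup>2 < 15")
      case True
      then have "112 * (of_int k1)\<^sup>2 < 15 * (196 * (real_of_int c)\<^sup>2)"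
        unfolding xj using c2 by (simp add: power_divide power_mult_distrib field_simps)
      then have "real_of_int (112 * k1\<^sup>2) < of_int (15 * (196 * c\<^sup>2))" by simp
      then have "112 * k1\<^sup>2 < 15 * (196 * c\<^sup>2)" unfolding of_int_less_iff .
      \<comment> \<open>\<open>28 b1 c = k1^2 + D\<close>, where the square is below 15/16 of
        \<open>28 c^2\<close> and \<open>D\<close> is at most the remaining 1/16.\<close>
      then have "28 * b1 * c < 28 * c\<^sup>2" using D1 False by linarith
      then have "b1 < c" using c by (simp add: power2_eq_square)
      then have "nat b1 < nat c" using b1 by simp
      moreover have "28 * c * b1 - (- k1)\<^sup>2 = D" using D1 by (simp add: mult.commute mult.left_commute)
      ultimately show ?thesis
        using form_root_I[OF f1(1) b1] Orb_I(1)[OF Im] by blast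
    next
      case nt: False
      then have "28 * (2 * (x - of_int j) - 1)\<^sup>2 < 3" using j by blast
      moreover have "2 * (x - of_int j) - 1 = - ((of_int k1 + 7 * of_int c) / (7 * of_int c))"
        unfolding xj using c by (simp add: field_simps)
      ultimately have "28 * ((of_int k1 + 7 * of_int c) / (7 * real_of_int c))\<^sup>2 < 3"
        by (simp only: power2_minus)
      then have "28 * (of_int k1 + 7 * of_int c)\<^sup>2 < 3 * (49 * (real_of_int c)\<^sup>2)"
        using c2 by (simp add: power_divide power_mult_distrib pos_divide_less_eq)
      then have "real_of_int (28 * (k1 + 7 * c)\<^sup>2) < of_int (3 * (49 * c\<^sup>2))" by simp
      then have *: "28 * (k1 + 7 * c)\<^sup>2 < 3 * (49 * c\<^sup>2)" unfolding of_int_less_iff .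
      let ?c = "7 * c + 2 * k1 + 4 * b1"
      have cc: "28 * (c * ?c) = 4 * (k1 + 7 * c)\<^sup>2 + 4 * D"
        unfolding D1[symmetric] by (simp add: power2_eq_square algebra_simps)
      then have "c * ?c > 0" using assms(3) zero_le_power2[of "k1 + 7 * c"] by linarith
      then have pos: "?c > 0" using c by (simp add: zero_less_mult_iff)
      \<comment> \<open>Here the square contributes less than 3/4 of \<open>28 c^2\<close>, and
        \<open>4 D\<close> at most 1/4.\<close>
      have "28 * (c * ?c) < 28 * c\<^sup>2" using cc * False by linarith
      then have "?c < c" using c by (simp add: power2_eq_square)
      then have "nat ?c < nat c" using pos by simp
      moreover have "28 * (16 * c + 4 * k1 + 7 * b1) * ?c - (- 56 * c - 15 * k1 - 28 * b1)\<^sup>2 = D"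
        unfolding D1[symmetric] by (simp add: power2_eq_square algebra_simps)
      ultimately show ?thesis
        using form_root_M[OF f1(1) pos] Orb_M(1)[OF Im] by blast
    qed
    then obtain c' k' b' w' where n: "form_root c' k' b' w'" "28 * b' * c' - k'\<^sup>2 = D"
      "Orb w' = Orb w1" "nat c' < nat c" by blast
    from less.hyps[OF n(4) n(1,2)] show ?thesis using n(3) f1(2) by metis
  qed
qed

text \<open>Reduction leaves \<open>c = 1\<close>, where a translation changes \<open>k\<close> by
  multiples of 14. Among the residues, only 5 and -5 satisfy \<open>k^2 = -3\<close> modulo 28, and
  I exchanges them.\<close>

lemma Orb_disc3:
  assumes "form_root c k b w" "28 * b * c - k\<^sup>2 = 3"
  shows "Orb w = Orb wT"
proof -
  obtain c1 k1 b1 w1 where 1: "form_root c1 k1 b1 w1" "28 * b1 * c1 - k1\<^sup>2 = 3"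
    "Orb w1 = Orb w" "28 * c1\<^sup>2 < 16 * 3"
    using form_root_reduce[OF assms] by auto
  have "c1 > 0" using 1(1) by (simp add: form_root_def)
  have "c1 < 2"
  proof (rule ccontr)
    assume "\<not> c1 < 2"
    then have "2\<^sup>2 \<le> c1\<^sup>2" by (intro power_mono) auto
    with 1(4) show False by simp
  qed
  with \<open>c1 > 0\<close> have c1: "c1 = 1" by simp
  \<comment> \<open>This translation replaces \<open>k1\<close> by its residue modulo 14 between -7
    and 6.\<close>
  define j where "j = - ((k1 + 7) div 14)"
  define k2 b2 w2 where "k2 = k1 + 14 * j" and "b2 = b1 + k1 * j + 7 * j * j" and "w2 = w1 - of_int j"
  have f2: "form_root 1 k2 b2 w2" and O2: "Orb w2 = Orb w1"
    using form_root_translate[OF 1(1), of j] by (simp_all add: k2_def b2_def w2_def c1)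
  have "28 * b2 - k2\<^sup>2 = 3"
    using 1(2) by (simp add: k2_def b2_def c1 power2_eq_square algebra_simps)
  then have eq: "k2 * k2 = 28 * b2 - 3" by (simp add: power2_eq_square)
  have "k2 = (k1 + 7) mod 14 - 7"
    using div_mult_mod_eq[of "k1 + 7" 14] unfolding k2_def j_def by linarith
  then have "k2 \<ge> - 7" "k2 \<le> 6" by simp_all
  then have "k2 \<in> {- 7, - 6, - 5, - 4, - 3, - 2, - 1, 0, 1, 2, 3, 4, 5, 6}" by simp presburger
  then have "k2 = 5 \<or> k2 = - 5"
    using eq by (elim insertE emptyE; simp; presburger)
  then have b2: "b2 = 1" using eq by auto
  have Im2: "Im w2 > 0" using f2 by (simp add: form_root_def)
  from \<open>k2 = 5 \<or> k2 = - 5\<close> have "Orb w2 = Orb wT"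
  proof
    \<comment> \<open>Both outer coefficients are 1, so I only changes the sign of the middle
      one.\<close>
    assume k: "k2 = 5"
    have "form_root 1 (- 5) 1 (- 1 / (7 * w2))"
      using form_root_I[OF f2] k b2 by simp
    then have "- 1 / (7 * w2) = wT"
      using root_base(3)[OF Orb_I(2)[OF Im2]] by (simp add: form_root_def)
    then show ?thesis using Orb_I(1)[OF Im2] by simp
  next
    assume k: "k2 = - 5"
    then have "w2 = wT" using f2 root_base(3)[OF Im2] b2 by (simp add: form_root_def)
    then show ?thesis by simp
  qed
  then show ?thesis using O2 1(3) by simp
qed

text \<open>Reduction leaves \<open>c\<close> in 1, 2, 3, and \<open>k = 14 a\<close> turns the
  condition into \<open>b c = 7 a^2 + 1\<close>. The value 1 leads to \<open>wI\<close>, and 2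
  forces \<open>a\<close> odd and leads to \<open>wM\<close>.\<close>

lemma Orb_disc28:
  assumes "form_root c k b w" "28 * b * c - k\<^sup>2 = 28"
  shows "Orb w = Orb wI \<or> Orb w = Orb wM"
proof -
  obtain c1 k1 b1 w1 where 1: "form_root c1 k1 b1 w1" "28 * b1 * c1 - k1\<^sup>2 = 28"
    "Orb w1 = Orb w" "28 * c1\<^sup>2 < 16 * 28"
    using form_root_reduce[OF assms] by auto
  have "c1 > 0" using 1(1) by (simp add: form_root_def)
  have "c1 < 4"
  proof (rule ccontr)
    assume "\<not> c1 < 4"
    then have "4\<^sup>2 \<le> c1\<^sup>2" by (intro power_mono) auto
    with 1(4) show False by simp
  qed
  have "k1 * k1 = 28 * (b1 * c1 - 1)" using 1(2) by (simp add: power2_eq_square algebra_simps)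
  then have "2 dvd k1 * k1" "7 dvd k1 * k1" by simp_all
  then have "2 dvd k1" "7 dvd k1" by (simp_all add: prime_dvd_mult_iff)
  then have "14 dvd k1" by presburger
  then obtain a where a: "k1 = 14 * a" by blast
  then have eq: "b1 * c1 = 7 * (a * a) + 1" using 1(2) by (simp add: power2_eq_square algebra_simps)
  have "c1 = 1 \<or> c1 = 2 \<or> c1 = 3" using \<open>c1 > 0\<close> \<open>c1 < 4\<close> by auto
  then consider "c1 = 1" | "c1 = 2" | "c1 = 3" by blast
  then have "Orb w1 = Orb wI \<or> Orb w1 = Orb wM"
  proof cases
    case 1
    have "form_root 1 0 1 (w1 - of_int (- a))" "Orb (w1 - of_int (- a)) = Orb w1"
      using form_root_translate[OF \<open>form_root c1 k1 b1 w1\<close>, of "- a"] eq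
      by (simp_all add: 1 a algebra_simps)
    moreover from this have "w1 - of_int (- a) = wI"
      using root_base(1)[of "w1 - of_int (- a)"] by (simp add: form_root_def)
    ultimately show ?thesis by simp
  next
    case 2
    have "7 * (a * a) = 2 * b1 - 1" using eq 2 by simp
    moreover have "odd (2 * b1 - 1)" by simp
    ultimately have "odd (7 * (a * a))" by metis
    then have "odd a" by simp
    then obtain m where m: "a = 2 * m + 1" by (rule oddE)
    have b1: "b1 = 14 * m * m + 14 * m + 4" using eq 2 by (simp add: m algebra_simps)
    \<comment> \<open>For \<open>c = 2\<close> a translation moves \<open>k\<close> in steps of 28,
      here from \<open>28 m + 14\<close> to -14.\<close>
    define u where "u = w1 - of_int (- (m + 1))"
    have *: "k1 + 14 * c1 * (- (m + 1)) = - 14"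
        "b1 + k1 * (- (m + 1)) + 7 * c1 * (- (m + 1)) * (- (m + 1)) = 4"
      by (simp_all add: 2 a m b1 algebra_simps)
    have "form_root 2 (- 14) 4 u" "Orb u = Orb w1"
      using form_root_translate[OF \<open>form_root c1 k1 b1 w1\<close>, of "- (m + 1)"]
      unfolding 2 *[unfolded 2] u_def by simp_all
    moreover from this have "u = wM"
      using root_base(2)[of u] by (simp add: form_root_def)
    ultimately show ?thesis by simp
  next
    case 3
    \<comment> \<open>\<open>7 a^2 + 1\<close> is 1 or 2 modulo 3, never 0.\<close>
    have "a mod 3 = 0 \<or> a mod 3 = 1 \<or> a mod 3 = 2" by presburger
    then have "(a mod 3 * (a mod 3)) mod 3 = 0 \<or> (a mod 3 * (a mod 3)) mod 3 = 1" by auto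
    then have "(a * a) mod 3 = 0 \<or> (a * a) mod 3 = 1" by (simp only: mod_mult_eq)
    moreover have "b1 * 3 = 7 * (a * a) + 1" using eq 3 by simp
    ultimately have False by presburger
    then show ?thesis ..
  qed
  then show ?thesis using 1(3) by simp
qed

lemma form_Orb:
  assumes eq: "7 * of_int c * w * w + of_int k * w + of_int b = 0" and "Im w > 0" "c \<noteq> 0"
    and D: "28 * b * c - k\<^sup>2 \<in> {3, 28}"
  shows "Orb w \<in> {Orb wI, Orb wM, Orb wT}"
proof (cases "c > 0")
  case True
  then have "form_root c k b w" using assms by (simp add: form_root_def)
  then show ?thesis using D Orb_disc3 Orb_disc28 by blast
next
  case False
  have "7 * of_int (- c) * w * w + of_int (- k) * w + of_int (- b) =
      - (7 * of_int c * w * w + of_int k * w + of_int b)"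
    by (simp add: algebra_simps)
  then have "form_root (- c) (- k) (- b) w"
    using False assms(2,3) by (simp only: form_root_def eq) simp
  moreover have "28 * (- b) * (- c) - (- k)\<^sup>2 \<in> {3, 28}" using D by simp
  ultimately show ?thesis using Orb_disc3 Orb_disc28 by blast
qed

text \<open>The fixed-point equation is an integral form in \<open>w\<close>. Its positive
  discriminant term equals 4 minus the squared trace, respectively 28 minus 49 times the square of
  \<open>a' + d'\<close>, which bounds the trace.\<close>

lemma nontrivial_isotropy_Orb:
  assumes g: "g \<in> carrier stab_mirror" "g \<notin> triv_mirror" "act g (Pt w) = Pt w" and w: "Im w > 0"
  shows "Orb w \<in> {Orb wI, Orb wM, Orb wT}"
proof -
  obtain a b c d where E: "mat_E a b c d \<in> carrier UJ_O7" and ge: "g = el a b c d"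
    using g(1) by (rule carrier_stab_mirrorE)
  have "mob a b c d w = w"
    using g(3) act_el_Pt(2)[OF E w] by (simp add: ge)
  then have fix_eq: "a * i_sqrt7 * w + b = w * (i_sqrt7 * (c * i_sqrt7 * w + d))"
    using act_el_Pt(1)[OF E w] unfolding mob_def by (simp only: divide_eq_eq, simp)
  from E show ?thesis
  proof (cases rule: stab_mirror_integral)
    case (even a' b' c' d')
    have "i_sqrt7 * (of_int a' * w + of_int b') = i_sqrt7 * (w * (i_sqrt7 * i_sqrt7 * of_int c' * w + of_int d'))"
      using fix_eq by (simp add: even algebra_simps)
    then have "of_int a' * w + of_int b' = w * (i_sqrt7 * i_sqrt7 * of_int c' * w + of_int d')"
      by (rule mult_left_cancel[OF i_sqrt7_nonzero, THEN iffD1])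
    then have eq: "7 * of_int c' * w * w + of_int (a' - d') * w + of_int b' = 0"
      by (simp add: i_sqrt7_sq algebra_simps)
    have "c' \<noteq> 0"
    proof
      assume c: "c' = 0"
      have "of_int (a' - d') * Im w = 0" using arg_cong[OF eq, of Im] by (simp add: c)
      then have "real_of_int (a' - d') = 0" using w by simp
      then have ad: "a' = d'" by (simp only: of_int_eq_0_iff eq_iff_diff_eq_0[symmetric])
      with eq c have b: "b' = 0" by simp
      have "a' * a' = 1" using even(5) c ad by simp
      then have "a' = 1 \<or> a' = -1" by (metis zmult_eq_1_iff)
      then have "g \<in> triv_mirror"
        using even ad b c by (auto simp: ge triv_mirror_eq el_one generators_el)
      with g(2) show False by blast
    qed
    have D: "28 * b' * c' - (a' - d')\<^sup>2 = 4 - (a' + d')\<^sup>2"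
      using even(5) by (simp add: power2_eq_square algebra_simps)
    then have "(a' + d')\<^sup>2 < 2\<^sup>2" using form_root_disc[OF eq w \<open>c' \<noteq> 0\<close>] by simp
    then have "\<bar>a' + d'\<bar> < 2"
      using power_less_imp_less_base[of "\<bar>a' + d'\<bar>" 2 2] by simp
    then have "a' + d' = 0 \<or> a' + d' = 1 \<or> a' + d' = -1" by auto
    \<comment> \<open>Trace zero would make -1 a square modulo 7.\<close>
    moreover have "a' + d' \<noteq> 0"
    proof
      assume "a' + d' = 0"
      then have "d' = - a'" by simp
      then have "a' * a' = 7 * (b' * c') - 1" using even(5) by (simp add: algebra_simps)
      then have "(a' * a') mod 7 = 6" by presburger
      then have "((a' mod 7) * (a' mod 7)) mod 7 = 6" by (simp add: mod_mult_eq)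
      moreover have "a' mod 7 \<in> {0, 1, 2, 3, 4, 5, 6}"
        using pos_mod_bound[of 7 a'] pos_mod_sign[of 7 a'] by auto
      ultimately show False by auto
    qed
    ultimately have "(a' + d')\<^sup>2 = 1" by auto
    with D show ?thesis using form_Orb[OF eq w \<open>c' \<noteq> 0\<close>] by simp
  next
    case (odd a' b' c' d')
    have "i_sqrt7 * i_sqrt7 * of_int a' * w + of_int b' = w * (i_sqrt7 * i_sqrt7 * (of_int c' * w + of_int d'))"
      using fix_eq by (simp add: odd algebra_simps)
    then have eq: "7 * of_int c' * w * w + of_int (7 * (d' - a')) * w + of_int b' = 0"
      by (simp add: i_sqrt7_sq algebra_simps)
    have "c' \<noteq> 0"
    proof
      \<comment> \<open>In this coset the determinant condition would make 1 a multiple of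
        7.\<close>
      assume "c' = 0"
      then have "7 * (a' * d') = 1" using odd(5) by simp
      then show False by presburger
    qed
    have D: "28 * b' * c' - (7 * (d' - a'))\<^sup>2 = 28 - 49 * (a' + d')\<^sup>2"
      using odd(5) by (simp add: power2_eq_square algebra_simps)
    then have "(a' + d')\<^sup>2 < 1" using form_root_disc[OF eq w \<open>c' \<noteq> 0\<close>] by simp
    then have "a' + d' = 0" by (simp add: power2_less_1_iff)
    with D show ?thesis using form_Orb[OF eq w \<open>c' \<noteq> 0\<close>] by simp
  qed
qed

section \<open>Separation of the three orbits by imaginary parts\<close>

lemma stab_mirror_Im:
  assumes g: "g \<in> carrier stab_mirror" "act g (Pt w) = Pt w'" and w: "Im w > 0"
  obtains c d :: int where "Im w' * (cmod (of_int d - 7 * of_int c * w))\<^sup>2 = Im w"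
    | c d :: int where "Im w' * (7 * (cmod (of_int c * w + of_int d))\<^sup>2) = Im w"
proof -
  obtain a b c d where E: "mat_E a b c d \<in> carrier UJ_O7" and ge: "g = el a b c d"
    using g(1) by (rule carrier_stab_mirrorE)
  have "mob a b c d w = w'"
    using g(2) act_el_Pt(2)[OF E w] by (simp add: ge)
  then have Im: "Im w' * (cmod (c * i_sqrt7 * w + d))\<^sup>2 = Im w"
    using act_el_Pt(3)[OF E w] by simp
  from E show thesis
  proof (cases rule: stab_mirror_integral)
    case (even a' b' c' d')
    have "c * i_sqrt7 * w + d = i_sqrt7 * i_sqrt7 * of_int c' * w + of_int d'"
      by (simp add: even algebra_simps)
    also have "\<dots> = of_int d' - 7 * of_int c' * w" by (simp add: i_sqrt7_sq)
    finally show ?thesis using Im that(1) by metis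
  next
    case (odd a' b' c' d')
    have "c * i_sqrt7 * w + d = i_sqrt7 * (of_int c' * w + of_int d')"
      by (simp add: odd algebra_simps)
    then have "(cmod (c * i_sqrt7 * w + d))\<^sup>2 = 7 * (cmod (of_int c' * w + of_int d'))\<^sup>2"
      by (simp add: norm_mult power_mult_distrib i_sqrt7_def)
    then show ?thesis using Im that(2) by metis
  qed
qed

lemma sqrt_eq_sqrt_mult_iff:
  assumes "sqrt 3 * of_int n = of_int m * sqrt 7"
  shows "3 * (n * n) = 7 * (m * m)"
proof -
  have "(sqrt 3 * of_int n)\<^sup>2 = (of_int m * sqrt 7)\<^sup>2" using assms by simp
  then have "real_of_int (3 * (n * n)) = of_int (7 * (m * m))"
    by (simp add: power_mult_distrib) (simp add: power2_eq_square mult.commute)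
  then show ?thesis by (simp only: of_int_eq_iff)
qed

text \<open>Both cosets yield the same quadratic form, with the roles of \<open>c\<close> and
  \<open>d\<close> exchanged, since I lies in the Fricke coset and fixes \<open>wI\<close>.\<close>

lemma stab_mirror_Im_wI:
  assumes "g \<in> carrier stab_mirror" "act g (Pt wI) = Pt w'"
  obtains c d :: int where "Im w' * of_int (d * d + 7 * (c * c)) = sqrt 7 / 7"
proof -
  have "Im wI > 0" by simp
  with assms show thesis
  proof (cases rule: stab_mirror_Im)
    case (1 c d)
    have "(cmod (of_int d - 7 * of_int c * wI))\<^sup>2 = of_int (d * d + 7 * (c * c))"
      by (simp add: cmod_power2 wI_def power_mult_distrib) (simp add: power2_eq_square)
    with 1 that show thesis by (simp only: Im_base)
  next
    case (2 c d)
    have "7 * (cmod (of_int c * wI + of_int d))\<^sup>2 = of_int (c * c + 7 * (d * d))"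
      by (simp add: cmod_power2 wI_def power_mult_distrib power_divide) (simp add: power2_eq_square)
    with 2 that show thesis by (simp only: Im_base)
  qed
qed

lemma stab_mirror_Im_wM:
  assumes "g \<in> carrier stab_mirror" "act g (Pt wM) = Pt w'"
  obtains n :: int where "Im w' * of_int n = sqrt 7 / 14"
proof -
  have "Im wM > 0" by simp
  with assms show thesis
  proof (cases rule: stab_mirror_Im)
    case (1 c d)
    have "(cmod (of_int d - 7 * of_int c * wM))\<^sup>2 = (of_int d - of_int c * 7 / 2)\<^sup>2 + (of_int c)\<^sup>2 * 7 / 4"
      by (simp add: cmod_power2 wM_def power_mult_distrib power_divide)
    also have "\<dots> = of_int (d * d - 7 * (c * d) + 14 * (c * c))"
      by (simp add: power2_eq_square field_simps)
    finally show thesis using 1 that by (simp only: Im_base)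
  next
    case (2 c d)
    have "7 * (cmod (of_int c * wM + of_int d))\<^sup>2 = 7 * ((of_int c / 2 + of_int d)\<^sup>2 + (of_int c)\<^sup>2 * 7 / 196)"
      by (simp add: cmod_power2 wM_def power_mult_distrib power_divide)
    also have "\<dots> = of_int (2 * (c * c) + 7 * (c * d) + 7 * (d * d))"
      by (simp add: power2_eq_square field_simps)
    finally show thesis using 2 that by (simp only: Im_base)
  qed
qed

text \<open>\<open>Im wI\<close> is twice \<open>Im wM\<close>, but 2 is not of the form
  \<open>d^2 + 7 c^2\<close>. The ratios of \<open>Im wI\<close> and \<open>Im wM\<close> to
  \<open>Im wT\<close> are irrational, whereas within an orbit they would be integers.\<close>

lemma Orb_distinct: "Orb wM \<noteq> Orb wI" "Orb wT \<noteq> Orb wI" "Orb wT \<noteq> Orb wM"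
proof -
  show "Orb wM \<noteq> Orb wI"
  proof
    assume "Orb wM = Orb wI"
    then obtain g where "g \<in> carrier stab_mirror" "act g (Pt wI) = Pt wM" by (rule Orb_eqD)
    then obtain c d :: int where "Im wM * of_int (d * d + 7 * (c * c)) = sqrt 7 / 7"
      by (rule stab_mirror_Im_wI)
    then have "sqrt 7 * of_int (d * d + 7 * (c * c)) = sqrt 7 * of_int 2" by simp
    then have eq: "d * d + 7 * (c * c) = 2"
      by (subst (asm) mult_left_cancel) (simp, simp only: of_int_eq_iff)
    have "c * c \<ge> 0" "d * d \<ge> 0" by simp_all
    with eq have "c * c = 0" by linarith
    with eq have "d * d = 2" by simp
    then have "even d" by (metis even_mult_iff even_numeral)
    then obtain e where "d = 2 * e" by blast
    with \<open>d * d = 2\<close> have "2 * (e * e) = 1" by simp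
    then show False by presburger
  qed
  show "Orb wT \<noteq> Orb wI"
  proof
    assume "Orb wT = Orb wI"
    then obtain g where "g \<in> carrier stab_mirror" "act g (Pt wI) = Pt wT" by (rule Orb_eqD)
    then obtain c d :: int where "Im wT * of_int (d * d + 7 * (c * c)) = sqrt 7 / 7"
      by (rule stab_mirror_Im_wI)
    then have "sqrt 3 * of_int (d * d + 7 * (c * c)) = of_int 2 * sqrt 7" by simp
    from sqrt_eq_sqrt_mult_iff[OF this] show False by presburger
  qed
  show "Orb wT \<noteq> Orb wM"
  proof
    assume "Orb wT = Orb wM"
    then obtain g where "g \<in> carrier stab_mirror" "act g (Pt wM) = Pt wT" by (rule Orb_eqD)
    then obtain n :: int where "Im wT * of_int n = sqrt 7 / 14"
      by (rule stab_mirror_Im_wM)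
    then have "sqrt 3 * of_int n = of_int 1 * sqrt 7" by simp
    from sqrt_eq_sqrt_mult_iff[OF this] show False by presburger
  qed
qed

lemma Orb_isotropic: "orbit stab_mirror act ` isotropic_points = {Orb wI, Orb wM, Orb wT}"
proof
  show "orbit stab_mirror act ` isotropic_points \<subseteq> {Orb wI, Orb wM, Orb wT}"
  proof (rule image_subsetI)
    fix p assume "p \<in> isotropic_points"
    then obtain w g where "p = Pt w" "Im w > 0" "g \<in> carrier stab_mirror" "g \<notin> triv_mirror" "act g p = p"
      unfolding isotropic_points_iff mirror_R_eq by blast
    then show "orbit stab_mirror act p \<in> {Orb wI, Orb wM, Orb wT}"
      using nontrivial_isotropy_Orb by simp
  qed
  have "elI \<notin> triv_mirror" "elM \<notin> triv_mirror" "el_tau \<notin> triv_mirror"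
    by (simp_all add: triv_mirror_eq el_one generators_el el_eq_iff el_tau_eq(1)[unfolded generators_el])
  moreover have "act elI (Pt wI) = Pt wI" "act elM (Pt wM) = Pt wM" "act el_tau (Pt wT) = Pt wT"
    by (simp_all add: act_fix_iff)
  moreover have "Pt wI \<in> mirror_R" "Pt wM \<in> mirror_R" "Pt wT \<in> mirror_R"
    by (simp_all add: mirror_R_eq)
  ultimately have "Pt wI \<in> isotropic_points" "Pt wM \<in> isotropic_points" "Pt wT \<in> isotropic_points"
    unfolding isotropic_points_iff using generators_stab(2,3) el_tau_stab by metis+
  then show "{Orb wI, Orb wM, Orb wT} \<subseteq> orbit stab_mirror act ` isotropic_points"
    by (intro insert_subsetI imageI empty_subsetI)
qed

theorem mainTheorem3:
  shows "mirror_R = polar_line (vector [0, 1, 0])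
    \<and> has_presentation quot_mirror gens_quot rels_quot (\<lambda>x. quot_proj (gen_elt x))
    \<and> central_extension stab_mirror quot_mirror quot_proj
    \<and> has_presentation stab_mirror gens_stab rels_stab gen_elt
    \<and> (\<exists>pI pM pT.
          mirror_R \<inter> fixed_points elI \<inter> fixed_points elR = {pI}
        \<and> isolated_fixed_points elM = {pM}
        \<and> isolated_fixed_points (elM \<otimes>\<^bsub>PUJ_O7\<^esub> elTv \<otimes>\<^bsub>PUJ_O7\<^esub> elI) = {pT}
        \<and> orbit stab_mirror act ` isotropic_points =
            {orbit stab_mirror act pI, orbit stab_mirror act pM, orbit stab_mirror act pT}
        \<and> card (orbit stab_mirror act ` isotropic_points) = 3)"
proof (intro conjI exI)
  show "mirror_R = polar_line (vector [0, 1, 0])"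
    by (simp only: mirror_R_eq polar_line_eq)
  show "has_presentation quot_mirror gens_quot rels_quot (\<lambda>x. quot_proj (gen_elt x))"
    by (rule presentation_quot_mirror)
  show "central_extension stab_mirror quot_mirror quot_proj"
    by (rule central_extension_stab)
  show "has_presentation stab_mirror gens_stab rels_stab gen_elt"
    by (rule presentation_stab_mirror)
  \<comment> \<open>The matrix of I fixes the middle basis vector and the negative vector
    \<open>(1, 0, -1)\<close>, so I has a whole complex line of fixed points. Its point is therefore
    singled out by intersection with the mirror, not as an isolated fixed point.\<close>
  show "mirror_R \<inter> fixed_points elI \<inter> fixed_points elR = {Pt wI}"
  proof (intro equalityI subsetI)
    fix p assume p: "p \<in> mirror_R \<inter> fixed_points elI \<inter> fixed_points elR"
    then obtain w where w: "p = Pt w" "Im w > 0" unfolding mirror_R_eq by blast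
    have "act elI (Pt w) = Pt w" using p w(1) by (simp add: fixed_points_def)
    with w show "p \<in> {Pt wI}" using act_fix_iff(1) by simp
  next
    fix p assume "p \<in> {Pt wI}"
    moreover have "Pt wI \<in> mirror_R" by (simp add: mirror_R_eq)
    moreover have "Pt wI \<in> fixed_points elI" by (simp add: fixed_points_def act_fix_iff)
    ultimately show "p \<in> mirror_R \<inter> fixed_points elI \<inter> fixed_points elR"
      by (simp add: mirror_R_def)
  qed
  show "isolated_fixed_points elM = {Pt wM}" "isolated_fixed_points el_tau = {Pt wT}"
    by (intro isolated_fixed_points_singleton fixed_points_elM fixed_points_el_tau)+
  show "orbit stab_mirror act ` isotropic_points = {Orb wI, Orb wM, Orb wT}"
    by (rule Orb_isotropic)
  show "card (orbit stab_mirror act ` isotropic_points) = 3"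
    unfolding Orb_isotropic using Orb_distinct by simp
qed

end
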